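(* Let $H=\{z:\operatorname{Im} z>0\}$ be the upper half-plane and let $E\subset H$ be a bounded set that is relatively closed in $H$. Then the relative capacity $\operatorname{relcap} E$ of $E$ with respect to $H$ at the point $z_0=\infty$ equals the half-plane capacity of $E$: $$\operatorname{relcap} E=\operatorname{hcap} E .$$
   Context: For an open set $G\subset\overline{\mathbb C}$ and a finite point $z\in G$, $r(G,z)$ denotes the inner radius at $z$ of the connected component $G_z$ of $G$ containing $z$: $\log r(G,z)=\lim_{w\to z}\bigl(g_{G_z}(w,z)+\log|w-z|\bigr)$, where $g_{G_z}(\cdot,z)$ is the Green function of $G_z$ with pole at $z$. The relative capacity $\operatorname{relcap}E$ of $E$ with respect to $H$ at $\infty$ is the (existing and unique) real number defined by the asymptotic expansion $$\frac{r(H\setminus E,z)}{r(H,z)}=1-2(\operatorname{relcap}E)\,|1/z|^2+o(|1/z|^2),\qquad z\to\infty,$$ where $z\to\infty$ along arcs in $H$ whose image under $z\mapsto 1/z$ is perpendicular to the real axis at $0$ (for instance $z=iy$, $y\to+\infty$). The half-plane capacity: let $G=H\setminus E$ and $$\phi_G(z)=\operatorname{Im} z-\mathbf E^z[\operatorname{Im}(B_{\tau_G})],$$ where $B_t$ is a standard planar Brownian motion started at $z$, $\tau_G=\inf\{t:B_t\notin G\}$, and $\mathbf E^z$ is the expectation. Then $\phi_G$ is a positive harmonic function on $G$, vanishing at the regular points of $\partial G$, with $\phi_G(z)=\operatorname{Im}z+O(|z|^{-1})$ as $z\to\infty$. The half-plane capacity $\operatorname{hcap}E$ is the real number defined by $$\phi_G(z)=\operatorname{Im}\Bigl(z+\frac{\operatorname{hcap}E}{z}\Bigr)+o(|z|^{-1}),\qquad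 z\to\infty .$$ *)

theory Defs
  imports "HOL-Probability.Probability" "HOL-Complex_Analysis.Complex_Analysis"
begin

definition upper_half_plane :: "complex set" where
  "upper_half_plane = {z. 0 < Im z}"


(* C^2 with u_xx + u_yy = 0. *)
definition harmonic_on :: "(complex \<Rightarrow> real) \<Rightarrow> complex set \<Rightarrow> bool" where
  "harmonic_on u S \<longleftrightarrow> open S \<and>
     (\<exists>ux uy uxx uxy uyx uyy.
        continuous_on S uxx \<and> continuous_on S uxy \<and>
        continuous_on S uyx \<and> continuous_on S uyy \<and>
        (\<forall>z\<in>S.
           (u has_derivative (\<lambda>h. ux z * Re h + uy z * Im h)) (at z) \<and>
           (ux has_derivative (\<lambda>h. uxx z * Re h + uxy z * Im h)) (at z) \<and>
           (uy has_derivative (\<lambda>h. uyx z * Re h + uyy z * Im h)) (at z) \<and>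
           uxx z + uyy z = 0))"

(* Nonnegative harmonic functions u on D - {z} for which u(w) + log |w - z| extends to a
   harmonic function near z; the values of u at z and outside D are irrelevant. *)
definition log_pole_majorants :: "complex set \<Rightarrow> complex \<Rightarrow> (complex \<Rightarrow> real) set" where
  "log_pole_majorants D z =
     {u. harmonic_on u (D - {z}) \<and> (\<forall>w \<in> D - {z}. 0 \<le> u w) \<and>
         (\<exists>h. harmonic_on h D \<and> (\<forall>w \<in> D - {z}. u w = h w - ln (cmod (w - z))))}"

(* The Green function g_D(w,z) of a domain D with pole at z, as the least nonnegative harmonic
   function on D - {z} with singularity -log |w - z| at z. This is the usual (generalized) Green
   function, with no regularity assumption on the boundary of D. It is meaningful when the above
   class is nonempty, i.e. when D has a Green function; this is the case for every subdomain of
   the upper half-plane. *)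
definition green_function :: "complex set \<Rightarrow> complex \<Rightarrow> complex \<Rightarrow> real" where
  "green_function D w z = (INF u \<in> log_pole_majorants D z. u w)"

definition inner_radius :: "complex set \<Rightarrow> complex \<Rightarrow> real" where
  "inner_radius G z =
     exp (Lim (at z)
       (\<lambda>w. green_function (connected_component_set G z) w z + ln (cmod (w - z))))"


(* \<gamma> restricted to [0,1) is an arc in the upper half-plane going to infinity as t tends to 1,
   whose image under z \<mapsto> 1/z, completed by the endpoint 0, is perpendicular to the real axis
   at 0. As the image lies in the lower half-plane, its direction at 0 is that of -\<i>. *)
definition perpendicular_arc_to_infinity :: "(real \<Rightarrow> complex) \<Rightarrow> bool" where
  "perpendicular_arc_to_infinity \<gamma> \<longleftrightarrow>
     \<gamma> ` {0..<1} \<subseteq> upper_half_plane \<and>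
     arc (\<lambda>t. if t = 1 then 0 else 1 / \<gamma> t) \<and>
     ((\<lambda>t. sgn (1 / \<gamma> t)) \<longlongrightarrow> - \<i>) (at_left 1)"

definition relcap_expansion :: "complex set \<Rightarrow> real \<Rightarrow> bool" where
  "relcap_expansion E c \<longleftrightarrow>
     (\<forall>\<gamma>. perpendicular_arc_to_infinity \<gamma> \<longrightarrow>
        (\<lambda>t. inner_radius (upper_half_plane - E) (\<gamma> t) / inner_radius upper_half_plane (\<gamma> t)
              - (1 - 2 * c * (cmod (1 / \<gamma> t))\<^sup>2))
          \<in> o[at_left 1](\<lambda>t. (cmod (1 / \<gamma> t))\<^sup>2))"

definition relcap :: "complex set \<Rightarrow> real" where
  "relcap E = (THE c. relcap_expansion E c)"


(* Standard planar Brownian motion started at z, indexed by times t \<ge> 0 (B t is unconstrained for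
   t < 0): continuous paths and independent increments, where B t - B s has two independent
   N(0, t - s) coordinates. *)
definition planar_brownian_motion ::
    "complex \<Rightarrow> 'w measure \<Rightarrow> (real \<Rightarrow> 'w \<Rightarrow> complex) \<Rightarrow> bool" where
  "planar_brownian_motion z M B \<longleftrightarrow>
     prob_space M \<and>
     (\<forall>t\<ge>0. B t \<in> borel_measurable M) \<and>
     (\<forall>\<omega>\<in>space M. B 0 \<omega> = z \<and> continuous_on {0..} (\<lambda>t. B t \<omega>)) \<and>
     (\<forall>s t. 0 \<le> s \<and> s < t \<longrightarrow>
        distributed M lborel (\<lambda>\<omega>. B t \<omega> - B s \<omega>)
          (\<lambda>w. ennreal (normal_density 0 (sqrt (t - s)) (Re w) *
                        normal_density 0 (sqrt (t - s)) (Im w)))) \<and>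
     (\<forall>(n::nat) (t :: nat \<Rightarrow> real). 0 \<le> t 0 \<and> strict_mono t \<longrightarrow>
        prob_space.indep_vars M (\<lambda>_. borel) (\<lambda>i \<omega>. B (t (Suc i)) \<omega> - B (t i) \<omega>) {..<n})"

(* The position at the first exit time inf {t. B t \<notin> G}. Paths that never leave G get the
   arbitrary value 0; they have probability zero when G lies in the upper half-plane. *)
definition exit_position ::
    "complex set \<Rightarrow> (real \<Rightarrow> 'w \<Rightarrow> complex) \<Rightarrow> 'w \<Rightarrow> complex" where
  "exit_position G B \<omega> =
     (if \<exists>t\<ge>0. B t \<omega> \<notin> G then B (Inf {t. 0 \<le> t \<and> B t \<omega> \<notin> G}) \<omega> else 0)"

(* In what follows B z, on the probability space M z, is a Brownian motion started at z. *)

definition phi ::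
    "(complex \<Rightarrow> 'w measure) \<Rightarrow> (complex \<Rightarrow> real \<Rightarrow> 'w \<Rightarrow> complex) \<Rightarrow> complex set \<Rightarrow> complex \<Rightarrow> real" where
  "phi M B G z = Im z - (\<integral>\<omega>. Im (exit_position G (B z) \<omega>) \<partial>M z)"

definition hcap_expansion ::
    "(complex \<Rightarrow> 'w measure) \<Rightarrow> (complex \<Rightarrow> real \<Rightarrow> 'w \<Rightarrow> complex) \<Rightarrow> complex set \<Rightarrow> real \<Rightarrow> bool" where
  "hcap_expansion M B E c \<longleftrightarrow>
     (\<lambda>z. phi M B (upper_half_plane - E) z - Im (z + complex_of_real c / z))
       \<in> o[inf at_infinity (principal (upper_half_plane - E))](\<lambda>z. 1 / cmod z)"

definition hcap ::
    "(complex \<Rightarrow> 'w measure) \<Rightarrow> (complex \<Rightarrow> real \<Rightarrow> 'w \<Rightarrow> complex) \<Rightarrow> complex set \<Rightarrow> real" where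
  "hcap M B E = (THE c. hcap_expansion M B E c)"

end

(*
  Let V(z) be the expected height at which Brownian motion started at z leaves G = H - E. It is obtained
  by potential theory: truncate the height to a superharmonic function that tends to 0 at infinity, and
  sweep it out over discs in G, each visited infinitely often (Poisson modification). The limit V
  is harmonic on G, and optional stopping, applied to the sweeping sequence from above and to V from
  below, identifies it with the expectation. Reflection at infinity gives
  V(z) = c Im z / |z|^2 + o(1/|z|), so c is the half-plane capacity.

  On the other hand, g_H(w,z) = 2 Im w Im z / |z|^2 (1 + o(1)) uniformly for w in E as z tends to infinity.
  By the minimum principle g_H(.,z) - g_G(.,z) therefore lies between two multiples of V, both with factors
  2 Im z / |z|^2 (1 + o(1)). At w = z this says
  log (r(G,z) / r(H,z)) = - 2 Im z V(z) / |z|^2 (1 + o(1)), and the same c appears.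
*)
theory Submission
  imports Defs
begin

section \<open>Circle means and the minimum principle\<close>

text \<open>The boundary of \<open>G\<close> may be irregular, so \<open>V\<close> need not be
  continuous up to it and has no boundary values to compare with. Every comparison therefore runs
  through functions continuous on the whole plane: on one side the swept functions
  \<open>v n\<close>, which still equal the truncated height off \<open>G\<close>, on the other the
  truncated height itself, which dominates \<open>V\<close>; only afterwards does n tend to
  infinity. On the probabilistic side only independent Gaussian increments are at hand, so optional
  stopping is proved on a time grid. Rotation invariance turns a Gaussian average into an average of
  circle means; one step of length s thus raises the expectation of a function with the
  super-mean-value property by at most a tail of order s^2, which survives summation over about 1/s
  steps. The truncation keeps the functions bounded and small at infinity, which disposes of paths
  that stay in \<open>G\<close> for long. Perpendicularity of the arcs means that Im z / |z| tends
  to 1; this turns Im z V(z) / |z|^2 into c / |z|^2 up to smaller terms.\<close>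

definition circle_mean :: "(complex \<Rightarrow> real) \<Rightarrow> complex \<Rightarrow> real \<Rightarrow> real" where
  "circle_mean f a r = integral {0..1} (\<lambda>t. f (circlepath a r t))"

lemma dist_circlepath [simp]: "dist a (circlepath a r t) = \<bar>r\<bar>"
  by (simp add: circlepath dist_norm norm_mult)

lemma norm_circlepath_minus_centre: "cmod (circlepath a r t - a) = \<bar>r\<bar>"
  by (simp add: circlepath norm_mult)

lemma continuous_on_circlepath: "continuous_on S (circlepath a r)"
  unfolding circlepath by (intro continuous_intros)

lemma continuous_on_compose_circlepath:
  assumes "continuous_on (sphere a r) f" "0 \<le> r"
  shows "continuous_on S (\<lambda>t. f (circlepath a r t))"
  using assms
  by (intro continuous_on_compose2[OF assms(1) continuous_on_circlepath]) auto

lemma integrable_compose_circlepath: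
  assumes "continuous_on (sphere a r) f" "0 \<le> r"
  shows "(\<lambda>t. f (circlepath a r t) :: real) integrable_on {0..1}"
  by (intro integrable_continuous_real continuous_on_compose_circlepath assms)

lemma circle_mean_const [simp]: "circle_mean (\<lambda>_. c) a r = c"
  by (simp add: circle_mean_def)

lemma circle_mean_cong:
  assumes "\<And>w. w \<in> sphere a r \<Longrightarrow> f w = g w" "0 \<le> r"
  shows "circle_mean f a r = circle_mean g a r"
  unfolding circle_mean_def by (intro integral_cong) (use assms in auto)

lemma circle_mean_mono:
  assumes "continuous_on (sphere a r) f" "continuous_on (sphere a r) g" "0 \<le> r"
    and "\<And>w. w \<in> sphere a r \<Longrightarrow> f w \<le> g w"
  shows "circle_mean f a r \<le> circle_mean g a r"
  unfolding circle_mean_def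
  by (intro integral_le integrable_compose_circlepath) (use assms in auto)

lemma circle_mean_add:
  assumes "continuous_on (sphere a r) f" "continuous_on (sphere a r) g" "0 \<le> r"
  shows "circle_mean (\<lambda>w. f w + g w) a r = circle_mean f a r + circle_mean g a r"
  unfolding circle_mean_def
  by (intro integral_add integrable_compose_circlepath assms)

lemma circle_mean_cmult: "circle_mean (\<lambda>w. c * f w) a r = c * circle_mean f a r"
  unfolding circle_mean_def by simp

lemma circle_mean_uminus: "circle_mean (\<lambda>w. - f w) a r = - circle_mean f a r"
  unfolding circle_mean_def by simp

text \<open>Only circles of small radius, depending on the point, are tested: in this form the class
  is visibly stable under sums, minima and Poisson modification. The inequality for every closed
  disc in \<open>S\<close> comes back in \<open>supermean_on_circle_mean_le\<close>. The balls
  inside \<open>S\<close> make \<open>S\<close> open.\<close>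

definition supermean_on :: "(complex \<Rightarrow> real) \<Rightarrow> complex set \<Rightarrow> bool" where
  "supermean_on f S \<longleftrightarrow> continuous_on S f \<and>
     (\<forall>a\<in>S. \<exists>\<rho>>0. ball a \<rho> \<subseteq> S \<and> (\<forall>r. 0 < r \<and> r < \<rho> \<longrightarrow> circle_mean f a r \<le> f a))"

lemma supermean_on_imp_continuous: "supermean_on f S \<Longrightarrow> continuous_on S f"
  by (simp add: supermean_on_def)

lemma supermean_on_imp_open: "supermean_on f S \<Longrightarrow> open S"
  unfolding supermean_on_def by (meson openI)

lemma supermean_onE:
  assumes "supermean_on f S" "a \<in> S"
  obtains \<rho> where "\<rho> > 0" "ball a \<rho> \<subseteq> S" "\<And>r. 0 < r \<Longrightarrow> r < \<rho> \<Longrightarrow> circle_mean f a r \<le> f a"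
  using assms unfolding supermean_on_def by blast

lemma sphere_subset_ball: "r < \<rho> \<Longrightarrow> sphere a r \<subseteq> ball a \<rho>"
  by auto

lemma supermean_on_add:
  assumes "supermean_on f S" "supermean_on g S"
  shows "supermean_on (\<lambda>w. f w + g w) S"
  unfolding supermean_on_def
proof (intro conjI ballI)
  show cont: "continuous_on S (\<lambda>w. f w + g w)"
    using assms by (intro continuous_intros supermean_on_imp_continuous)
  fix a assume "a \<in> S"
  obtain \<rho> where r1: "\<rho> > 0" "ball a \<rho> \<subseteq> S" "\<And>r. 0 < r \<Longrightarrow> r < \<rho> \<Longrightarrow> circle_mean f a r \<le> f a"
    using supermean_onE[OF assms(1) \<open>a \<in> S\<close>] by blast
  obtain \<sigma> where r2: "\<sigma> > 0" "ball a \<sigma> \<subseteq> S" "\<And>r. 0 < r \<Longrightarrow> r < \<sigma> \<Longrightarrow> circle_mean g a r \<le> g a"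
    using supermean_onE[OF assms(2) \<open>a \<in> S\<close>] by blast
  show "\<exists>\<rho>>0. ball a \<rho> \<subseteq> S \<and> (\<forall>r. 0 < r \<and> r < \<rho> \<longrightarrow> circle_mean (\<lambda>w. f w + g w) a r \<le> f a + g a)"
  proof (intro exI[of _ "min \<rho> \<sigma>"] conjI allI impI)
    show "0 < min \<rho> \<sigma>" "ball a (min \<rho> \<sigma>) \<subseteq> S" using r1 r2 by auto
    fix r assume r: "0 < r \<and> r < min \<rho> \<sigma>"
    have "sphere a r \<subseteq> S" using r r1(2) sphere_subset_ball[of r \<rho> a] by auto
    hence "circle_mean (\<lambda>w. f w + g w) a r = circle_mean f a r + circle_mean g a r"
      using r assms by (intro circle_mean_add)
        (auto intro: continuous_on_subset supermean_on_imp_continuous)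
    also have "\<dots> \<le> f a + g a" using r r1(3)[of r] r2(3)[of r] by auto
    finally show "circle_mean (\<lambda>w. f w + g w) a r \<le> f a + g a" .
  qed
qed

lemma supermean_on_cmult:
  assumes "supermean_on f S" "0 \<le> c"
  shows "supermean_on (\<lambda>w. c * f w) S"
  using assms unfolding supermean_on_def circle_mean_cmult
  by (auto intro!: continuous_intros mult_left_mono) (metis mult_left_mono)

lemma supermean_on_min:
  assumes "supermean_on f S" "supermean_on g S"
  shows "supermean_on (\<lambda>w. min (f w) (g w)) S"
  unfolding supermean_on_def
proof (intro conjI ballI)
  show cont: "continuous_on S (\<lambda>w. min (f w) (g w))"
    using assms by (intro continuous_intros supermean_on_imp_continuous)
  fix a assume "a \<in> S"
  obtain \<rho> where r1: "\<rho> > 0" "ball a \<rho> \<subseteq> S" "\<And>r. 0 < r \<Longrightarrow> r < \<rho> \<Longrightarrow> circle_mean f a r \<le> f a"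
    using supermean_onE[OF assms(1) \<open>a \<in> S\<close>] by blast
  obtain \<sigma> where r2: "\<sigma> > 0" "ball a \<sigma> \<subseteq> S" "\<And>r. 0 < r \<Longrightarrow> r < \<sigma> \<Longrightarrow> circle_mean g a r \<le> g a"
    using supermean_onE[OF assms(2) \<open>a \<in> S\<close>] by blast
  show "\<exists>\<rho>>0. ball a \<rho> \<subseteq> S \<and> (\<forall>r. 0 < r \<and> r < \<rho> \<longrightarrow> circle_mean (\<lambda>w. min (f w) (g w)) a r \<le> min (f a) (g a))"
  proof (intro exI[of _ "min \<rho> \<sigma>"] conjI allI impI)
    show "0 < min \<rho> \<sigma>" "ball a (min \<rho> \<sigma>) \<subseteq> S" using r1 r2 by auto
    fix r assume r: "0 < r \<and> r < min \<rho> \<sigma>"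
    have sub: "sphere a r \<subseteq> S" using r r1(2) sphere_subset_ball[of r \<rho> a] by auto
    have c: "continuous_on (sphere a r) f" "continuous_on (sphere a r) g"
            "continuous_on (sphere a r) (\<lambda>w. min (f w) (g w))"
      using sub assms cont by (auto intro: continuous_on_subset supermean_on_imp_continuous)
    have "circle_mean (\<lambda>w. min (f w) (g w)) a r \<le> circle_mean f a r"
      by (intro circle_mean_mono c) (use r in auto)
    moreover have "circle_mean (\<lambda>w. min (f w) (g w)) a r \<le> circle_mean g a r"
      by (intro circle_mean_mono c) (use r in auto)
    ultimately show "circle_mean (\<lambda>w. min (f w) (g w)) a r \<le> min (f a) (g a)"
      using r r1(3)[of r] r2(3)[of r] by auto
  qed
qed

text \<open>A nonnegative continuous integrand with integral at most 0 vanishes identically.\<close>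

lemma circle_mean_le_min_imp_const:
  assumes "continuous_on (sphere a r) f" "0 < r" "circle_mean f a r \<le> m"
    and "\<And>w. w \<in> sphere a r \<Longrightarrow> m \<le> f w"
  shows "w \<in> sphere a r \<Longrightarrow> f w = m"
proof -
  have cont: "continuous_on {0..1} (\<lambda>t. f (circlepath a r t) - m)"
    using assms by (intro continuous_intros continuous_on_compose_circlepath) auto
  have ge: "\<And>t. 0 \<le> f (circlepath a r t) - m" using assms(2,4) by simp
  have "integral {0..1} (\<lambda>t. f (circlepath a r t) - m) = circle_mean f a r - m"
    using assms unfolding circle_mean_def
    by (subst integral_diff) (auto intro: integrable_compose_circlepath)
  moreover have "0 \<le> integral {0..1} (\<lambda>t. f (circlepath a r t) - m)"
    by (intro integral_nonneg integrable_continuous_real cont) (use ge in auto)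
  ultimately have 0: "integral {0..1} (\<lambda>t. f (circlepath a r t) - m) = 0"
    using assms(3) by simp
  assume "w \<in> sphere a r"
  hence "w \<in> path_image (circlepath a r)" using assms(2) by simp
  then obtain t where t: "t \<in> {0..1}" "w = circlepath a r t" unfolding path_image_def by auto
  have "f (circlepath a r t) - m = 0"
    using integral_eq_0_iff[OF cont, of ] ge 0 t(1) by auto
  thus "f w = m" using t(2) by simp
qed

text \<open>Boundary behaviour is encoded as compactness of the sets where \<open>q\<close> is at
  most a negative constant, so that a negative minimum is attained.\<close>

lemma minimum_principle:
  assumes sm: "supermean_on q D"
    and cpt: "\<And>\<eta>. \<eta> > 0 \<Longrightarrow> compact {w\<in>D. q w \<le> - \<eta>}"
    and "w \<in> D"
  shows "0 \<le> q w"
proof (rule ccontr)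
  assume "\<not> 0 \<le> q w"
  define \<eta> where "\<eta> = - q w"
  have "\<eta> > 0" using \<open>\<not> 0 \<le> q w\<close> by (simp add: \<eta>_def)
  define K where "K = {w\<in>D. q w \<le> - \<eta>}"
  have K: "compact K" "K \<noteq> {}" "K \<subseteq> D"
    using cpt[OF \<open>\<eta> > 0\<close>] \<open>w \<in> D\<close> by (auto simp: K_def \<eta>_def)
  have contD: "continuous_on D q" using sm by (rule supermean_on_imp_continuous)
  have contK: "continuous_on K q" using contD K(3) continuous_on_subset by blast
  obtain x where x: "x \<in> K" "\<And>y. y \<in> K \<Longrightarrow> q x \<le> q y"
    using continuous_attains_inf[OF K(1,2) contK] by blast
  have glob: "q x \<le> q y" if "y \<in> D" for y
    using x that by (cases "y \<in> K") (auto simp: K_def)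
  define L where "L = {y\<in>K. q y = q x}"
  have "L = K \<inter> q -` {q x}" by (auto simp: L_def)
  moreover have "closed (K \<inter> q -` {q x})"
    using contK compact_imp_closed[OF K(1)] by (intro continuous_closed_preimage) auto
  ultimately have "compact L" using K(1) by (metis L_def closed_Int_compact Int_commute Collect_conj_eq inf.left_idem compact_Int_closed Int_absorb2 inf_le1)
  moreover have "L \<noteq> {}" using x by (auto simp: L_def)
  \<comment> \<open>Rightmost among the minimum points: a small circle around it consists of minimum
    points as well and contains one further to the right. This replaces a connectedness
    argument.\<close>
  ultimately obtain y where y: "y \<in> L" "\<And>z. z \<in> L \<Longrightarrow> Re z \<le> Re y"
    using continuous_attains_sup[of L Re] continuous_on_Re[OF continuous_on_id] by blast
  have yD: "y \<in> D" "q y = q x" using y K by (auto simp: L_def)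
  obtain \<rho> where \<rho>: "\<rho> > 0" "ball y \<rho> \<subseteq> D" "\<And>r. 0 < r \<Longrightarrow> r < \<rho> \<Longrightarrow> circle_mean q y r \<le> q y"
    using supermean_onE[OF sm yD(1)] by blast
  define r where "r = \<rho> / 2"
  have r: "0 < r" "r < \<rho>" using \<rho> by (auto simp: r_def)
  have sub: "sphere y r \<subseteq> D" using \<rho>(2) sphere_subset_ball[OF r(2)] by blast
  have s: "y + of_real r \<in> sphere y r" using r by (simp add: dist_norm)
  have "q (y + of_real r) = q y"
  proof (rule circle_mean_le_min_imp_const[where a = y and r = r])
    show "continuous_on (sphere y r) q" using contD sub continuous_on_subset by blast
    show "circle_mean q y r \<le> q y" using \<rho>(3) r by blast
    show "\<And>w. w \<in> sphere y r \<Longrightarrow> q y \<le> q w" using glob yD sub by auto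
  qed (use r s in auto)
  hence "y + of_real r \<in> L" using s sub x yD unfolding L_def K_def by auto
  from y(2)[OF this] r show False by simp
qed

text \<open>A limit point of the sublevel set on the frontier would contradict the lower bound near
  it, and the condition at infinity bounds the set. One-sided bounds near the frontier suit
  functions without boundary values.\<close>

lemma minimum_principle_boundary:
  assumes sm: "supermean_on q D"
    and fr: "\<And>x \<eta>. x \<in> frontier D \<Longrightarrow> \<eta> > 0 \<Longrightarrow> \<forall>\<^sub>F w in at x within D. q w > - \<eta>"
    and inf: "\<And>\<eta>. \<eta> > 0 \<Longrightarrow> \<forall>\<^sub>F w in at_infinity. w \<in> D \<longrightarrow> q w > - \<eta>"
    and "w \<in> D"
  shows "0 \<le> q w"
proof (rule minimum_principle[OF sm _ \<open>w \<in> D\<close>])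
  fix \<eta> :: real assume "\<eta> > 0"
  let ?K = "{w\<in>D. q w \<le> - \<eta>}"
  have cont: "continuous_on D q" and "open D"
    using sm supermean_on_imp_continuous supermean_on_imp_open by blast+
  obtain b where b: "\<And>w. b \<le> norm w \<Longrightarrow> w \<in> D \<Longrightarrow> q w > - \<eta>"
    using inf[OF \<open>\<eta> > 0\<close>] unfolding eventually_at_infinity by blast
  have "bounded ?K" unfolding bounded_iff
    by (intro exI[of _ b]) (use b in force)
  moreover have "closed ?K" unfolding closed_limpt
  proof (intro allI impI)
    fix x assume lim: "x islimpt ?K"
    have xD: "x \<in> closure D" using islimpt_subset[OF lim, of D] by (auto simp: closure_def)
    have "x \<in> D"
    proof (rule ccontr)
      assume "x \<notin> D"
      hence "x \<in> frontier D" using xD \<open>open D\<close> by (simp add: frontier_def interior_open)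
      from fr[OF this \<open>\<eta> > 0\<close>]
      obtain d where d: "d > 0" "\<And>w. w \<in> D \<Longrightarrow> w \<noteq> x \<Longrightarrow> dist w x < d \<Longrightarrow> q w > - \<eta>"
        unfolding eventually_at by blast
      from lim \<open>d > 0\<close> obtain y where "y \<in> ?K" "y \<noteq> x" "dist y x < d"
        unfolding islimpt_approachable by blast
      with d(2)[of y] show False by auto
    qed
    moreover have "q x \<le> - \<eta>"
    proof (rule ccontr)
      assume "\<not> q x \<le> - \<eta>"
      hence "\<forall>\<^sub>F w in at x. q w > - \<eta>"
        using cont \<open>open D\<close> \<open>x \<in> D\<close> unfolding continuous_on_eq_continuous_at[OF \<open>open D\<close>] isCont_def
        by (intro order_tendstoD(1)[of q "q x"]) auto
      then obtain d where d: "d > 0" "\<And>w. w \<noteq> x \<Longrightarrow> dist w x < d \<Longrightarrow> q w > - \<eta>"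
        unfolding eventually_at by blast
      from lim \<open>d > 0\<close> obtain y where "y \<in> ?K" "y \<noteq> x" "dist y x < d"
        unfolding islimpt_approachable by blast
      with d(2)[of y] show False by auto
    qed
    ultimately show "x \<in> ?K" by simp
  qed
  ultimately show "compact ?K" by (simp add: compact_eq_bounded_closed)
qed

section \<open>The Poisson integral\<close>

text \<open>\<open>circlepath\<close> runs once around the circle over [0,1], so the usual factor 1
  / (2 pi) is absorbed here and in \<open>circle_mean\<close>.\<close>

definition poisson :: "(complex \<Rightarrow> real) \<Rightarrow> complex \<Rightarrow> real \<Rightarrow> complex \<Rightarrow> real" where
  "poisson f a R w =
     integral {0..1} (\<lambda>t. (R\<^sup>2 - (cmod (w - a))\<^sup>2) / (cmod (circlepath a R t - w))\<^sup>2
                          * f (circlepath a R t))"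

text \<open>The working notion of harmonicity. The holomorphic function is chosen on each disc
  separately, because a harmonic conjugate need not exist on a multiply connected set. Equivalence
  with \<open>harmonic_on\<close> is \<open>harmonic_on_iff_locally_Re_holomorphic\<close>.\<close>

definition locally_Re_holomorphic :: "(complex \<Rightarrow> real) \<Rightarrow> complex set \<Rightarrow> bool" where
  "locally_Re_holomorphic u S \<longleftrightarrow>
     (\<forall>a\<in>S. \<exists>\<rho>>0. \<exists>F. ball a \<rho> \<subseteq> S \<and> F holomorphic_on ball a \<rho> \<and> (\<forall>w\<in>ball a \<rho>. u w = Re (F w)))"

lemma locally_Re_holomorphicI:
  assumes "open S" "F holomorphic_on S" "\<And>w. w \<in> S \<Longrightarrow> u w = Re (F w)"
  shows "locally_Re_holomorphic u S"
  unfolding locally_Re_holomorphic_def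
proof
  fix a assume "a \<in> S"
  then obtain \<rho> where "\<rho> > 0" "ball a \<rho> \<subseteq> S" using \<open>open S\<close> open_contains_ball by blast
  thus "\<exists>\<rho>>0. \<exists>F. ball a \<rho> \<subseteq> S \<and> F holomorphic_on ball a \<rho> \<and> (\<forall>w\<in>ball a \<rho>. u w = Re (F w))"
    using assms holomorphic_on_subset by blast
qed

lemma locally_Re_holomorphicE:
  assumes "locally_Re_holomorphic u S" "a \<in> S"
  obtains \<rho> F where "\<rho> > 0" "ball a \<rho> \<subseteq> S" "F holomorphic_on ball a \<rho>" "\<And>w. w \<in> ball a \<rho> \<Longrightarrow> u w = Re (F w)"
  using assms unfolding locally_Re_holomorphic_def by blast

lemma locally_Re_holomorphic_imp_open: "locally_Re_holomorphic u S \<Longrightarrow> open S"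
  unfolding locally_Re_holomorphic_def by (meson openI)

lemma locally_Re_holomorphic_subset:
  assumes "locally_Re_holomorphic u S" "open T" "T \<subseteq> S"
  shows "locally_Re_holomorphic u T"
  unfolding locally_Re_holomorphic_def
proof
  fix a assume "a \<in> T"
  then obtain \<rho> F where F: "\<rho> > 0" "F holomorphic_on ball a \<rho>" "\<And>w. w \<in> ball a \<rho> \<Longrightarrow> u w = Re (F w)"
    using locally_Re_holomorphicE[OF assms(1)] assms(3) by (metis subsetD)
  obtain \<sigma> where s: "\<sigma> > 0" "ball a \<sigma> \<subseteq> T" using \<open>a \<in> T\<close> \<open>open T\<close> open_contains_ball by blast
  show "\<exists>\<rho>>0. \<exists>F. ball a \<rho> \<subseteq> T \<and> F holomorphic_on ball a \<rho> \<and> (\<forall>w\<in>ball a \<rho>. u w = Re (F w))"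
    by (intro exI[of _ "min \<rho> \<sigma>"] conjI exI[of _ F])
       (use F s in \<open>auto intro: holomorphic_on_subset\<close>)
qed

lemma locally_Re_holomorphic_cong:
  assumes "locally_Re_holomorphic u S" "\<And>w. w \<in> S \<Longrightarrow> v w = u w"
  shows "locally_Re_holomorphic v S"
  using assms unfolding locally_Re_holomorphic_def by (metis subsetD)

lemma locally_Re_holomorphic_add:
  assumes "locally_Re_holomorphic u S" "locally_Re_holomorphic v S"
  shows "locally_Re_holomorphic (\<lambda>w. u w + v w) S"
  unfolding locally_Re_holomorphic_def
proof
  fix a assume "a \<in> S"
  obtain \<rho> F where F: "\<rho> > 0" "ball a \<rho> \<subseteq> S" "F holomorphic_on ball a \<rho>" "\<And>w. w \<in> ball a \<rho> \<Longrightarrow> u w = Re (F w)"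
    using locally_Re_holomorphicE[OF assms(1) \<open>a \<in> S\<close>] by blast
  obtain \<sigma> G where G: "\<sigma> > 0" "ball a \<sigma> \<subseteq> S" "G holomorphic_on ball a \<sigma>" "\<And>w. w \<in> ball a \<sigma> \<Longrightarrow> v w = Re (G w)"
    using locally_Re_holomorphicE[OF assms(2) \<open>a \<in> S\<close>] by blast
  have "(\<lambda>w. F w + G w) holomorphic_on ball a (min \<rho> \<sigma>)"
    by (intro holomorphic_on_add holomorphic_on_subset[OF F(3)] holomorphic_on_subset[OF G(3)]) auto
  thus "\<exists>\<rho>>0. \<exists>F. ball a \<rho> \<subseteq> S \<and> F holomorphic_on ball a \<rho> \<and> (\<forall>w\<in>ball a \<rho>. u w + v w = Re (F w))"
    by (intro exI[of _ "min \<rho> \<sigma>"] conjI exI[of _ "\<lambda>w. F w + G w"])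
       (use F G in auto)
qed

lemma locally_Re_holomorphic_cmult:
  assumes "locally_Re_holomorphic u S"
  shows "locally_Re_holomorphic (\<lambda>w. c * u w) S"
  unfolding locally_Re_holomorphic_def
proof
  fix a assume "a \<in> S"
  obtain \<rho> F where F: "\<rho> > 0" "ball a \<rho> \<subseteq> S" "F holomorphic_on ball a \<rho>" "\<And>w. w \<in> ball a \<rho> \<Longrightarrow> u w = Re (F w)"
    using locally_Re_holomorphicE[OF assms(1) \<open>a \<in> S\<close>] by blast
  thus "\<exists>\<rho>>0. \<exists>F. ball a \<rho> \<subseteq> S \<and> F holomorphic_on ball a \<rho> \<and> (\<forall>w\<in>ball a \<rho>. c * u w = Re (F w))"
    by (intro exI[of _ \<rho>] conjI exI[of _ "\<lambda>w. of_real c * F w"]) (auto intro!: holomorphic_intros)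
qed

lemma locally_Re_holomorphic_uminus:
  "locally_Re_holomorphic u S \<Longrightarrow> locally_Re_holomorphic (\<lambda>w. - u w) S"
  using locally_Re_holomorphic_cmult[of u S "-1"] by simp

lemma locally_Re_holomorphic_diff:
  assumes "locally_Re_holomorphic u S" "locally_Re_holomorphic v S"
  shows "locally_Re_holomorphic (\<lambda>w. u w - v w) S"
  using locally_Re_holomorphic_add[OF assms(1) locally_Re_holomorphic_uminus[OF assms(2)]] by simp

lemma locally_Re_holomorphic_imp_continuous:
  assumes "locally_Re_holomorphic u S"
  shows "continuous_on S u"
  unfolding continuous_on_eq_continuous_at[OF locally_Re_holomorphic_imp_open[OF assms]]
proof
  fix a assume "a \<in> S"
  obtain \<rho> F where F: "\<rho> > 0" "ball a \<rho> \<subseteq> S" "F holomorphic_on ball a \<rho>" "\<And>w. w \<in> ball a \<rho> \<Longrightarrow> u w = Re (F w)"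
    using locally_Re_holomorphicE[OF assms(1) \<open>a \<in> S\<close>] by blast
  have "continuous_on (ball a \<rho>) (\<lambda>w. Re (F w))"
    using F by (intro continuous_intros holomorphic_on_imp_continuous_on)
  hence "continuous_on (ball a \<rho>) u" using F(4) by (metis (no_types, lifting) continuous_on_cong)
  thus "isCont u a" using F(1) by (simp add: continuous_on_eq_continuous_at)
qed

text \<open>The velocity of \<open>circlepath a r\<close> is 2 pi i times the radius vector; hence
  contour integrals become integrals over [0,1], in which circle means are written.\<close>

lemma has_contour_integral_circlepath_iff:
  "(g has_contour_integral i) (circlepath a r) \<longleftrightarrow>
   ((\<lambda>t. g (circlepath a r t) * (2 * pi * \<i> * (circlepath a r t - a))) has_integral i) {0..1}"
proof -
  have "((\<lambda>t. g (circlepath a r t) * vector_derivative (circlepath a r) (at t within {0..1})) has_integral i) {0..1}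
     \<longleftrightarrow> ((\<lambda>t. g (circlepath a r t) * (2 * pi * \<i> * (circlepath a r t - a))) has_integral i) {0..1}"
    by (rule has_integral_cong, subst vector_derivative_circlepath01) (auto simp: circlepath)
  thus ?thesis by (simp add: has_contour_integral_def)
qed

text \<open>Cauchy's formula at the centre, where the kernel 1 / (u - a) cancels the velocity up to
  the factor 2 pi i.\<close>

lemma circle_mean_Re_holomorphic:
  assumes "F holomorphic_on ball a \<rho>" "0 < r" "r < \<rho>"
  shows "circle_mean (\<lambda>w. Re (F w)) a r = Re (F a)"
proof -
  have "((\<lambda>u. F u / (u - a)) has_contour_integral (2 * of_real pi * \<i> * F a)) (circlepath a r)"
  proof (intro Cauchy_integral_circlepath holomorphic_on_imp_continuous_on)
    show "F holomorphic_on cball a r" "F holomorphic_on ball a r"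
      by (rule holomorphic_on_subset[OF assms(1)], use assms in force)+
  qed (use assms in simp)
  hence "((\<lambda>t. F (circlepath a r t) / (circlepath a r t - a) * (2 * pi * \<i> * (circlepath a r t - a)))
      has_integral (2 * of_real pi * \<i> * F a)) {0..1}"
    by (simp add: has_contour_integral_circlepath_iff)
  hence "((\<lambda>t. 1 / (2 * of_real pi * \<i>) * (F (circlepath a r t) / (circlepath a r t - a) * (2 * pi * \<i> * (circlepath a r t - a))))
      has_integral 1 / (2 * of_real pi * \<i>) * (2 * of_real pi * \<i> * F a)) {0..1}"
    by (rule has_integral_mult_right)
  moreover have "1 / (2 * of_real pi * \<i>) * (F (circlepath a r t) / (circlepath a r t - a)
      * (2 * pi * \<i> * (circlepath a r t - a))) = F (circlepath a r t)" for t
  proof -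
    have "circlepath a r t - a \<noteq> 0"
      using norm_circlepath_minus_centre[of a r t] \<open>0 < r\<close> by auto
    thus ?thesis by simp
  qed
  ultimately have "((\<lambda>t. F (circlepath a r t)) has_integral F a) {0..1}"
    by simp
  from has_integral_linear[OF this bounded_linear_Re]
  show ?thesis unfolding circle_mean_def o_def by (simp add: integral_unique)
qed

lemma locally_Re_holomorphic_imp_supermean:
  assumes "locally_Re_holomorphic u S"
  shows "supermean_on u S"
  unfolding supermean_on_def
proof (intro conjI ballI)
  show "continuous_on S u" by (rule locally_Re_holomorphic_imp_continuous[OF assms])
  fix a assume "a \<in> S"
  obtain \<rho> F where F: "\<rho> > 0" "ball a \<rho> \<subseteq> S" "F holomorphic_on ball a \<rho>" "\<And>w. w \<in> ball a \<rho> \<Longrightarrow> u w = Re (F w)"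
    using locally_Re_holomorphicE[OF assms(1) \<open>a \<in> S\<close>] by blast
  have "circle_mean u a r = u a" if "0 < r" "r < \<rho>" for r
  proof -
    have "circle_mean u a r = circle_mean (\<lambda>w. Re (F w)) a r"
      using that F(4) by (intro circle_mean_cong) auto
    thus ?thesis using circle_mean_Re_holomorphic[OF F(3) that] F(1,4) by simp
  qed
  thus "\<exists>\<rho>>0. ball a \<rho> \<subseteq> S \<and> (\<forall>r. 0 < r \<and> r < \<rho> \<longrightarrow> circle_mean u a r \<le> u a)"
    using F by (intro exI[of _ \<rho>]) auto
qed

lemma supermean_on_subset:
  assumes "supermean_on f S" "open T" "T \<subseteq> S"
  shows "supermean_on f T"
  unfolding supermean_on_def
proof (intro conjI ballI)
  show "continuous_on T f" using assms supermean_on_imp_continuous continuous_on_subset by blast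
  fix a assume "a \<in> T"
  then obtain \<rho> where F: "\<rho> > 0" "\<And>r. 0 < r \<Longrightarrow> r < \<rho> \<Longrightarrow> circle_mean f a r \<le> f a"
    using supermean_onE[OF assms(1)] assms(3) by (metis subsetD)
  obtain \<sigma> where s: "\<sigma> > 0" "ball a \<sigma> \<subseteq> T" using \<open>a \<in> T\<close> \<open>open T\<close> open_contains_ball by blast
  show "\<exists>\<rho>>0. ball a \<rho> \<subseteq> T \<and> (\<forall>r. 0 < r \<and> r < \<rho> \<longrightarrow> circle_mean f a r \<le> f a)"
    by (intro exI[of _ "min \<rho> \<sigma>"]) (use F s in auto)
qed

text \<open>The right side is the real part of the Schwarz kernel ((\<zeta> - a) + (w - a)) /
  (\<zeta> - w), written as twice a Cauchy kernel minus 1 and hence holomorphic in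
  \<open>w\<close>.\<close>

lemma poisson_kernel_eq_Re:
  assumes "cmod (\<zeta> - a) = R" "\<zeta> \<noteq> w"
  shows "(R\<^sup>2 - (cmod (w - a))\<^sup>2) / (cmod (\<zeta> - w))\<^sup>2 = Re (2 * (\<zeta> - a) / (\<zeta> - w) - 1)"
proof -
  have "2 * (\<zeta> - a) / (\<zeta> - w) - 1 = ((\<zeta> - a) + (w - a)) / (\<zeta> - w)"
    using assms(2) by (simp add: field_simps)
  also have "\<dots> = ((\<zeta> - a) + (w - a)) * cnj (\<zeta> - w) / of_real ((cmod (\<zeta> - w))\<^sup>2)"
    by (subst complex_div_cnj) simp
  finally have "Re (2 * (\<zeta> - a) / (\<zeta> - w) - 1)
    = Re (((\<zeta> - a) + (w - a)) * cnj (\<zeta> - w)) / (cmod (\<zeta> - w))\<^sup>2"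
    by (metis Re_divide_of_real)
  also have "Re (((\<zeta> - a) + (w - a)) * cnj (\<zeta> - w)) = R\<^sup>2 - (cmod (w - a))\<^sup>2"
    unfolding assms(1)[symmetric] cmod_power2 by (simp add: power2_eq_square algebra_simps)
  finally show ?thesis by simp
qed

lemma circlepath_ne_inside:
  assumes "w \<in> ball a R" shows "circlepath a R t \<noteq> w"
  using assms dist_circlepath[of a R t] by auto

text \<open>\<open>F\<close> is the Schwarz integral: twice the Cauchy integral of \<open>f\<close>
  minus the mean of \<open>f\<close>. Integrability is recorded with it because both come from the
  same \<open>has_integral\<close> fact.\<close>

lemma poisson_holomorphic:
  assumes f: "continuous_on (sphere a R) f"
  obtains F where "F holomorphic_on ball a R" "\<And>w. w \<in> ball a R \<Longrightarrow> poisson f a R w = Re (F w)"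
    "\<And>w. w \<in> ball a R \<Longrightarrow> (\<lambda>t. (R\<^sup>2 - (cmod (w - a))\<^sup>2) / (cmod (circlepath a R t - w))\<^sup>2
                          * f (circlepath a R t)) integrable_on {0..1}"
proof (cases "R > 0")
  case False
  hence e: "w \<in> ball a R \<Longrightarrow> P" for w P by (metis ball_eq_empty empty_iff not_less)
  show ?thesis by (rule that[of "\<lambda>_. 0"]) (simp, (erule e)+)
next
  case True
  \<comment> \<open>The exponent 1 fits the form of
    \<open>Cauchy_next_derivative_circlepath\<close>, which differentiates such integrals in
    \<open>w\<close>.\<close>
  define C where "C w = contour_integral (circlepath a R) (\<lambda>\<zeta>. complex_of_real (f \<zeta>) / (\<zeta> - w)^1)" for w
  define m where "m = circle_mean f a R"
  define F where "F w = 1 / (pi * \<i>) * C w - of_real m" for w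
  have C: "((\<lambda>\<zeta>. complex_of_real (f \<zeta>) / (\<zeta> - w)^1) has_contour_integral C w) (circlepath a R)"
    if "w \<in> ball a R" for w
    unfolding C_def
  proof (intro has_contour_integral_integral contour_integrable_continuous_circlepath)
    have "\<zeta> \<noteq> w" if "\<zeta> \<in> sphere a R" for \<zeta> using that \<open>w \<in> ball a R\<close> by auto
    thus "continuous_on (path_image (circlepath a R)) (\<lambda>\<zeta>. complex_of_real (f \<zeta>) / (\<zeta> - w) ^ 1)"
      using f True by (auto intro!: continuous_intros)
  qed
  have fc: "continuous_on (path_image (circlepath a R)) (\<lambda>\<zeta>. complex_of_real (f \<zeta>))"
    using f True by (auto intro!: continuous_intros)
  have "C field_differentiable at w" if "w \<in> ball a R" for w
    using Cauchy_next_derivative_circlepath(2)[OF fc C _ that] unfolding field_differentiable_def by auto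
  hence "C holomorphic_on ball a R"
    by (simp add: holomorphic_on_def field_differentiable_at_within)
  hence hol: "F holomorphic_on ball a R"
    unfolding F_def by (intro holomorphic_intros) auto
  have main: "((\<lambda>t. (R\<^sup>2 - (cmod (w - a))\<^sup>2) / (cmod (circlepath a R t - w))\<^sup>2
                          * f (circlepath a R t)) has_integral Re (F w)) {0..1}" if w: "w \<in> ball a R" for w
  proof -
    let ?c = "circlepath a R"
    have "((\<lambda>t. f (?c t)) has_integral m) {0..1}"
      unfolding m_def circle_mean_def using f True
      by (intro integrable_integral integrable_compose_circlepath) auto
    from has_integral_linear[OF this bounded_linear_of_real]
    have "((\<lambda>t. complex_of_real (f (?c t))) has_integral of_real m) {0..1}"
      by (simp only: o_def)
    moreover have "((\<lambda>t. complex_of_real (f (?c t)) / (?c t - w)^1 * (2 * of_real pi * \<i> * (?c t - a))) has_integral C w) {0..1}"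
      using C[OF w] unfolding has_contour_integral_circlepath_iff by simp
    ultimately have "((\<lambda>t. 1 / (of_real pi * \<i>) * (complex_of_real (f (?c t)) / (?c t - w)^1 * (2 * of_real pi * \<i> * (?c t - a)))
         - complex_of_real (f (?c t))) has_integral F w) {0..1}"
      unfolding F_def by (intro has_integral_diff has_integral_mult_right)
    moreover have "1 / (of_real pi * \<i>) * (complex_of_real (f (?c t)) / (?c t - w)^1 * (2 * of_real pi * \<i> * (?c t - a)))
         - complex_of_real (f (?c t)) = (2 * (?c t - a) / (?c t - w) - 1) * of_real (f (?c t))" for t
    proof -
      have "1 / (p * \<i>) * (y / x ^ 1 * (2 * p * \<i> * v)) - y = (2 * v / x - 1) * y"
        if "x \<noteq> 0" "p \<noteq> 0" for x y p v :: complex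
        using that by (simp add: field_simps)
      thus ?thesis using circlepath_ne_inside[OF w] by (metis eq_iff_diff_eq_0 of_real_eq_0_iff pi_neq_zero)
    qed
    ultimately have "((\<lambda>t. (2 * (?c t - a) / (?c t - w) - 1) * of_real (f (?c t))) has_integral F w) {0..1}"
      by (simp only:)
    from has_integral_linear[OF this bounded_linear_Re]
    have "((\<lambda>t. Re ((2 * (?c t - a) / (?c t - w) - 1) * of_real (f (?c t)))) has_integral Re (F w)) {0..1}"
      by (simp only: o_def)
    moreover have "Re ((2 * (?c t - a) / (?c t - w) - 1) * of_real (f (?c t))) =
        (R\<^sup>2 - (cmod (w - a))\<^sup>2) / (cmod (?c t - w))\<^sup>2 * f (?c t)" for t
      using poisson_kernel_eq_Re[of "?c t" a R w] True circlepath_ne_inside[OF w] norm_circlepath_minus_centre[of a R t]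
      by simp
    ultimately show ?thesis by (simp only:)
  qed
  show ?thesis
    by (rule that[OF hol]) (use main in \<open>auto simp: poisson_def integral_unique integrable_on_def\<close>)
qed

lemma poisson_integrable:
  assumes "continuous_on (sphere a R) f" "w \<in> ball a R"
  shows "(\<lambda>t. (R\<^sup>2 - (cmod (w - a))\<^sup>2) / (cmod (circlepath a R t - w))\<^sup>2
                          * f (circlepath a R t)) integrable_on {0..1}"
  by (rule poisson_holomorphic[OF assms(1)]) (use assms(2) in blast)

lemma poisson_locally_Re_holomorphic:
  assumes "continuous_on (sphere a R) f"
  shows "locally_Re_holomorphic (poisson f a R) (ball a R)"
proof -
  obtain F where "F holomorphic_on ball a R" "\<And>w. w \<in> ball a R \<Longrightarrow> poisson f a R w = Re (F w)"
    using poisson_holomorphic[OF assms] by metis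
  thus ?thesis by (intro locally_Re_holomorphicI) auto
qed

lemma poisson_kernel_nonneg:
  assumes "w \<in> ball a R"
  shows "0 \<le> (R\<^sup>2 - (cmod (w - a))\<^sup>2) / (cmod (\<zeta> - w))\<^sup>2"
  using assms by (intro divide_nonneg_nonneg) (auto simp: dist_norm norm_minus_commute intro!: power_mono)

lemma poisson_cmult: "poisson (\<lambda>w. c * f w) a R w = c * poisson f a R w"
proof -
  have *: "(\<lambda>t. (R\<^sup>2 - (cmod (w - a))\<^sup>2) / (cmod (circlepath a R t - w))\<^sup>2 * (c * f (circlepath a R t))) =
    (\<lambda>t. c * ((R\<^sup>2 - (cmod (w - a))\<^sup>2) / (cmod (circlepath a R t - w))\<^sup>2 * f (circlepath a R t)))"
    by (intro ext) simp
  show ?thesis unfolding poisson_def * by (rule integral_mult_right)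
qed

lemma poisson_uminus: "poisson (\<lambda>w. - f w) a R w = - poisson f a R w"
  using poisson_cmult[of "-1" f] by simp

lemma poisson_diff:
  assumes "continuous_on (sphere a R) f" "continuous_on (sphere a R) g" "w \<in> ball a R"
  shows "poisson (\<lambda>w. f w - g w) a R w = poisson f a R w - poisson g a R w"
  unfolding poisson_def right_diff_distrib
  by (intro integral_diff poisson_integrable assms)

lemma poisson_mono:
  assumes "continuous_on (sphere a R) f" "continuous_on (sphere a R) g" "w \<in> ball a R"
    and "\<And>\<zeta>. \<zeta> \<in> sphere a R \<Longrightarrow> f \<zeta> \<le> g \<zeta>"
  shows "poisson f a R w \<le> poisson g a R w"
  unfolding poisson_def
proof (intro integral_le poisson_integrable assms mult_left_mono poisson_kernel_nonneg)
  have "R > 0" using assms(3) by (metis ball_eq_empty empty_iff not_le)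
  thus "circlepath a R t \<in> sphere a R" for t by simp
qed

lemma poisson_centre:
  assumes "R > 0"
  shows "poisson f a R a = circle_mean f a R"
  unfolding poisson_def circle_mean_def using assms
  by (simp add: norm_circlepath_minus_centre)

text \<open>Cauchy's formula for the constant 1 gives the kernel total mass 1.\<close>

lemma poisson_const:
  assumes "w \<in> ball a R"
  shows "poisson (\<lambda>_. c) a R w = c"
proof -
  have R: "R > 0" using assms(1) by (metis ball_eq_empty empty_iff not_le)
  let ?c = "circlepath a R"
  have "((\<lambda>u. 1 / (u - w)) has_contour_integral (2 * of_real pi * \<i> * 1)) ?c"
    using assms by (intro Cauchy_integral_circlepath) (auto simp: dist_norm norm_minus_commute)
  hence "((\<lambda>t. 1 / (?c t - w) * (2 * pi * \<i> * (?c t - a))) has_integral 2 * of_real pi * \<i> * 1) {0..1}"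
    unfolding has_contour_integral_circlepath_iff .
  moreover have "((\<lambda>t. 1 :: complex) has_integral 1) {0..1::real}"
    using has_integral_const_real[of "1::complex" "0::real" 1] by simp
  ultimately have "((\<lambda>t. 1 / (pi * \<i>) * (1 / (?c t - w) * (2 * pi * \<i> * (?c t - a))) - 1)
      has_integral (1 / (pi * \<i>) * (2 * of_real pi * \<i> * 1) - 1)) {0..1}"
    by (intro has_integral_diff has_integral_mult_right)
  from has_integral_linear[OF this bounded_linear_Re]
  have "((\<lambda>t. Re (1 / (pi * \<i>) * (1 / (?c t - w) * (2 * pi * \<i> * (?c t - a))) - 1))
      has_integral 1) {0..1}"
    by (simp add: o_def)
  moreover have "Re (1 / (pi * \<i>) * (1 / (?c t - w) * (2 * pi * \<i> * (?c t - a))) - 1) =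
     (R\<^sup>2 - (cmod (w - a))\<^sup>2) / (cmod (?c t - w))\<^sup>2 * 1" for t
  proof -
    have ne: "?c t \<noteq> w" by (rule circlepath_ne_inside[OF assms])
    have "1 / (pi * \<i>) * (1 / (?c t - w) * (2 * pi * \<i> * (?c t - a))) - 1 = 2 * (?c t - a) / (?c t - w) - 1"
      using ne by (simp add: field_simps)
    thus ?thesis
      using poisson_kernel_eq_Re[of "?c t" a R w] R ne norm_circlepath_minus_centre[of a R t] by simp
  qed
  ultimately have "poisson (\<lambda>_. 1) a R w = 1" unfolding poisson_def by (simp add: integral_unique)
  thus ?thesis using poisson_cmult[of c "\<lambda>_. 1" a R w] by simp
qed

text \<open>With d = |w - a| the numerator is (R - d) (R + d), and the denominator lies between (R -
  d)^2 and (R + d)^2.\<close>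

lemma poisson_kernel_bounds:
  assumes "w \<in> ball a R" "\<zeta> \<in> sphere a R"
  shows "(R - dist a w) / (R + dist a w) \<le> (R\<^sup>2 - (cmod (w - a))\<^sup>2) / (cmod (\<zeta> - w))\<^sup>2"
    and "(R\<^sup>2 - (cmod (w - a))\<^sup>2) / (cmod (\<zeta> - w))\<^sup>2 \<le> (R + dist a w) / (R - dist a w)"
proof -
  define d where "d = dist a w"
  have d: "0 \<le> d" "d < R" using assms by (auto simp: d_def)
  have eq: "R\<^sup>2 - (cmod (w - a))\<^sup>2 = (R - d) * (R + d)"
    by (simp add: d_def dist_norm norm_minus_commute power2_eq_square algebra_simps)
  have 1: "cmod (\<zeta> - w) \<le> R + d"
    using dist_triangle2[of \<zeta> w a] assms by (simp add: d_def dist_norm norm_minus_commute)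
  have 2: "R - d \<le> cmod (\<zeta> - w)"
    using dist_triangle[of a \<zeta> w] assms by (simp add: d_def dist_norm norm_minus_commute)
  have 3: "(cmod (\<zeta> - w))\<^sup>2 \<le> (R + d)\<^sup>2" "(R - d)\<^sup>2 \<le> (cmod (\<zeta> - w))\<^sup>2"
    using 1 2 d by (auto intro: power_mono)
  have pos: "0 < (cmod (\<zeta> - w))\<^sup>2" "0 < (R-d)\<^sup>2" using 2 d by auto
  have "(R - d) / (R + d) = (R - d) * (R + d) / (R + d)\<^sup>2"
    using d by (simp add: power2_eq_square)
  also have "\<dots> \<le> (R - d) * (R + d) / (cmod (\<zeta> - w))\<^sup>2"
    using 3(1) pos d by (intro divide_left_mono mult_nonneg_nonneg mult_pos_pos) auto
  finally show "(R - dist a w) / (R + dist a w) \<le> (R\<^sup>2 - (cmod (w - a))\<^sup>2) / (cmod (\<zeta> - w))\<^sup>2"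
    unfolding eq by (simp add: d_def)
  have "(R - d) * (R + d) / (cmod (\<zeta> - w))\<^sup>2 \<le> (R - d) * (R + d) / (R - d)\<^sup>2"
    using 3(2) pos d by (intro divide_left_mono mult_nonneg_nonneg mult_pos_pos) linarith+
  also have "\<dots> = (R + d) / (R - d)" using d by (simp add: power2_eq_square)
  finally show "(R\<^sup>2 - (cmod (w - a))\<^sup>2) / (cmod (\<zeta> - w))\<^sup>2 \<le> (R + dist a w) / (R - dist a w)"
    unfolding eq by (simp add: d_def)
qed

section \<open>The Dirichlet problem on a disc and the Harnack inequality\<close>

text \<open>The kernel is an approximate identity: nonnegative, of mass 1, and small away from
  \<open>x\<close>, since its numerator is at most 2 R |w - x|.\<close>

lemma poisson_tendsto_boundary:
  assumes f: "continuous_on (sphere a R) f" and x: "x \<in> sphere a R" and R: "R > 0"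
  shows "(poisson f a R \<longlongrightarrow> f x) (at x within ball a R)"
proof (rule tendstoI)
  fix \<epsilon> :: real assume "\<epsilon> > 0"
  have "compact (f ` sphere a R)" using f by (intro compact_continuous_image) auto
  then obtain M where M: "M > 0" "\<And>w. w \<in> sphere a R \<Longrightarrow> \<bar>f w\<bar> \<le> M"
    by (auto dest!: compact_imp_bounded simp: bounded_pos)
  obtain \<delta> where \<delta>: "\<delta> > 0" "\<And>w. w \<in> sphere a R \<Longrightarrow> dist w x < \<delta> \<Longrightarrow> dist (f w) (f x) < \<epsilon> / 2"
    using f x \<open>\<epsilon> > 0\<close> unfolding continuous_on_iff by (metis half_gt_zero)
  \<comment> \<open>The first bound keeps points of the circle at distance at least \<delta> from
    \<open>x\<close> no closer than \<delta>/2 to \<open>w\<close>; the second makes the far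
    contribution \<open>c\<close> less than \<epsilon>/4.\<close>
  define \<eta> where "\<eta> = min (\<delta> / 2) (\<epsilon> * \<delta>\<^sup>2 / (64 * M * R))"
  have "\<eta> > 0" using \<open>\<epsilon> > 0\<close> \<delta> M R by (simp add: \<eta>_def)
  have main: "dist (poisson f a R w) (f x) < \<epsilon>" if w: "w \<in> ball a R" "dist w x < \<eta>" for w
  proof -
    let ?k = "\<lambda>t. (R\<^sup>2 - (cmod (w - a))\<^sup>2) / (cmod (circlepath a R t - w))\<^sup>2"
    define c where "c = 16 * M * R * dist w x / \<delta>\<^sup>2"
    have Rw: "0 \<le> R\<^sup>2 - (cmod (w - a))\<^sup>2" "R\<^sup>2 - (cmod (w - a))\<^sup>2 \<le> 2 * R * dist w x"
    proof -
      have 1: "R - cmod (w - a) \<le> dist w x" "0 \<le> R - cmod (w - a)"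
        using x w dist_triangle[of x a w] by (auto simp: dist_norm norm_minus_commute)
      have "R\<^sup>2 - (cmod (w - a))\<^sup>2 = (R - cmod (w - a)) * (R + cmod (w - a))"
        by (simp add: power2_eq_square algebra_simps)
      also have "\<dots> \<le> dist w x * (2 * R)"
        using 1 R by (intro mult_mono) auto
      finally show "R\<^sup>2 - (cmod (w - a))\<^sup>2 \<le> 2 * R * dist w x" by (simp only: mult.commute[of "dist w x"])
      show "0 \<le> R\<^sup>2 - (cmod (w - a))\<^sup>2" using 1 R by (simp add: power_mono)
    qed
    have c0: "0 \<le> c" using M R \<delta> by (simp add: c_def)
    have ptw: "?k t * \<bar>f (circlepath a R t) - f x\<bar> \<le> \<epsilon> / 2 * ?k t + c" for t
    proof -
      let ?z = "circlepath a R t"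
      have z: "?z \<in> sphere a R" using R by simp
      have k0: "0 \<le> ?k t" using poisson_kernel_nonneg[OF w(1)] .
      show ?thesis
      proof (cases "dist ?z x < \<delta>")
        case True
        hence "\<bar>f ?z - f x\<bar> \<le> \<epsilon> / 2" using \<delta>(2)[OF z] by (simp add: dist_real_def)
        hence "?k t * \<bar>f ?z - f x\<bar> \<le> ?k t * (\<epsilon> / 2)" using k0 by (rule mult_left_mono)
        thus ?thesis using c0 by (simp add: mult.commute)
      next
        case False
        have "\<delta> / 2 \<le> cmod (?z - w)"
          using False w(2) dist_triangle[of ?z x w] by (simp add: \<eta>_def dist_norm)
        hence "(\<delta> / 2)\<^sup>2 \<le> (cmod (?z - w))\<^sup>2" using \<delta> by (intro power_mono) auto
        hence "?k t \<le> 2 * R * dist w x / (\<delta> / 2)\<^sup>2"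
          using Rw \<delta> R by (intro frac_le) auto
        moreover have "\<bar>f ?z - f x\<bar> \<le> 2 * M" using M(2)[OF z] M(2)[OF x] by linarith
        ultimately have "?k t * \<bar>f ?z - f x\<bar> \<le> 2 * R * dist w x / (\<delta> / 2)\<^sup>2 * (2 * M)"
          using R by (intro mult_mono) auto
        also have "\<dots> = c" by (simp add: c_def field_simps power2_eq_square)
        finally have "?k t * \<bar>f ?z - f x\<bar> \<le> c" .
        moreover have "0 \<le> \<epsilon> / 2 * ?k t" using k0 \<open>\<epsilon> > 0\<close> by (intro mult_nonneg_nonneg) auto
        ultimately show ?thesis by linarith
      qed
    qed
    have cf: "continuous_on (sphere a R) (\<lambda>w. f w - f x)" using f by (intro continuous_intros)
    have ca: "continuous_on (sphere a R) (\<lambda>w. \<bar>f w - f x\<bar>)" using f by (intro continuous_intros)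
    have "poisson f a R w - f x = poisson (\<lambda>w. f w - f x) a R w"
      by (subst poisson_diff[OF f _ w(1)]) (auto simp: poisson_const[OF w(1)])
    also have "\<bar>\<dots>\<bar> \<le> poisson (\<lambda>w. \<bar>f w - f x\<bar>) a R w"
      unfolding poisson_def
      unfolding real_norm_def[symmetric]
      by (intro integral_norm_bound_integral poisson_integrable[OF cf w(1)]
            poisson_integrable[OF ca[folded real_norm_def] w(1)])
         (simp only: abs_mult abs_of_nonneg[OF poisson_kernel_nonneg[OF w(1)]] order_refl real_norm_def)
    also have "\<dots> \<le> integral {0..1} (\<lambda>t. \<epsilon> / 2 * ?k t + c)"
      unfolding poisson_def
    proof (rule integral_le)
      have "?k integrable_on {0..1}"
        using poisson_integrable[of a R "\<lambda>_. 1", OF _ w(1)] by simp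
      thus "(\<lambda>t. \<epsilon> / 2 * ?k t + c) integrable_on {0..1}"
        by (intro integrable_add integrable_on_mult_right) auto
    qed (rule poisson_integrable[OF ca w(1)], rule ptw)
    also have "\<dots> = \<epsilon> / 2 + c"
    proof -
      have "?k integrable_on {0..1}"
        using poisson_integrable[of a R "\<lambda>_. 1", OF _ w(1)] by simp
      moreover have "integral {0..1} ?k = 1" using poisson_const[OF w(1), of 1] by (simp add: poisson_def)
      ultimately show ?thesis
        by (subst integral_add)
           (simp_all only: integral_mult_right integrable_on_mult_right integrable_const_ivl, simp)
    qed
    also have "\<dots> < \<epsilon>"
    proof -
      have "dist w x < \<epsilon> * \<delta>\<^sup>2 / (64 * M * R)" using w(2) by (simp add: \<eta>_def)
      hence "dist w x * (64 * M * R) < \<epsilon> * \<delta>\<^sup>2" using M R by (simp add: pos_less_divide_eq)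
      hence "c * 4 < \<epsilon>" using \<delta> by (simp add: c_def field_simps)
      thus ?thesis using c0 by linarith
    qed
    finally show ?thesis by (simp add: dist_real_def)
  qed
  show "\<forall>\<^sub>F w in at x within ball a R. dist (poisson f a R w) (f x) < \<epsilon>"
    unfolding eventually_at using \<open>\<eta> > 0\<close> main by blast
qed

text \<open>\<open>f\<close> minus its Poisson integral has the super-mean-value property in the
  disc and tends to 0 at the circle, so the minimum principle applies.\<close>

lemma supermean_on_ge_poisson:
  assumes f: "supermean_on f S" and S: "cball a R \<subseteq> S" and w: "w \<in> ball a R"
  shows "poisson f a R w \<le> f w"
proof -
  have R: "R > 0" using w by (metis ball_eq_empty empty_iff not_le)
  have cont: "continuous_on (cball a R) f"
    using supermean_on_imp_continuous[OF f] S continuous_on_subset by blast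
  have contS: "continuous_on (sphere a R) f" by (rule continuous_on_subset[OF cont]) auto
  have "supermean_on (\<lambda>w. f w + - poisson f a R w) (ball a R)"
    by (intro supermean_on_add locally_Re_holomorphic_imp_supermean locally_Re_holomorphic_uminus
         poisson_locally_Re_holomorphic contS supermean_on_subset[OF f])
       (use S ball_subset_cball in auto)
  from minimum_principle_boundary[OF this _ _ w]
  have "0 \<le> f w + - poisson f a R w"
  proof this
    fix x and \<eta> :: real assume "x \<in> frontier (ball a R)" "\<eta> > 0"
    hence x: "x \<in> sphere a R" using R by simp
    have "(f \<longlongrightarrow> f x) (at x within cball a R)"
      using cont x by (auto simp: continuous_on_def)
    hence "(f \<longlongrightarrow> f x) (at x within ball a R)"
      by (rule tendsto_within_subset) auto
    from tendsto_add[OF this tendsto_minus[OF poisson_tendsto_boundary[OF contS x R]]]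
    have "((\<lambda>w. f w + - poisson f a R w) \<longlongrightarrow> 0) (at x within ball a R)" by simp
    from order_tendstoD(1)[OF this, of "-\<eta>"] \<open>\<eta> > 0\<close>
    show "\<forall>\<^sub>F w in at x within ball a R. - \<eta> < f w + - poisson f a R w" by simp
  next
    fix \<eta> :: real
    have "\<forall>\<^sub>F w in at_infinity. w \<notin> ball a R"
      unfolding eventually_at_infinity
    proof (intro exI allI impI)
      fix w :: complex assume "norm a + R \<le> norm w"
      thus "w \<notin> ball a R" using norm_triangle_ineq2[of w a] by (simp add: dist_norm norm_minus_commute)
    qed
    thus "\<forall>\<^sub>F w in at_infinity. w \<in> ball a R \<longrightarrow> - \<eta> < f w + - poisson f a R w"
      by eventually_elim simp
  qed
  thus ?thesis by simp
qed

text \<open>At the centre the Poisson integral is the circle mean; the inequality known for small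
  circles thereby extends to all closed discs in \<open>S\<close>.\<close>

lemma supermean_on_circle_mean_le:
  assumes "supermean_on f S" "cball a r \<subseteq> S" "0 < r"
  shows "circle_mean f a r \<le> f a"
  using supermean_on_ge_poisson[OF assms(1,2), of a] assms(3) poisson_centre[of r f a] by simp

lemma poisson_eqI:
  assumes "supermean_on f S" "supermean_on (\<lambda>w. - f w) S" "cball a R \<subseteq> S" "w \<in> ball a R"
  shows "f w = poisson f a R w"
  using supermean_on_ge_poisson[OF assms(1,3,4)] supermean_on_ge_poisson[OF assms(2,3,4)]
  by (simp add: poisson_uminus)

text \<open>Converse of the mean value property: the two inequalities force \<open>f\<close> to
  equal its Poisson integral. Harmonicity of limits and of reflected functions is obtained this
  way.\<close>

lemma supermean_imp_locally_Re_holomorphic: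
  assumes "supermean_on f S" "supermean_on (\<lambda>w. - f w) S"
  shows "locally_Re_holomorphic f S"
  unfolding locally_Re_holomorphic_def
proof
  fix a assume "a \<in> S"
  then obtain R where R: "R > 0" "cball a R \<subseteq> S"
    using supermean_on_imp_open[OF assms(1)] open_contains_cball by blast
  have "continuous_on (sphere a R) f"
    by (rule continuous_on_subset[OF supermean_on_imp_continuous[OF assms(1)]]) (use R in auto)
  then obtain F where F: "F holomorphic_on ball a R" "\<And>w. w \<in> ball a R \<Longrightarrow> poisson f a R w = Re (F w)"
    using poisson_holomorphic by metis
  have "\<forall>w\<in>ball a R. f w = Re (F w)"
    using poisson_eqI[OF assms R(2)] F(2) by simp
  thus "\<exists>\<rho>>0. \<exists>F. ball a \<rho> \<subseteq> S \<and> F holomorphic_on ball a \<rho> \<and> (\<forall>w\<in>ball a \<rho>. f w = Re (F w))"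
    using F(1) R ball_subset_cball by blast
qed

lemma locally_Re_holomorphic_eq_poisson:
  assumes "locally_Re_holomorphic u S" "cball a R \<subseteq> S" "w \<in> ball a R"
  shows "u w = poisson u a R w"
  using assms
  by (intro poisson_eqI locally_Re_holomorphic_imp_supermean locally_Re_holomorphic_uminus)

lemma locally_Re_holomorphic_circle_mean:
  assumes "locally_Re_holomorphic u S" "cball a r \<subseteq> S" "0 < r"
  shows "circle_mean u a r = u a"
  using locally_Re_holomorphic_eq_poisson[OF assms(1,2), of a] assms(3) poisson_centre[of r u a] by simp

text \<open>The kernel bounds are multiplied by the nonnegative boundary values and integrated; the
  mean over the circle is \<open>u a\<close>.\<close>

lemma Harnack_ball:
  assumes u: "locally_Re_holomorphic u S" and S: "cball a R \<subseteq> S" and w: "w \<in> ball a R"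
    and nonneg: "\<And>\<zeta>. \<zeta> \<in> sphere a R \<Longrightarrow> 0 \<le> u \<zeta>"
  shows "(R - dist a w) / (R + dist a w) * u a \<le> u w"
    and "u w \<le> (R + dist a w) / (R - dist a w) * u a"
proof -
  have R: "R > 0" using w by (metis ball_eq_empty empty_iff not_le)
  have cont: "continuous_on (sphere a R) u"
    by (rule continuous_on_subset[OF locally_Re_holomorphic_imp_continuous[OF u]]) (use S in auto)
  have mean: "integral {0..1} (\<lambda>t. u (circlepath a R t)) = u a"
    using locally_Re_holomorphic_circle_mean[OF u S R] by (simp add: circle_mean_def)
  have int: "(\<lambda>t. u (circlepath a R t)) integrable_on {0..1}"
    using R by (intro integrable_compose_circlepath cont) auto
  have eq: "u w = poisson u a R w" by (rule locally_Re_holomorphic_eq_poisson[OF u S w])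
  have c: "circlepath a R t \<in> sphere a R" for t using R by simp
  have "integral {0..1} (\<lambda>t. (R - dist a w) / (R + dist a w) * u (circlepath a R t)) \<le> u w"
    unfolding eq poisson_def
    by (intro integral_le poisson_integrable[OF cont w] integrable_on_mult_right int mult_right_mono
          nonneg c poisson_kernel_bounds[OF w])
  thus "(R - dist a w) / (R + dist a w) * u a \<le> u w"
    by (simp only: integral_mult_right mean)
  have "u w \<le> integral {0..1} (\<lambda>t. (R + dist a w) / (R - dist a w) * u (circlepath a R t))"
    unfolding eq poisson_def
    by (intro integral_le poisson_integrable[OF cont w] integrable_on_mult_right int mult_right_mono
          nonneg c poisson_kernel_bounds[OF w])
  thus "u w \<le> (R + dist a w) / (R - dist a w) * u a"
    by (simp only: integral_mult_right mean)
qed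

section \<open>Poisson modification on a disc\<close>

definition poisson_modification :: "complex \<Rightarrow> real \<Rightarrow> (complex \<Rightarrow> real) \<Rightarrow> complex \<Rightarrow> real" where
  "poisson_modification a R f w = (if w \<in> ball a R then poisson f a R w else f w)"

text \<open>The delicate points lie on the circle: from inside, the Poisson integral tends to
  \<open>f\<close>, and on the circle the function is \<open>f\<close>. The closed disc and the
  complement of the open disc are then glued as closed sets.\<close>

lemma continuous_on_poisson_modification:
  assumes f: "continuous_on UNIV f" and R: "R > 0"
  shows "continuous_on UNIV (poisson_modification a R f)"
proof -
  let ?g = "poisson_modification a R f"
  have contS: "continuous_on (sphere a R) f" using f continuous_on_subset by blast
  have g1: "continuous_on (ball a R) ?g"
    using locally_Re_holomorphic_imp_continuous[OF poisson_locally_Re_holomorphic[OF contS]]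
    by (rule continuous_on_eq) (simp add: poisson_modification_def)
  have "(?g \<longlongrightarrow> ?g x) (at x within cball a R)" if x: "x \<in> cball a R" for x
  proof (cases "x \<in> ball a R")
    case True
    hence "isCont ?g x" using g1 by (simp add: continuous_on_eq_continuous_at)
    thus ?thesis unfolding isCont_def by (rule tendsto_within_subset) auto
  next
    case False
    hence xs: "x \<in> sphere a R" using x by auto
    have gx: "?g x = f x" using False by (simp add: poisson_modification_def)
    have "(poisson f a R \<longlongrightarrow> f x) (at x within ball a R)"
      by (rule poisson_tendsto_boundary[OF contS xs R])
    moreover have "\<forall>\<^sub>F w in at x within ball a R. poisson f a R w = ?g w"
      by (auto simp: eventually_at_filter poisson_modification_def)
    ultimately have 1: "(?g \<longlongrightarrow> f x) (at x within ball a R)"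
      by (rule Lim_transform_eventually)
    have "(f \<longlongrightarrow> f x) (at x within sphere a R)"
      using contS xs by (auto simp: continuous_on_def)
    moreover have "\<forall>\<^sub>F w in at x within sphere a R. f w = ?g w"
      by (auto simp: eventually_at_filter poisson_modification_def)
    ultimately have 2: "(?g \<longlongrightarrow> f x) (at x within sphere a R)"
      by (rule Lim_transform_eventually)
    have "cball a R = ball a R \<union> sphere a R" by auto
    thus ?thesis using 1 2 gx by (simp add: Lim_within_Un)
  qed
  hence "continuous_on (cball a R) ?g" by (simp add: continuous_on_def)
  moreover have "continuous_on (- ball a R) ?g"
    using continuous_on_subset[OF f] by (rule continuous_on_eq) (auto simp: poisson_modification_def)
  ultimately have "continuous_on (cball a R \<union> - ball a R) ?g"
    by (intro continuous_on_closed_Un) (auto simp: closed_def)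
  moreover have "cball a R \<union> - ball a R = UNIV" by auto
  ultimately show ?thesis by simp
qed

lemma poisson_modification_le:
  assumes "supermean_on f S" "cball a R \<subseteq> S"
  shows "poisson_modification a R f w \<le> f w"
  using supermean_on_ge_poisson[OF assms] by (simp add: poisson_modification_def)

text \<open>Inside the disc the new function is harmonic. Elsewhere the value at the centre
  \<open>b\<close> is unchanged, while the values on circles around it can only drop.\<close>

lemma supermean_on_poisson_modification:
  assumes f: "supermean_on f S" and S: "cball a R \<subseteq> S" and R: "R > 0" and cont: "continuous_on UNIV f"
  shows "supermean_on (poisson_modification a R f) S"
  unfolding supermean_on_def
proof (intro conjI ballI)
  let ?g = "poisson_modification a R f"
  have cg: "continuous_on UNIV ?g" by (rule continuous_on_poisson_modification[OF cont R])
  show "continuous_on S ?g" by (rule continuous_on_subset[OF cg]) auto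
  fix b assume b: "b \<in> S"
  have contS: "continuous_on (sphere a R) f" using cont continuous_on_subset by blast
  show "\<exists>\<rho>>0. ball b \<rho> \<subseteq> S \<and> (\<forall>r. 0 < r \<and> r < \<rho> \<longrightarrow> circle_mean ?g b r \<le> ?g b)"
  proof (cases "b \<in> ball a R")
    case True
    have "locally_Re_holomorphic ?g (ball a R)"
      by (rule locally_Re_holomorphic_cong[OF poisson_locally_Re_holomorphic[OF contS]])
         (simp add: poisson_modification_def)
    from supermean_onE[OF locally_Re_holomorphic_imp_supermean[OF this] True]
    show ?thesis using S ball_subset_cball by (metis subset_trans)
  next
    case False
    hence gb: "?g b = f b" by (simp add: poisson_modification_def)
    obtain \<rho> where \<rho>: "\<rho> > 0" "ball b \<rho> \<subseteq> S" "\<And>r. 0 < r \<Longrightarrow> r < \<rho> \<Longrightarrow> circle_mean f b r \<le> f b"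
      using supermean_onE[OF f b] by blast
    have "circle_mean ?g b r \<le> ?g b" if "0 < r" "r < \<rho>" for r
    proof -
      have "circle_mean ?g b r \<le> circle_mean f b r"
        by (intro circle_mean_mono continuous_on_subset[OF cg] continuous_on_subset[OF cont]
              poisson_modification_le[OF f S]) (use that in auto)
      thus ?thesis using \<rho>(3)[OF that] gb by simp
    qed
    thus ?thesis using \<rho> by blast
  qed
qed

section \<open>Sweeping out\<close>

lemma locally_Re_holomorphicI_local:
  assumes "\<And>x. x \<in> S \<Longrightarrow> \<exists>T. x \<in> T \<and> T \<subseteq> S \<and> locally_Re_holomorphic u T"
  shows "locally_Re_holomorphic u S"
  unfolding locally_Re_holomorphic_def
proof
  fix a assume "a \<in> S"
  then obtain T where T: "a \<in> T" "T \<subseteq> S" "locally_Re_holomorphic u T" using assms by blast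
  show "\<exists>\<rho>>0. \<exists>F. ball a \<rho> \<subseteq> S \<and> F holomorphic_on ball a \<rho> \<and> (\<forall>w\<in>ball a \<rho>. u w = Re (F w))"
    by (rule locally_Re_holomorphicE[OF T(3,1)]) (use T(2) in blast)
qed

text \<open>Harnack's convergence theorem. The differences of members of the sequence are
  nonnegative and harmonic, so their size near \<open>y\<close> is controlled by their value at
  \<open>y\<close>.\<close>

lemma decreasing_limit_locally_Re_holomorphic:
  assumes u: "\<And>k::nat. locally_Re_holomorphic (u k) S"
    and dec: "\<And>w k l. k \<le> l \<Longrightarrow> w \<in> S \<Longrightarrow> u l w \<le> u k w"
    and lim: "\<And>w. w \<in> S \<Longrightarrow> (\<lambda>k. u k w) \<longlonglongrightarrow> U w"
    and S: "open S"
  shows "locally_Re_holomorphic U S"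
proof -
  have above: "U w \<le> u k w" if "w \<in> S" for w k
    using lim[OF that] dec[OF _ that] by (intro LIMSEQ_le_const2) auto
  \<comment> \<open>3 is the Harnack constant (s + s/2) / (s - s/2) on the disc of half the radius.
    Letting l tend to infinity turns the inequality between the members k and l into one between the
    member k and \<open>U\<close>.\<close>
  have key: "\<exists>s>0. cball y s \<subseteq> S \<and> (\<forall>k. \<forall>w\<in>cball y s. u k w - U w \<le> 3 * (u k y - U y))"
    if y: "y \<in> S" for y
  proof -
    obtain s where s: "s > 0" "cball y s \<subseteq> S" using S y open_contains_cball by blast
    have "u k w - U w \<le> 3 * (u k y - U y)" if w: "w \<in> cball y (s/2)" for k w
    proof (rule LIMSEQ_le)
      have wS: "w \<in> S" "w \<in> ball y s" using w s by auto
      show "(\<lambda>l. u k w - u l w) \<longlonglongrightarrow> u k w - U w" by (intro tendsto_intros lim wS)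
      show "(\<lambda>l. 3 * (u k y - u l y)) \<longlonglongrightarrow> 3 * (u k y - U y)" by (intro tendsto_intros lim y)
      show "\<exists>N. \<forall>n\<ge>N. u k w - u n w \<le> 3 * (u k y - u n y)"
      proof (intro exI allI impI)
        fix l assume kl: "k \<le> l"
        have nn: "0 \<le> u k z - u l z" if "z \<in> S" for z using dec[OF kl that] by simp
        have "u k w - u l w \<le> (s + dist y w) / (s - dist y w) * (u k y - u l y)"
          by (rule Harnack_ball[OF locally_Re_holomorphic_diff[OF u u] s(2) wS(2)])
             (use s nn in auto)
        also have "\<dots> \<le> 3 * (u k y - u l y)"
          using w s(1) nn[OF y] by (intro mult_right_mono) (auto simp: divide_le_eq)
        finally show "u k w - u l w \<le> 3 * (u k y - u l y)" .
      qed
    qed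
    thus ?thesis using s by (intro exI[of _ "s/2"]) auto
  qed
  have cont: "continuous_on S U"
    unfolding continuous_on_eq_continuous_at[OF S]
  proof
    fix y assume y: "y \<in> S"
    obtain s where s: "s > 0" "cball y s \<subseteq> S" "\<And>k w. w \<in> cball y s \<Longrightarrow> u k w - U w \<le> 3 * (u k y - U y)"
      using key[OF y] by blast
    have "uniform_limit (cball y s) u U sequentially"
    proof (rule uniform_limitI)
      fix e :: real assume "e > 0"
      have "(\<lambda>k. 3 * (u k y - U y)) \<longlonglongrightarrow> 3 * (U y - U y)" by (intro tendsto_intros lim y)
      hence "\<forall>\<^sub>F k in sequentially. 3 * (u k y - U y) < e"
        using \<open>e > 0\<close> by (intro order_tendstoD(2)) auto
      thus "\<forall>\<^sub>F k in sequentially. \<forall>x\<in>cball y s. dist (u k x) (U x) < e"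
      proof eventually_elim
        case (elim k)
        show ?case
        proof
          fix x assume x: "x \<in> cball y s"
          have "x \<in> S" using x s(2) by blast
          from above[OF this, of k] s(3)[OF x, of k] elim
          show "dist (u k x) (U x) < e" by (simp add: dist_real_def)
        qed
      qed
    qed
    moreover have "\<forall>\<^sub>F k in sequentially. continuous_on (cball y s) (u k)"
      using locally_Re_holomorphic_imp_continuous[OF u] s(2) continuous_on_subset by (intro always_eventually) blast
    ultimately have "continuous_on (cball y s) U"
      using uniform_limit_theorem by (metis sequentially_bot)
    thus "isCont U y" using s(1) by (intro continuous_on_interior[of "cball y s"]) auto
  qed
  \<comment> \<open>The mean of \<open>U\<close> is squeezed between \<open>u k y\<close> and
    \<open>u k y\<close> minus 3 times \<open>u k y - U y\<close>, both of which tend to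
    \<open>U y\<close>.\<close>
  have mean: "\<exists>\<rho>>0. ball y \<rho> \<subseteq> S \<and> (\<forall>r. 0 < r \<and> r < \<rho> \<longrightarrow> circle_mean U y r = U y)" if y: "y \<in> S" for y
  proof -
    obtain s where s: "s > 0" "cball y s \<subseteq> S" "\<And>k w. w \<in> cball y s \<Longrightarrow> u k w - U w \<le> 3 * (u k y - U y)"
      using key[OF y] by blast
    have "circle_mean U y r = U y" if r: "0 < r" "r < s" for r
    proof -
      have sub: "sphere y r \<subseteq> cball y s" using r by auto
      have cu: "continuous_on (sphere y r) (u k)" for k
        using locally_Re_holomorphic_imp_continuous[OF u] sub s(2) by (meson continuous_on_subset order_trans)
      have cU: "continuous_on (sphere y r) U"
        using cont sub s(2) by (meson continuous_on_subset order_trans)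
      have mu: "circle_mean (u k) y r = u k y" for k
        by (rule locally_Re_holomorphic_circle_mean[OF u]) (use r s in auto)
      have le: "circle_mean U y r \<le> u k y" for k
      proof -
        have "circle_mean U y r \<le> circle_mean (u k) y r"
          by (intro circle_mean_mono cU cu above) (use r sub s(2) in auto)
        thus ?thesis by (simp add: mu)
      qed
      have ge: "u k y + - 3 * (u k y - U y) \<le> circle_mean U y r" for k
      proof -
        have "circle_mean (\<lambda>w. u k w + (- 3 * (u k y - U y))) y r \<le> circle_mean U y r"
        proof (intro circle_mean_mono cU)
          show "continuous_on (sphere y r) (\<lambda>w. u k w + - 3 * (u k y - U y))" by (intro continuous_intros cu)
          fix w assume "w \<in> sphere y r"
          hence "w \<in> cball y s" using sub by blast
          from s(3)[OF this, of k] show "u k w + - 3 * (u k y - U y) \<le> U w" by simp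
        qed (use r in auto)
        thus ?thesis using cu r by (subst (asm) circle_mean_add) (auto simp: mu)
      qed
      have "circle_mean U y r \<le> U y"
        using lim[OF y] le by (intro LIMSEQ_le_const) auto
      moreover have "(\<lambda>k. u k y + - 3 * (u k y - U y)) \<longlonglongrightarrow> U y + - 3 * (U y - U y)"
        by (intro tendsto_intros lim y)
      hence "U y \<le> circle_mean U y r"
        using ge by (intro LIMSEQ_le_const2) auto
      ultimately show ?thesis by simp
    qed
    thus ?thesis using s by (intro exI[of _ s]) (auto intro: ball_subset_cball[THEN subsetD])
  qed
  have "supermean_on U S" "supermean_on (\<lambda>w. - U w) S"
    unfolding supermean_on_def circle_mean_uminus
    using mean cont by (auto intro!: continuous_intros) (metis order_refl)+
  thus ?thesis by (rule supermean_imp_locally_Re_holomorphic)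
qed

text \<open>A point \<open>x\<close> is caught by a dense centre at distance less than r, where r is
  below half the radius of a disc around \<open>x\<close> in \<open>G\<close>; then the catching
  disc stays in \<open>G\<close>.\<close>

lemma countable_disc_cover:
  assumes "open (G :: complex set)"
  obtains P :: "(complex \<times> real) set" where "countable P"
    "\<And>a r. (a, r) \<in> P \<Longrightarrow> 0 < r \<and> cball a r \<subseteq> G"
    "\<And>x. x \<in> G \<Longrightarrow> \<exists>(a, r)\<in>P. x \<in> ball a r"
proof -
  obtain Q :: "complex set" where Q: "countable Q" "\<And>X. open X \<Longrightarrow> X \<noteq> {} \<Longrightarrow> \<exists>d\<in>Q. d \<in> X"
    using countable_dense_setE by metis
  define P where "P = (Q \<times> range (\<lambda>n::nat. 1 / real (Suc n))) \<inter> {(a, r). cball a r \<subseteq> G}"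
  show thesis
  proof (rule that[of P])
    show "countable P" unfolding P_def using Q by (intro countable_Int1 countable_SIGMA) auto
    show "\<And>a r. (a, r) \<in> P \<Longrightarrow> 0 < r \<and> cball a r \<subseteq> G" by (auto simp: P_def)
    fix x assume "x \<in> G"
    then obtain e where e: "e > 0" "cball x e \<subseteq> G" using assms open_contains_cball by blast
    obtain n where n: "1 / real (Suc n) < e / 2" using e(1) by (metis half_gt_zero nat_approx_posE)
    define r where "r = 1 / real (Suc n)"
    have r: "0 < r" "r < e / 2" using n by (simp_all add: r_def)
    obtain a where a: "a \<in> Q" "a \<in> ball x r" using Q(2)[of "ball x r"] r by auto
    have "cball a r \<subseteq> cball x e"
    proof
      fix y assume "y \<in> cball a r"
      thus "y \<in> cball x e" using a(2) r dist_triangle[of x y a] by auto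
    qed
    hence "(a, r) \<in> P" using a e by (auto simp: P_def r_def)
    moreover have "x \<in> ball a r" using a(2) by (simp add: dist_commute)
    ultimately show "\<exists>(a, r)\<in>P. x \<in> ball a r" by blast
  qed
qed

text \<open>Balayage. The closed discs lie in \<open>G\<close>, so values off \<open>G\<close> never
  change. The sequence is returned together with its limit because each \<open>v n\<close> is
  continuous on the whole plane, while continuity of \<open>V\<close> is asserted on
  \<open>G\<close> alone.\<close>

lemma sweeping_out:
  assumes G: "open G" and cont0: "continuous_on UNIV w0" and sm0: "supermean_on w0 G"
    and nonneg: "\<And>w. 0 \<le> w0 w"
  obtains v :: "nat \<Rightarrow> complex \<Rightarrow> real" and V where
    "\<And>n. continuous_on UNIV (v n)" "\<And>n. supermean_on (v n) G"
    "\<And>n w. 0 \<le> v n w" "\<And>n w. v n w \<le> w0 w"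
    "\<And>n w. w \<notin> G \<Longrightarrow> v n w = w0 w"
    "\<And>w. (\<lambda>n. v n w) \<longlonglongrightarrow> V w"
    "locally_Re_holomorphic V G"
proof (cases "G = {}")
  case True
  show thesis
    by (rule that[of "\<lambda>_. w0" w0])
       (use True assms in \<open>auto simp: locally_Re_holomorphic_def\<close>)
next
  case False
  obtain P where P: "countable P" "\<And>a r. (a, r) \<in> P \<Longrightarrow> 0 < r \<and> cball a r \<subseteq> G"
    "\<And>x. x \<in> G \<Longrightarrow> \<exists>(a, r)\<in>P. x \<in> ball a r"
    using countable_disc_cover[OF G] by metis
  have "P \<noteq> {}" using False P(3) by fastforce
  define d where "d = from_nat_into P"
  have range_d: "range d = P" using \<open>P \<noteq> {}\<close> P(1) by (simp add: d_def range_from_nat_into)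
  \<comment> \<open>through the pairing function every disc is visited infinitely often\<close>
  define c where "c n = d (fst (prod_decode n))" for n
  have cP: "0 < snd (c n)" "cball (fst (c n)) (snd (c n)) \<subseteq> G" for n
  proof -
    have "(fst (c n), snd (c n)) \<in> P" unfolding c_def using range_d by auto
    thus "0 < snd (c n)" "cball (fst (c n)) (snd (c n)) \<subseteq> G" using P(2) by blast+
  qed
  define v where "v = rec_nat w0 (\<lambda>n f. poisson_modification (fst (c n)) (snd (c n)) f)"
  have v0: "v 0 = w0" and vS: "v (Suc n) = poisson_modification (fst (c n)) (snd (c n)) (v n)" for n
    by (simp_all add: v_def)
  have v1: "continuous_on UNIV (v n) \<and> supermean_on (v n) G \<and> (\<forall>w. 0 \<le> v n w) \<and> (\<forall>w. w \<notin> G \<longrightarrow> v n w = w0 w)" for n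
  proof (induction n)
    case 0 thus ?case by (simp add: v0 assms)
  next
    case (Suc n)
    hence IH: "continuous_on UNIV (v n)" "supermean_on (v n) G" "\<And>w. 0 \<le> v n w" "\<And>w. w \<notin> G \<Longrightarrow> v n w = w0 w"
      by auto
    have nn: "0 \<le> v (Suc n) w" for w
    proof (cases "w \<in> ball (fst (c n)) (snd (c n))")
      case True
      have "poisson (\<lambda>_. 0) (fst (c n)) (snd (c n)) w \<le> poisson (v n) (fst (c n)) (snd (c n)) w"
        by (rule poisson_mono[OF _ _ True]) (auto intro: continuous_on_subset[OF IH(1)] IH(3))
      thus ?thesis using True by (simp add: vS poisson_modification_def poisson_const)
    qed (simp add: vS poisson_modification_def IH(3))
    have eq: "v (Suc n) w = w0 w" if "w \<notin> G" for w
    proof -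
      have "w \<notin> ball (fst (c n)) (snd (c n))" using that cP(2)[of n] ball_subset_cball by blast
      thus ?thesis using IH(4)[OF that] by (simp only: vS poisson_modification_def if_False)
    qed
    have "continuous_on UNIV (v (Suc n))" unfolding vS
      by (rule continuous_on_poisson_modification[OF IH(1) cP(1)])
    moreover have "supermean_on (v (Suc n)) G" unfolding vS
      by (rule supermean_on_poisson_modification[OF IH(2) cP(2) cP(1) IH(1)])
    ultimately show ?case using nn eq by blast
  qed
  have "v (Suc n) w \<le> v n w" for n w
    unfolding vS by (rule poisson_modification_le[OF _ cP(2)]) (use v1 in blast)
  hence decS: "decseq (\<lambda>n. v n w)" for w by (simp add: decseq_Suc_iff)
  hence dec: "v l w \<le> v k w" if "k \<le> l" for k l w using that by (auto simp: decseq_def)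
  define V where "V w = (INF n. v n w)" for w
  have bdd: "bdd_below (range (\<lambda>n. v n w))" for w using v1 by (intro bdd_belowI[of _ 0]) auto
  have lim: "(\<lambda>n. v n w) \<longlonglongrightarrow> V w" for w
    unfolding V_def by (rule LIMSEQ_decseq_INF[OF bdd decS])
  have "locally_Re_holomorphic V G"
  proof (rule locally_Re_holomorphicI_local)
    fix x assume "x \<in> G"
    then obtain a R where aR: "(a, R) \<in> P" "x \<in> ball a R" using P(3) by blast
    then obtain i where i: "d i = (a, R)" using range_d by (metis imageE)
    have cm: "c (prod_encode (i, k)) = (a, R)" for k by (simp add: c_def i)
    \<comment> \<open>\<open>q k\<close> is a time not before k at which the disc with index i is
      visited; \<open>p (Suc k)\<close> is the moment right after the visit at
      \<open>q (p k)\<close>, when the function is a Poisson integral on that disc. Along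
      \<open>p\<close> Harnack's convergence theorem applies there.\<close>
    define q where "q k = prod_encode (i, k)" for k
    have q: "k \<le> q k" for k unfolding q_def by (rule le_prod_encode_2)
    define p where "p = rec_nat 0 (\<lambda>_ k. Suc (q k))"
    have p: "p (Suc k) = Suc (q (p k))" for k by (simp add: p_def)
    have "p k < p (Suc k)" for k using q[of "p k"] by (simp add: p)
    hence smp: "strict_mono p" by (rule strict_monoI_Suc)
    have "locally_Re_holomorphic V (ball a R)"
    proof (rule decreasing_limit_locally_Re_holomorphic)
      show "locally_Re_holomorphic (v (p (Suc k))) (ball a R)" for k
      proof (rule locally_Re_holomorphic_cong[OF poisson_locally_Re_holomorphic])
        show "continuous_on (sphere a R) (v (q (p k)))" using v1 continuous_on_subset by blast
        show "w \<in> ball a R \<Longrightarrow> v (p (Suc k)) w = poisson (v (q (p k))) a R w" for w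
          using cm[of "p k"] by (simp add: p vS poisson_modification_def q_def)
      qed
      show "v (p (Suc l)) w \<le> v (p (Suc k)) w" if "k \<le> l" for w k l
        using that strict_mono_leD[OF smp, of "Suc k" "Suc l"] by (intro dec) auto
      show "(\<lambda>k. v (p (Suc k)) w) \<longlonglongrightarrow> V w" for w
      proof -
        have "strict_mono (\<lambda>k. p (Suc k))" using smp by (auto simp: strict_mono_def)
        from LIMSEQ_subseq_LIMSEQ[OF lim this] show ?thesis by (simp add: o_def)
      qed
    qed auto
    thus "\<exists>T. x \<in> T \<and> T \<subseteq> G \<and> locally_Re_holomorphic V T"
      using aR P(2) ball_subset_cball by (intro exI[of _ "ball a R"]) blast
  qed
  moreover have "v n w \<le> w0 w" for n w using dec[of 0 n w] by (simp add: v0)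
  ultimately show thesis using v1 lim by (intro that[of v V]) auto
qed

section \<open>Harmonic functions as local real parts\<close>

lemma DERIV_along_Re:
  assumes "(u has_derivative (\<lambda>h. a * Re h + b * Im h)) (at (z + complex_of_real x))"
  shows "DERIV (\<lambda>t. u (z + complex_of_real t)) x :> a"
proof -
  have "((\<lambda>t. z + complex_of_real t) has_derivative (\<lambda>t. complex_of_real t)) (at x)"
    by (auto intro!: derivative_eq_intros)
  from has_derivative_compose[OF this assms] show ?thesis
    by (simp add: has_field_derivative_def)
qed

lemma DERIV_along_Im:
  assumes "(u has_derivative (\<lambda>h. a * Re h + b * Im h)) (at (z + \<i> * complex_of_real x))"
  shows "DERIV (\<lambda>t. u (z + \<i> * complex_of_real t)) x :> b"
proof -
  have "((\<lambda>t. z + \<i> * complex_of_real t) has_derivative (\<lambda>t. \<i> * complex_of_real t)) (at x)"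
    by (auto intro!: derivative_eq_intros)
  from has_derivative_compose[OF this assms] show ?thesis
    by (simp add: has_field_derivative_def)
qed

text \<open>Clairaut's theorem: the second difference of \<open>u\<close> over a small square is
  evaluated by the mean value theorem in both orders. The symmetry is not part of
  \<open>harmonic_on\<close>, and the Cauchy-Riemann equations for ux - i uy require it.\<close>

lemma mixed_partials_eq:
  assumes S: "open S" "z \<in> S"
    and c: "continuous_on S uxy" "continuous_on S uyx"
    and d: "\<And>z. z \<in> S \<Longrightarrow> (u has_derivative (\<lambda>h. ux z * Re h + uy z * Im h)) (at z)"
      "\<And>z. z \<in> S \<Longrightarrow> (ux has_derivative (\<lambda>h. uxx z * Re h + uxy z * Im h)) (at z)"
      "\<And>z. z \<in> S \<Longrightarrow> (uy has_derivative (\<lambda>h. uyx z * Re h + uyy z * Im h)) (at z)"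
  shows "uxy z = (uyx z :: real)"
proof -
  have pts: "\<exists>p q. dist p z < e \<and> dist q z < e \<and> uxy p = uyx q" if e: "e > 0" "ball z e \<subseteq> S" for e
  proof -
    define t where "t = e / 4"
    have t: "0 < t" using e by (simp add: t_def)
    have near: "dist (z + complex_of_real x + \<i> * complex_of_real y) z < e" if "0 \<le> x" "x \<le> t" "0 \<le> y" "y \<le> t" for x y
    proof -
      have "dist (z + complex_of_real x + \<i> * complex_of_real y) z = cmod (complex_of_real x + \<i> * complex_of_real y)"
        by (simp add: dist_norm add.assoc)
      also have "\<dots> \<le> x + y" using that norm_triangle_ineq[of "complex_of_real x" "\<i> * complex_of_real y"]
        by (simp add: norm_mult)
      also have "\<dots> < e" using that e by (simp add: t_def)
      finally show ?thesis .
    qed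
    have inS: "z + complex_of_real x + \<i> * complex_of_real y \<in> S" if "0 \<le> x" "x \<le> t" "0 \<le> y" "y \<le> t" for x y
      using near[OF that] e(2) by (auto simp: dist_commute)
    \<comment> \<open>The second difference over the square of side t = e/4; with this side all
      intermediate points stay within e of \<open>z\<close>.\<close>
    define D where "D = u (z + complex_of_real t + \<i> * complex_of_real t) - u (z + complex_of_real t)
        - u (z + \<i> * complex_of_real t) + u z"
    have swap: "z + complex_of_real x + \<i> * complex_of_real y = z + \<i> * complex_of_real y + complex_of_real x" for x y
      by simp
    have D1: "DERIV (\<lambda>x. u (z + complex_of_real x + \<i> * complex_of_real y)) x :> ux (z + complex_of_real x + \<i> * complex_of_real y)"
      if "0 \<le> x" "x \<le> t" "0 \<le> y" "y \<le> t" for x y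
      unfolding swap by (rule DERIV_along_Re[OF d(1)[OF inS[OF that], unfolded swap]])
    have D2: "DERIV (\<lambda>y. u (z + complex_of_real x + \<i> * complex_of_real y)) y :> uy (z + complex_of_real x + \<i> * complex_of_real y)"
      if "0 \<le> x" "x \<le> t" "0 \<le> y" "y \<le> t" for x y
      by (rule DERIV_along_Im[OF d(1)[OF inS[OF that]]])
    have D3: "DERIV (\<lambda>y. ux (z + complex_of_real x + \<i> * complex_of_real y)) y :> uxy (z + complex_of_real x + \<i> * complex_of_real y)"
      if "0 \<le> x" "x \<le> t" "0 \<le> y" "y \<le> t" for x y
      by (rule DERIV_along_Im[OF d(2)[OF inS[OF that]]])
    have D4: "DERIV (\<lambda>x. uy (z + complex_of_real x + \<i> * complex_of_real y)) x :> uyx (z + complex_of_real x + \<i> * complex_of_real y)"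
      if "0 \<le> x" "x \<le> t" "0 \<le> y" "y \<le> t" for x y
      unfolding swap by (rule DERIV_along_Re[OF d(3)[OF inS[OF that], unfolded swap]])
    obtain x1 where x1: "0 < x1" "x1 < t"
      "D = t * (ux (z + complex_of_real x1 + \<i> * complex_of_real t) - ux (z + complex_of_real x1 + \<i> * complex_of_real 0))"
    proof -
      have "\<exists>x>0. x < t \<and> (\<lambda>x. u (z + complex_of_real x + \<i> * complex_of_real t) - u (z + complex_of_real x + \<i> * complex_of_real 0)) t
        - (\<lambda>x. u (z + complex_of_real x + \<i> * complex_of_real t) - u (z + complex_of_real x + \<i> * complex_of_real 0)) 0
        = (t - 0) * (ux (z + complex_of_real x + \<i> * complex_of_real t) - ux (z + complex_of_real x + \<i> * complex_of_real 0))"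
        using t by (intro MVT2 DERIV_diff D1) auto
      thus thesis using that by (auto simp: D_def)
    qed
    obtain y1 where y1: "0 < y1" "y1 < t"
      "ux (z + complex_of_real x1 + \<i> * complex_of_real t) - ux (z + complex_of_real x1 + \<i> * complex_of_real 0)
        = t * uxy (z + complex_of_real x1 + \<i> * complex_of_real y1)"
    proof -
      have "\<exists>y>0. y < t \<and> ux (z + complex_of_real x1 + \<i> * complex_of_real t) - ux (z + complex_of_real x1 + \<i> * complex_of_real 0)
        = (t - 0) * uxy (z + complex_of_real x1 + \<i> * complex_of_real y)"
        using t x1 by (intro MVT2 D3) auto
      thus thesis using that by auto
    qed
    obtain y2 where y2: "0 < y2" "y2 < t"
      "D = t * (uy (z + complex_of_real t + \<i> * complex_of_real y2) - uy (z + complex_of_real 0 + \<i> * complex_of_real y2))"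
    proof -
      have "\<exists>y>0. y < t \<and> (\<lambda>y. u (z + complex_of_real t + \<i> * complex_of_real y) - u (z + complex_of_real 0 + \<i> * complex_of_real y)) t
        - (\<lambda>y. u (z + complex_of_real t + \<i> * complex_of_real y) - u (z + complex_of_real 0 + \<i> * complex_of_real y)) 0
        = (t - 0) * (uy (z + complex_of_real t + \<i> * complex_of_real y) - uy (z + complex_of_real 0 + \<i> * complex_of_real y))"
        using t by (intro MVT2 DERIV_diff D2) auto
      thus thesis using that by (auto simp: D_def)
    qed
    obtain x2 where x2: "0 < x2" "x2 < t"
      "uy (z + complex_of_real t + \<i> * complex_of_real y2) - uy (z + complex_of_real 0 + \<i> * complex_of_real y2)
        = t * uyx (z + complex_of_real x2 + \<i> * complex_of_real y2)"
    proof -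
      have "\<exists>x>0. x < t \<and> uy (z + complex_of_real t + \<i> * complex_of_real y2) - uy (z + complex_of_real 0 + \<i> * complex_of_real y2)
        = (t - 0) * uyx (z + complex_of_real x + \<i> * complex_of_real y2)"
        using t y2 by (intro MVT2 D4) auto
      thus thesis using that by auto
    qed
    have "uxy (z + complex_of_real x1 + \<i> * complex_of_real y1) = uyx (z + complex_of_real x2 + \<i> * complex_of_real y2)"
      using x1(3) y1(3) y2(3) x2(3) t by simp
    thus ?thesis using near[of x1 y1] near[of x2 y2] x1 y1 x2 y2 by (meson less_imp_le)
  qed
  show ?thesis
  proof (rule ccontr)
    assume ne: "uxy z \<noteq> uyx z"
    define \<epsilon> where "\<epsilon> = \<bar>uxy z - uyx z\<bar> / 2"
    have \<epsilon>: "\<epsilon> > 0" using ne by (simp add: \<epsilon>_def)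
    obtain e0 where e0: "e0 > 0" "ball z e0 \<subseteq> S" using S open_contains_ball by blast
    obtain e1 where e1: "e1 > 0" "\<And>p. p \<in> S \<Longrightarrow> dist p z < e1 \<Longrightarrow> dist (uxy p) (uxy z) < \<epsilon>"
      using c(1) S(2) \<epsilon> unfolding continuous_on_iff by metis
    obtain e2 where e2: "e2 > 0" "\<And>p. p \<in> S \<Longrightarrow> dist p z < e2 \<Longrightarrow> dist (uyx p) (uyx z) < \<epsilon>"
      using c(2) S(2) \<epsilon> unfolding continuous_on_iff by metis
    define e where "e = min e0 (min e1 e2)"
    have "e > 0" "ball z e \<subseteq> S" using e0 e1 e2 by (auto simp: e_def)
    from pts[OF this] obtain p q where pq: "dist p z < e" "dist q z < e" "uxy p = uyx q" by blast
    have "p \<in> S" "q \<in> S" using pq \<open>ball z e \<subseteq> S\<close> by (auto simp: dist_commute)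
    with e1(2)[of p] e2(2)[of q] pq have "dist (uxy p) (uxy z) < \<epsilon>" "dist (uxy p) (uyx z) < \<epsilon>"
      by (simp_all add: e_def)
    with dist_triangle3[of "uxy z" "uyx z" "uxy p"] have "dist (uxy z) (uyx z) < 2 * \<epsilon>" by linarith
    thus False by (simp add: \<epsilon>_def dist_real_def)
  qed
qed

text \<open>The Laplace equation and the symmetry of the mixed derivatives are the Cauchy-Riemann
  equations for ux - i uy. A primitive of it on a disc has a real part with the same gradient as
  \<open>u\<close>.\<close>

lemma harmonic_on_imp_locally_Re_holomorphic:
  assumes "harmonic_on u S"
  shows "locally_Re_holomorphic u S"
proof -
  from assms obtain ux uy uxx uxy uyx uyy where S: "open S" and
    c: "continuous_on S uxy" "continuous_on S uyx"
    and d: "\<And>z. z \<in> S \<Longrightarrow> (u has_derivative (\<lambda>h. ux z * Re h + uy z * Im h)) (at z)"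
      "\<And>z. z \<in> S \<Longrightarrow> (ux has_derivative (\<lambda>h. uxx z * Re h + uxy z * Im h)) (at z)"
      "\<And>z. z \<in> S \<Longrightarrow> (uy has_derivative (\<lambda>h. uyx z * Re h + uyy z * Im h)) (at z)"
    and lap: "\<And>z. z \<in> S \<Longrightarrow> uxx z + uyy z = 0"
    unfolding harmonic_on_def by blast
  define f where "f z = Complex (ux z) (- uy z)" for z
  have f: "(f has_field_derivative Complex (uxx z) (- uyx z)) (at z)" if z: "z \<in> S" for z
  proof -
    have sym: "uxy z = uyx z" by (rule mixed_partials_eq[OF S z c d])
    have f_eq: "f = (\<lambda>z. of_real (ux z) - \<i> * of_real (uy z))" by (auto simp: f_def complex_eq_iff)
    have "(f has_derivative (\<lambda>h. of_real (uxx z * Re h + uxy z * Im h) - \<i> * of_real (uyx z * Re h + uyy z * Im h))) (at z)"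
      unfolding f_eq by (intro derivative_intros d z)
    moreover have "(\<lambda>h. complex_of_real (uxx z * Re h + uxy z * Im h) - \<i> * of_real (uyx z * Re h + uyy z * Im h))
        = (*) (Complex (uxx z) (- uyx z))"
    proof
      fix h
      have "uyy z = - uxx z" using lap[OF z] by simp
      thus "complex_of_real (uxx z * Re h + uxy z * Im h) - \<i> * of_real (uyx z * Re h + uyy z * Im h)
        = Complex (uxx z) (- uyx z) * h"
        by (simp add: complex_eq_iff sym algebra_simps)
    qed
    ultimately show ?thesis by (simp add: has_field_derivative_def)
  qed
  show ?thesis
    unfolding locally_Re_holomorphic_def
  proof
    fix a assume a: "a \<in> S"
    obtain r where r: "r > 0" "ball a r \<subseteq> S" using S a open_contains_ball by blast
    have "f holomorphic_on ball a r"
      unfolding holomorphic_on_def field_differentiable_def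
      using f r by (blast intro: has_field_derivative_at_within)
    then obtain F where F: "\<And>x. x \<in> ball a r \<Longrightarrow> (F has_field_derivative f x) (at x within ball a r)"
      using holomorphic_convex_primitive'[of "ball a r" f] by auto
    have "((\<lambda>w. u w - Re (F w)) has_derivative (\<lambda>h. 0)) (at x within ball a r)" if x: "x \<in> ball a r" for x
    proof -
      have xS: "x \<in> S" using r x by blast
      have "((\<lambda>w. u w - Re (F w)) has_derivative (\<lambda>h. (ux x * Re h + uy x * Im h) - Re (f x * h))) (at x within ball a r)"
        by (intro has_derivative_diff has_derivative_Re has_derivative_at_withinI[OF d(1)[OF xS]]
              F[OF x, unfolded has_field_derivative_def])
      thus ?thesis by (simp add: f_def)
    qed
    from has_derivative_zero_constant[OF convex_ball this]
    obtain c where c: "\<And>x. x \<in> ball a r \<Longrightarrow> u x - Re (F x) = c" by blast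
    show "\<exists>\<rho>>0. \<exists>F. ball a \<rho> \<subseteq> S \<and> F holomorphic_on ball a \<rho> \<and> (\<forall>w\<in>ball a \<rho>. u w = Re (F w))"
    proof (intro exI conjI ballI)
      show "(\<lambda>w. F w + of_real c) holomorphic_on ball a r"
        using F by (intro holomorphic_intros) (unfold holomorphic_on_def field_differentiable_def, blast)
      show "w \<in> ball a r \<Longrightarrow> u w = Re (F w + of_real c)" for w using c[of w] by simp
    qed (use r in auto)
  qed
qed

lemma Re_holomorphic_has_derivative:
  assumes F: "F holomorphic_on ball a \<rho>" and u: "\<And>w. w \<in> ball a \<rho> \<Longrightarrow> u w = Re (F w)"
    and z: "z \<in> ball a \<rho>"
  shows "(u has_derivative (\<lambda>h. Re (deriv F z) * Re h + Re (\<i> * deriv F z) * Im h)) (at z)"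
proof -
  have "(F has_field_derivative deriv F z) (at z)"
    by (rule holomorphic_derivI[OF F _ z]) auto
  hence "((\<lambda>w. Re (F w)) has_derivative (\<lambda>h. Re (deriv F z * h))) (at z)"
    unfolding has_field_derivative_def by (intro derivative_intros)
  hence "(u has_derivative (\<lambda>h. Re (deriv F z * h))) (at z)"
    by (rule has_derivative_transform_within_open[OF _ open_ball z]) (simp add: u)
  thus ?thesis by (simp add: algebra_simps)
qed

lemma locally_Re_holomorphic_imp_harmonic_on:
  assumes u: "locally_Re_holomorphic u S"
  shows "harmonic_on u S"
proof -
  \<comment> \<open>Partial derivatives taken through \<open>frechet_derivative\<close> do not
    depend on the local choice of \<open>F\<close>, so they are single functions on all of
    \<open>S\<close>; locally they are Re F' and Re (i F').\<close>
  define dx dy where "dx v z = frechet_derivative v (at z) (1::complex)"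
    and "dy v z = frechet_derivative v (at z) \<i>" for v :: "complex \<Rightarrow> real" and z :: complex
  have loc: "dx v z = Re (deriv F z)" "dy v z = Re (\<i> * deriv F z)"
    "(v has_derivative (\<lambda>h. dx v z * Re h + dy v z * Im h)) (at z)"
    if F: "F holomorphic_on ball a \<rho>" "\<And>w. w \<in> ball a \<rho> \<Longrightarrow> v w = Re (F w)" "z \<in> ball a \<rho>" for v a \<rho> F z
  proof -
    have D: "(v has_derivative (\<lambda>h. Re (deriv F z) * Re h + Re (\<i> * deriv F z) * Im h)) (at z)"
      by (rule Re_holomorphic_has_derivative[OF F])
    show "dx v z = Re (deriv F z)" "dy v z = Re (\<i> * deriv F z)"
      unfolding dx_def dy_def by (simp_all add: frechet_derivative_at[OF D, symmetric])
    with D show "(v has_derivative (\<lambda>h. dx v z * Re h + dy v z * Im h)) (at z)" by simp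
  qed
  have partials: "locally_Re_holomorphic (dx v) S \<and> locally_Re_holomorphic (dy v) S"
    if v: "locally_Re_holomorphic v S" for v
    unfolding locally_Re_holomorphic_def
  proof (intro conjI ballI)
    fix a assume "a \<in> S"
    then obtain \<rho> F where F: "\<rho> > 0" "ball a \<rho> \<subseteq> S" "F holomorphic_on ball a \<rho>" "\<And>w. w \<in> ball a \<rho> \<Longrightarrow> v w = Re (F w)"
      using locally_Re_holomorphicE[OF v] by blast
    have h: "deriv F holomorphic_on ball a \<rho>" by (rule holomorphic_deriv[OF F(3)]) auto
    show "\<exists>\<rho>>0. \<exists>F. ball a \<rho> \<subseteq> S \<and> F holomorphic_on ball a \<rho> \<and> (\<forall>w\<in>ball a \<rho>. dx v w = Re (F w))"
      using F(1,2) h loc(1)[OF F(3,4)] by blast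
    show "\<exists>\<rho>>0. \<exists>F. ball a \<rho> \<subseteq> S \<and> F holomorphic_on ball a \<rho> \<and> (\<forall>w\<in>ball a \<rho>. dy v w = Re (F w))"
    proof (intro exI[of _ \<rho>] conjI exI[of _ "\<lambda>w. \<i> * deriv F w"] ballI)
      show "(\<lambda>w. \<i> * deriv F w) holomorphic_on ball a \<rho>" by (intro holomorphic_intros h)
    qed (use F loc(2)[OF F(3,4)] in auto)
  qed
  have der: "(v has_derivative (\<lambda>h. dx v z * Re h + dy v z * Im h)) (at z)"
    if v: "locally_Re_holomorphic v S" and z: "z \<in> S" for v z
  proof -
    obtain \<rho> F where F: "\<rho> > 0" "ball z \<rho> \<subseteq> S" "F holomorphic_on ball z \<rho>" "\<And>w. w \<in> ball z \<rho> \<Longrightarrow> v w = Re (F w)"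
      using locally_Re_holomorphicE[OF v z] by blast
    have zz: "z \<in> ball z \<rho>" using F(1) by simp
    show ?thesis by (rule loc(3)[OF F(3,4) zz])
  qed
  have lap: "dx (dx u) z + dy (dy u) z = 0" if z: "z \<in> S" for z
  proof -
    obtain \<rho> F where F: "\<rho> > 0" "ball z \<rho> \<subseteq> S" "F holomorphic_on ball z \<rho>" "\<And>w. w \<in> ball z \<rho> \<Longrightarrow> u w = Re (F w)"
      using locally_Re_holomorphicE[OF u z] by blast
    have h: "deriv F holomorphic_on ball z \<rho>" by (rule holomorphic_deriv[OF F(3)]) auto
    have h': "(\<lambda>w. \<i> * deriv F w) holomorphic_on ball z \<rho>" by (intro holomorphic_intros h)
    have zz: "z \<in> ball z \<rho>" using F(1) by simp
    have "dx (dx u) z = Re (deriv (deriv F) z)"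
      by (rule loc(1)[OF h loc(1)[OF F(3,4)] zz])
    moreover have "dy (dy u) z = Re (\<i> * deriv (\<lambda>w. \<i> * deriv F w) z)"
      by (rule loc(2)[OF h' loc(2)[OF F(3,4)] zz])
    moreover have "deriv (\<lambda>w. \<i> * deriv F w) z = \<i> * deriv (deriv F) z"
      using h zz by (intro deriv_cmult holomorphic_on_imp_differentiable_at[of _ "ball z \<rho>"]) auto
    ultimately show ?thesis by simp
  qed
  have p1: "locally_Re_holomorphic (dx u) S" "locally_Re_holomorphic (dy u) S"
    using partials[OF u] by auto
  have p2: "locally_Re_holomorphic (dx (dx u)) S" "locally_Re_holomorphic (dy (dx u)) S"
    "locally_Re_holomorphic (dx (dy u)) S" "locally_Re_holomorphic (dy (dy u)) S"
    using partials[OF p1(1)] partials[OF p1(2)] by auto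
  show ?thesis unfolding harmonic_on_def
    by (intro conjI exI[of _ "dx u"] exI[of _ "dy u"] exI[of _ "dx (dx u)"] exI[of _ "dy (dx u)"]
        exI[of _ "dx (dy u)"] exI[of _ "dy (dy u)"] ballI locally_Re_holomorphic_imp_continuous p2
        der[OF u] der[OF p1(1)] der[OF p1(2)] lap locally_Re_holomorphic_imp_open[OF u])
qed

lemma harmonic_on_iff_locally_Re_holomorphic: "harmonic_on u S \<longleftrightarrow> locally_Re_holomorphic u S"
  using harmonic_on_imp_locally_Re_holomorphic locally_Re_holomorphic_imp_harmonic_on by blast

section \<open>Gaussian averages of functions with the super-mean-value property\<close>

lemma measurable_Complex [measurable]: "(\<lambda>(x, y). Complex x y) \<in> borel_measurable (borel \<Otimes>\<^sub>M borel)"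
  unfolding Complex_eq split_beta by measurable

text \<open>Both measures give a box the product of its side lengths; with this, Tonelli's theorem
  is available in real coordinates.\<close>

lemma lborel_complex_eq_pair:
  "(lborel :: complex measure) = distr (lborel \<Otimes>\<^sub>M lborel) borel (\<lambda>(x, y). Complex x y)"
proof (rule lborel_eqI)
  fix l u :: complex assume lu: "\<And>b. b \<in> Basis \<Longrightarrow> l \<bullet> b \<le> u \<bullet> b"
  hence le: "Re l \<le> Re u" "Im l \<le> Im u" using lu[of 1] lu[of \<i>] by (simp_all add: Basis_complex_def)
  have "(\<lambda>(x, y). Complex x y) -` box l u \<inter> space (lborel \<Otimes>\<^sub>M lborel) = {Re l<..<Re u} \<times> {Im l<..<Im u}"
    by (auto simp: box_def Basis_complex_def space_pair_measure)
  hence "emeasure (distr (lborel \<Otimes>\<^sub>M lborel) borel (\<lambda>(x, y). Complex x y)) (box l u)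
      = emeasure (lborel \<Otimes>\<^sub>M lborel) ({Re l<..<Re u} \<times> {Im l<..<Im u})"
    by (subst emeasure_distr) auto
  also have "\<dots> = ennreal (Re u - Re l) * ennreal (Im u - Im l)"
    using le by (subst lborel.emeasure_pair_measure_Times) auto
  also have "\<dots> = (\<Prod>b\<in>Basis. (u - l) \<bullet> b)"
    using le by (simp add: Basis_complex_def ennreal_mult)
  finally show "emeasure (distr (lborel \<Otimes>\<^sub>M lborel) borel (\<lambda>(x, y). Complex x y)) (box l u)
      = ennreal (\<Prod>b\<in>Basis. (u - l) \<bullet> b)" .
qed simp

lemma nn_integral_complex:
  assumes [measurable]: "f \<in> borel_measurable borel"
  shows "(\<integral>\<^sup>+z. f z \<partial>lborel) = (\<integral>\<^sup>+x. \<integral>\<^sup>+y. f (Complex x y) \<partial>lborel \<partial>lborel)"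
    and "(\<integral>\<^sup>+z. f z \<partial>lborel) = (\<integral>\<^sup>+y. \<integral>\<^sup>+x. f (Complex x y) \<partial>lborel \<partial>lborel)"
proof -
  have m: "(\<lambda>(x, y). f (Complex x y)) \<in> borel_measurable (lborel \<Otimes>\<^sub>M lborel)"
    using measurable_compose[OF measurable_Complex assms] by (simp add: split_beta')
  have "(\<integral>\<^sup>+z. f z \<partial>lborel) = (\<integral>\<^sup>+p. f (case p of (x, y) \<Rightarrow> Complex x y) \<partial>(lborel \<Otimes>\<^sub>M lborel))"
    by (subst lborel_complex_eq_pair) (simp add: nn_integral_distr)
  also have "\<dots> = (\<integral>\<^sup>+p. (case p of (x, y) \<Rightarrow> f (Complex x y)) \<partial>(lborel \<Otimes>\<^sub>M lborel))"
    by (simp add: split_beta')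
  finally have *: "(\<integral>\<^sup>+z. f z \<partial>lborel) = (\<integral>\<^sup>+p. (case p of (x, y) \<Rightarrow> f (Complex x y)) \<partial>(lborel \<Otimes>\<^sub>M lborel))" .
  show "(\<integral>\<^sup>+z. f z \<partial>lborel) = (\<integral>\<^sup>+x. \<integral>\<^sup>+y. f (Complex x y) \<partial>lborel \<partial>lborel)"
    unfolding * by (subst lborel.nn_integral_fst[OF m, symmetric]) simp
  show "(\<integral>\<^sup>+z. f z \<partial>lborel) = (\<integral>\<^sup>+y. \<integral>\<^sup>+x. f (Complex x y) \<partial>lborel \<partial>lborel)"
    unfolding * by (subst lborel_pair.nn_integral_snd[OF m, symmetric]) simp
qed

text \<open>A shear translates every line parallel to one axis, and the integral along that line is
  translation invariant.\<close>

lemma nn_integral_shear: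
  assumes f [measurable]: "f \<in> borel_measurable borel"
  shows "(\<integral>\<^sup>+z. f (Complex (Re z + a * Im z) (Im z)) \<partial>lborel) = (\<integral>\<^sup>+z. f z \<partial>lborel)"
    and "(\<integral>\<^sup>+z. f (Complex (Re z) (Im z + a * Re z)) \<partial>lborel) = (\<integral>\<^sup>+z. f z \<partial>lborel)"
proof -
  have [measurable]: "(\<lambda>z. f (Complex (Re z + a * Im z) (Im z))) \<in> borel_measurable borel"
    "(\<lambda>z. f (Complex (Re z) (Im z + a * Re z))) \<in> borel_measurable borel"
    "(\<lambda>x. f (Complex x y)) \<in> borel_measurable borel" "(\<lambda>x. f (Complex y x)) \<in> borel_measurable borel" for y
    unfolding Complex_eq by measurable
  have "(\<integral>\<^sup>+x. f (Complex (x + a * y) y) \<partial>lborel) = (\<integral>\<^sup>+x. f (Complex x y) \<partial>lborel)" for y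
    using nn_integral_real_affine[of "\<lambda>x. f (Complex x y)" 1 "a * y"] by (simp add: add.commute)
  thus "(\<integral>\<^sup>+z. f (Complex (Re z + a * Im z) (Im z)) \<partial>lborel) = (\<integral>\<^sup>+z. f z \<partial>lborel)"
    by (subst (1 2) nn_integral_complex(2)) simp_all
  have "(\<integral>\<^sup>+y. f (Complex x (y + a * x)) \<partial>lborel) = (\<integral>\<^sup>+y. f (Complex x y) \<partial>lborel)" for x
    using nn_integral_real_affine[of "\<lambda>y. f (Complex x y)" 1 "a * x"] by (simp add: add.commute)
  thus "(\<integral>\<^sup>+z. f (Complex (Re z) (Im z + a * Re z)) \<partial>lborel) = (\<integral>\<^sup>+z. f z \<partial>lborel)"
    by (subst (1 2) nn_integral_complex(1)) simp_all
qed

text \<open>A rotation other than \<open>z \<mapsto> -z\<close> is a product of three shears.\<close>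

lemma nn_integral_rotation_aux:
  assumes f [measurable]: "f \<in> borel_measurable borel" and c: "cmod c = 1" "c \<noteq> - 1"
  shows "(\<integral>\<^sup>+z. f (c * z) \<partial>lborel) = (\<integral>\<^sup>+z. f z \<partial>lborel)"
proof -
  \<comment> \<open>For a rotation by \<theta> the middle shear has factor sin \<theta> and the
    outer ones have - tan (\<theta>/2) = - sin \<theta> / (1 + cos \<theta>), which is undefined
    exactly at c = -1.\<close>
  define p q a where "p = Re c" and "q = Im c" and "a = - q / (1 + p)"
  have pq: "p\<^sup>2 + q\<^sup>2 = 1" using c(1) cmod_power2[of c] by (simp add: p_def q_def)
  have "p \<noteq> - 1"
  proof
    assume "p = - 1"
    hence "q = 0" using pq by simp
    with \<open>p = - 1\<close> c(2) show False by (simp add: p_def q_def complex_eq_iff)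
  qed
  hence p1: "1 + p \<noteq> 0" by linarith
  have a1: "1 + a * q = p"
  proof -
    have "(1 + p) * (1 + a * q) = 1 + p - q\<^sup>2" using p1 by (simp add: a_def field_simps power2_eq_square)
    also have "\<dots> = (1 + p) * p" using pq by (simp add: power2_eq_square algebra_simps)
    finally show ?thesis using p1 by simp
  qed
  have "p * a + a = a * (1 + p)" by (simp add: algebra_simps)
  also have "\<dots> = - q" using p1 by (simp add: a_def)
  finally have a2: "p * a + a = - q" .
  let ?h = "\<lambda>z. Complex (Re z + a * Im z) (Im z)" and ?v = "\<lambda>z. Complex (Re z) (Im z + q * Re z)"
  have hvh: "?h (?v (?h z)) = c * z" for z
  proof -
    have "Re z + a * Im z + a * (Im z + q * (Re z + a * Im z)) = (1 + a * q) * Re z + ((1 + a * q) * a + a) * Im z"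
      by (simp add: algebra_simps)
    also have "\<dots> = p * Re z - q * Im z" unfolding a1 a2 by simp
    finally have 1: "Re z + a * Im z + a * (Im z + q * (Re z + a * Im z)) = p * Re z - q * Im z" .
    have "Im z + q * (Re z + a * Im z) = (1 + a * q) * Im z + q * Re z" by (simp add: algebra_simps)
    hence 2: "Im z + q * (Re z + a * Im z) = p * Im z + q * Re z" unfolding a1 .
    show ?thesis using 1 2 by (simp add: complex_eq_iff p_def q_def)
  qed
  have [measurable]: "?h \<in> borel_measurable borel" "?v \<in> borel_measurable borel"
    unfolding Complex_eq by measurable
  have "(\<integral>\<^sup>+z. f (c * z) \<partial>lborel) = (\<integral>\<^sup>+z. f (?h (?v (?h z))) \<partial>lborel)" by (simp only: hvh)
  also have "\<dots> = (\<integral>\<^sup>+z. f (?h (?v z)) \<partial>lborel)"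
    by (rule nn_integral_shear(1)[of "\<lambda>z. f (?h (?v z))"]) measurable
  also have "\<dots> = (\<integral>\<^sup>+z. f (?h z) \<partial>lborel)"
    by (rule nn_integral_shear(2)[of "\<lambda>z. f (?h z)"]) measurable
  also have "\<dots> = (\<integral>\<^sup>+z. f z \<partial>lborel)" by (rule nn_integral_shear(1)) measurable
  finally show ?thesis .
qed

text \<open>The exceptional rotation by -1 is the square of the rotation by i.\<close>

lemma nn_integral_rotation:
  assumes f [measurable]: "f \<in> borel_measurable borel" and c: "cmod c = 1"
  shows "(\<integral>\<^sup>+z. f (c * z) \<partial>lborel) = (\<integral>\<^sup>+z. f z \<partial>lborel)"
proof (cases "c = - 1")
  case True
  have i: "\<i> \<noteq> - 1" by (simp add: complex_eq_iff)
  have "(\<integral>\<^sup>+z. f (c * z) \<partial>lborel) = (\<integral>\<^sup>+z. f (\<i> * (\<i> * z)) \<partial>lborel)"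
    by (simp add: True mult.assoc[symmetric])
  also have "\<dots> = (\<integral>\<^sup>+z. f (\<i> * z) \<partial>lborel)"
    by (rule nn_integral_rotation_aux[of "\<lambda>z. f (\<i> * z)"]) (use i in auto)
  also have "\<dots> = (\<integral>\<^sup>+z. f z \<partial>lborel)"
    by (rule nn_integral_rotation_aux) (use i in auto)
  finally show ?thesis .
qed (use nn_integral_rotation_aux[OF f c] in simp)

section \<open>The planar Gaussian law\<close>

definition complex_gauss_density :: "real \<Rightarrow> complex \<Rightarrow> real" where
  "complex_gauss_density \<sigma> w = normal_density 0 \<sigma> (Re w) * normal_density 0 \<sigma> (Im w)"

definition complex_gauss :: "real \<Rightarrow> complex measure" where
  "complex_gauss \<sigma> = density lborel (\<lambda>w. ennreal (complex_gauss_density \<sigma> w))"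

lemma measurable_complex_gauss_density [measurable]: "complex_gauss_density \<sigma> \<in> borel_measurable borel"
  unfolding complex_gauss_density_def by measurable

lemma complex_gauss_density_nonneg [simp]: "0 \<le> complex_gauss_density \<sigma> w"
  by (simp add: complex_gauss_density_def)

lemma space_complex_gauss [simp]: "space (complex_gauss \<sigma>) = UNIV"
  and sets_complex_gauss [simp, measurable_cong]: "sets (complex_gauss \<sigma>) = sets borel"
  by (simp_all add: complex_gauss_def)

text \<open>In this form the density depends on |w| alone; rotation invariance and the tail estimate
  rest on it.\<close>

lemma complex_gauss_density_eq:
  "complex_gauss_density \<sigma> w = 1 / (2 * pi * \<sigma>\<^sup>2) * exp (- (cmod w)\<^sup>2 / (2 * \<sigma>\<^sup>2))"
proof -
  have "complex_gauss_density \<sigma> w =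
    1 / (sqrt (2 * pi * \<sigma>\<^sup>2) * sqrt (2 * pi * \<sigma>\<^sup>2)) * (exp (- (Re w)\<^sup>2 / (2 * \<sigma>\<^sup>2)) * exp (- (Im w)\<^sup>2 / (2 * \<sigma>\<^sup>2)))"
    by (simp add: complex_gauss_density_def normal_density_def)
  also have "sqrt (2 * pi * \<sigma>\<^sup>2) * sqrt (2 * pi * \<sigma>\<^sup>2) = 2 * pi * \<sigma>\<^sup>2"
    by (rule real_sqrt_mult_self[THEN trans]) simp
  also have "exp (- (Re w)\<^sup>2 / (2 * \<sigma>\<^sup>2)) * exp (- (Im w)\<^sup>2 / (2 * \<sigma>\<^sup>2)) = exp (- (cmod w)\<^sup>2 / (2 * \<sigma>\<^sup>2))"
    unfolding exp_add[symmetric] cmod_power2 by (simp add: add_divide_distrib diff_divide_distrib)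
  finally show ?thesis .
qed

lemma prob_space_complex_gauss:
  assumes "\<sigma> > 0"
  shows "prob_space (complex_gauss \<sigma>)"
proof
  have 1: "(\<integral>\<^sup>+x. ennreal (normal_density 0 \<sigma> x) \<partial>lborel) = 1"
    using prob_space.emeasure_space_1[OF prob_space_normal_density[OF assms, of 0]]
    by (simp add: emeasure_density)
  have "emeasure (complex_gauss \<sigma>) (space (complex_gauss \<sigma>)) = (\<integral>\<^sup>+w. ennreal (complex_gauss_density \<sigma> w) \<partial>lborel)"
    by (simp add: complex_gauss_def emeasure_density)
  also have "\<dots> = (\<integral>\<^sup>+x. \<integral>\<^sup>+y. ennreal (normal_density 0 \<sigma> x) * ennreal (normal_density 0 \<sigma> y) \<partial>lborel \<partial>lborel)"
    by (subst nn_integral_complex(1)) (simp_all add: complex_gauss_density_def ennreal_mult)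
  also have "\<dots> = 1" by (simp add: nn_integral_cmult 1)
  finally show "emeasure (complex_gauss \<sigma>) (space (complex_gauss \<sigma>)) = 1" .
qed

lemma distr_complex_gauss_rotation:
  assumes "cmod c = 1"
  shows "distr (complex_gauss \<sigma>) borel ((*) c) = complex_gauss \<sigma>"
proof (rule measure_eqI)
  fix A assume "A \<in> sets (distr (complex_gauss \<sigma>) borel ((*) c))"
  hence A [measurable]: "A \<in> sets borel" by simp
  have [measurable]: "(*) c \<in> borel_measurable borel" by measurable
  have pre: "(*) c -` A \<inter> UNIV \<in> sets borel"
    using measurable_sets[of "(*) c" borel borel A] by simp
  have "emeasure (distr (complex_gauss \<sigma>) borel ((*) c)) A = emeasure (complex_gauss \<sigma>) ((*) c -` A \<inter> UNIV)"
    by (subst emeasure_distr) auto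
  also have "\<dots> = (\<integral>\<^sup>+z. ennreal (complex_gauss_density \<sigma> z) * indicator ((*) c -` A \<inter> UNIV) z \<partial>lborel)"
    unfolding complex_gauss_def using pre by (subst emeasure_density) auto
  also have "\<dots> = (\<integral>\<^sup>+z. ennreal (complex_gauss_density \<sigma> (c * z)) * indicator A (c * z) \<partial>lborel)"
    by (intro nn_integral_cong) (auto simp: complex_gauss_density_eq norm_mult assms indicator_def)
  also have "\<dots> = (\<integral>\<^sup>+z. ennreal (complex_gauss_density \<sigma> z) * indicator A z \<partial>lborel)"
    by (rule nn_integral_rotation[of "\<lambda>z. ennreal (complex_gauss_density \<sigma> z) * indicator A z"])
       (use assms in auto)
  also have "\<dots> = emeasure (complex_gauss \<sigma>) A"
    unfolding complex_gauss_def by (subst emeasure_density) auto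
  finally show "emeasure (distr (complex_gauss \<sigma>) borel ((*) c)) A = emeasure (complex_gauss \<sigma>) A" .
qed simp

text \<open>The factor \<open>exp (- |w|^2 / (4 \<sigma>^2))\<close> is at most \<open>32 (\<sigma> / \<delta>)^4\<close> outside the disc, and the
  remaining one is twice the density with variance \<open>2 \<sigma>^2\<close>.\<close>

lemma complex_gauss_tail:
  assumes \<sigma>: "\<sigma> > 0" and \<delta>: "\<delta> > 0"
  shows "measure (complex_gauss \<sigma>) (- ball 0 \<delta>) \<le> 64 * \<sigma> ^ 4 / \<delta> ^ 4"
proof -
  interpret prob_space "complex_gauss \<sigma>" by (rule prob_space_complex_gauss[OF \<sigma>])
  interpret G2: prob_space "complex_gauss (sqrt 2 * \<sigma>)" by (rule prob_space_complex_gauss) (use \<sigma> in simp)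
  have dens: "complex_gauss_density \<sigma> w \<le> 64 * \<sigma> ^ 4 / \<delta> ^ 4 * complex_gauss_density (sqrt 2 * \<sigma>) w"
    if w: "\<delta> \<le> cmod w" for w
  proof -
    define t where "t = (cmod w)\<^sup>2 / (4 * \<sigma>\<^sup>2)"
    have t: "\<delta>\<^sup>2 / (4 * \<sigma>\<^sup>2) \<le> t" unfolding t_def using w \<sigma> \<delta>
      by (intro divide_right_mono power_mono) auto
    have t0: "0 < \<delta>\<^sup>2 / (4 * \<sigma>\<^sup>2)" using \<sigma> \<delta> by simp
    have "t\<^sup>2 / 2 \<le> exp t" using exp_lower_Taylor_quadratic[of t] t t0 by linarith
    moreover have "(\<delta>\<^sup>2 / (4 * \<sigma>\<^sup>2))\<^sup>2 \<le> t\<^sup>2" using t t0 by (intro power_mono) auto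
    ultimately have "(\<delta>\<^sup>2 / (4 * \<sigma>\<^sup>2))\<^sup>2 / 2 \<le> exp t" by linarith
    hence "inverse (exp t) \<le> inverse ((\<delta>\<^sup>2 / (4 * \<sigma>\<^sup>2))\<^sup>2 / 2)"
      using t0 by (intro le_imp_inverse_le) auto
    also have "\<dots> = 32 * \<sigma> ^ 4 / \<delta> ^ 4"
      using \<sigma> \<delta> by (simp add: field_simps power2_eq_square power4_eq_xxxx)
    finally have et: "exp (- t) \<le> 32 * \<sigma> ^ 4 / \<delta> ^ 4" by (simp add: exp_minus)
    have "complex_gauss_density \<sigma> w = exp (- t) * (2 * complex_gauss_density (sqrt 2 * \<sigma>) w)"
    proof -
      have "exp (- (cmod w)\<^sup>2 / (2 * \<sigma>\<^sup>2)) = exp (- t) * exp (- t)"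
        unfolding exp_add[symmetric] t_def by (simp add: field_simps)
      moreover have "complex_gauss_density (sqrt 2 * \<sigma>) w = 1 / (4 * pi * \<sigma>\<^sup>2) * exp (- t)"
        by (simp add: complex_gauss_density_eq t_def power_mult_distrib)
      ultimately show ?thesis using \<sigma> by (simp add: complex_gauss_density_eq[of \<sigma>])
    qed
    also have "\<dots> \<le> 32 * \<sigma> ^ 4 / \<delta> ^ 4 * (2 * complex_gauss_density (sqrt 2 * \<sigma>) w)"
      by (intro mult_right_mono et) simp
    finally show ?thesis by simp
  qed
  have "emeasure (complex_gauss \<sigma>) (- ball 0 \<delta>)
      = (\<integral>\<^sup>+w. ennreal (complex_gauss_density \<sigma> w) * indicator (- ball 0 \<delta>) w \<partial>lborel)"
    unfolding complex_gauss_def by (subst emeasure_density) auto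
  also have "\<dots> \<le> (\<integral>\<^sup>+w. ennreal (64 * \<sigma> ^ 4 / \<delta> ^ 4) * ennreal (complex_gauss_density (sqrt 2 * \<sigma>) w) \<partial>lborel)"
    using dens \<sigma> \<delta> by (intro nn_integral_mono)
      (auto simp: indicator_def ennreal_mult[symmetric] intro!: ennreal_leI)
  also have "\<dots> = ennreal (64 * \<sigma> ^ 4 / \<delta> ^ 4) * emeasure (complex_gauss (sqrt 2 * \<sigma>)) UNIV"
    unfolding complex_gauss_def by (subst emeasure_density) (auto simp: nn_integral_cmult)
  also have "\<dots> = ennreal (64 * \<sigma> ^ 4 / \<delta> ^ 4)" using G2.emeasure_space_1 by simp
  finally show ?thesis using \<sigma> \<delta> by (simp add: emeasure_eq_measure)
qed

text \<open>The piece beyond 1 is moved back by one period.\<close>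

lemma integral_periodic_shift:
  fixes g :: "real \<Rightarrow> real"
  assumes cont: "continuous_on UNIV g" and per: "\<And>t. g (t + 1) = g t" and \<phi>: "0 \<le> \<phi>" "\<phi> \<le> 1"
  shows "integral {0..1} (\<lambda>t. g (t + \<phi>)) = integral {0..1} g"
proof -
  have int: "g integrable_on {a..b}" for a b
    by (intro integrable_continuous_real continuous_on_subset[OF cont]) auto
  have c: "continuous_on S g" for S by (rule continuous_on_subset[OF cont]) auto
  have "integral {0..1} (\<lambda>t. g (t + \<phi>)) = integral {\<phi>..1 + \<phi>} g"
    using integral_shift[OF c, of 0 1 \<phi>] by (simp add: o_def)
  also have "\<dots> = integral {\<phi>..1} g + integral {1..1 + \<phi>} g"
    using \<phi> by (intro Henstock_Kurzweil_Integration.integral_combine[symmetric] int) auto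
  also have "integral {1..1 + \<phi>} g = integral {0..\<phi>} g"
    using integral_shift[OF c, of 0 \<phi> 1] by (simp add: o_def per add.commute)
  also have "integral {\<phi>..1} g + integral {0..\<phi>} g = integral {0..1} g"
    using \<phi> Henstock_Kurzweil_Integration.integral_combine[OF _ _ int, of 0 \<phi> 1] by simp
  finally show ?thesis .
qed

text \<open>Writing \<open>y\<close> in polar form shifts the phase of \<open>circlepath\<close> by
  the argument of \<open>y\<close>, and integration over a full period absorbs the shift.\<close>

lemma circle_mean_rotate:
  assumes f: "continuous_on (sphere x (cmod y)) f"
  shows "integral {0..1} (\<lambda>\<theta>. f (x + exp (2 * of_real pi * \<i> * of_real \<theta>) * y)) = circle_mean f x (cmod y)"
proof -
  define \<phi> where "\<phi> = Arg2pi y / (2 * pi)"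
  have \<phi>: "0 \<le> \<phi>" "\<phi> \<le> 1" using Arg2pi_ge_0[of y] Arg2pi_lt_2pi[of y] by (auto simp: \<phi>_def field_simps)
  have y: "y = of_real (cmod y) * exp (2 * of_real pi * \<i> * of_real \<phi>)"
    using Arg2pi_eq[of y] by (simp add: \<phi>_def field_simps)
  define g where "g t = f (circlepath x (cmod y) t)" for t
  have "x + exp (2 * of_real pi * \<i> * of_real \<theta>) * y = circlepath x (cmod y) (\<theta> + \<phi>)" for \<theta>
    by (subst y) (simp add: circlepath exp_add ring_distribs)
  hence "integral {0..1} (\<lambda>\<theta>. f (x + exp (2 * of_real pi * \<i> * of_real \<theta>) * y))
    = integral {0..1} (\<lambda>t. g (t + \<phi>))" by (simp add: g_def)
  also have "\<dots> = integral {0..1} g"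
  proof (rule integral_periodic_shift[OF _ _ \<phi>])
    show "continuous_on UNIV g" unfolding g_def by (rule continuous_on_compose_circlepath[OF f]) simp
    show "g (t + 1) = g t" for t by (simp add: g_def circlepath_add1)
  qed
  finally show ?thesis by (simp add: g_def[abs_def] circle_mean_def)
qed

text \<open>By rotation invariance the Gaussian averages circle means inside the disc of radius \<open>\<delta>\<close>; the rest is
  a tail.\<close>

lemma complex_gauss_step:
  assumes \<sigma>: "\<sigma> > 0" and \<delta>: "\<delta> > 0"
    and f [measurable]: "f \<in> borel_measurable borel" and C: "\<And>w. \<bar>f w\<bar> \<le> C"
    and cont: "continuous_on (ball x \<delta>) f"
    and mean: "\<And>r. 0 < r \<Longrightarrow> r < \<delta> \<Longrightarrow> circle_mean f x r \<le> f x"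
  shows "(\<integral>y. f (x + y) - f x \<partial>complex_gauss \<sigma>) \<le> 2 * C * (64 * \<sigma> ^ 4 / \<delta> ^ 4)"
proof -
  interpret G: prob_space "complex_gauss \<sigma>" by (rule prob_space_complex_gauss[OF \<sigma>])
  \<comment> \<open>The uniform law of a rotation angle. As a probability measure it can be paired
    with the Gaussian for Fubini's theorem.\<close>
  define U :: "real measure" where "U = density lborel (\<lambda>t. ennreal (indicator {0..1} t))"
  have U_sets [simp, measurable_cong]: "sets U = sets borel" by (simp add: U_def)
  have U_eq: "(\<integral>t. g t \<partial>U) = integral {0..1} g" if "continuous_on {0..1} g" "g \<in> borel_measurable borel"
    for g :: "real \<Rightarrow> real"
  proof -
    have si: "set_integrable lborel {0..1} g"
      by (rule borel_integrable_atLeastAtMost') (rule that)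
    have "(\<integral>t. g t \<partial>U) = (\<integral>t. indicator {0..1} t *\<^sub>R g t \<partial>lborel)"
      unfolding U_def using that(2) by (subst integral_density) auto
    thus ?thesis using set_borel_integral_eq_integral(2)[OF si] by (simp add: set_lebesgue_integral_def)
  qed
  interpret U: prob_space U
  proof
    have "emeasure U (space U) = (\<integral>\<^sup>+t. indicator {0..1::real} t \<partial>lborel)"
      unfolding U_def by (subst emeasure_density) (auto simp: ennreal_indicator simp del: nn_integral_indicator)
    also have "\<dots> = 1" by (subst nn_integral_indicator) auto
    finally show "emeasure U (space U) = 1" .
  qed
  interpret GU: pair_prob_space "complex_gauss \<sigma>" U ..
  have C0: "0 \<le> C" using C[of 0] by linarith
  define q where "q y = indicator (ball 0 \<delta>) y * (f (x + y) - f x)" for y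
  have fx [measurable]: "(\<lambda>y. f (x + y)) \<in> borel_measurable borel"
    by (rule measurable_compose[OF _ f]) simp
  have q [measurable]: "q \<in> borel_measurable borel"
    unfolding q_def[abs_def] by (intro borel_measurable_times borel_measurable_indicator borel_measurable_diff fx) auto
  have qb: "\<bar>q y\<bar> \<le> 2 * C" for y
    using C[of "x + y"] C[of x] by (auto simp: q_def indicator_def)
  define e where "e \<theta> = exp (2 * of_real pi * \<i> * complex_of_real \<theta>)" for \<theta>
  have [measurable]: "e \<in> borel_measurable borel"
    unfolding e_def by (intro borel_measurable_continuous_onI continuous_intros)
  have e1: "cmod (e \<theta>) = 1" for \<theta> by (simp add: e_def)
  have rot: "(\<integral>y. q (e \<theta> * y) \<partial>complex_gauss \<sigma>) = (\<integral>y. q y \<partial>complex_gauss \<sigma>)" for \<theta>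
    by (subst (2) distr_complex_gauss_rotation[OF e1, symmetric], subst integral_distr) simp_all
  have int: "integrable (complex_gauss \<sigma> \<Otimes>\<^sub>M U) (\<lambda>(y, \<theta>). q (e \<theta> * y))"
    by (rule GU.integrable_const_bound[where B = "2 * C"]) (use qb in auto)
  \<comment> \<open>For 0 < |y| < \<delta> this is the circle mean of radius |y| minus the central
    value; for all other \<open>y\<close> the integrand vanishes.\<close>
  have inner: "(\<integral>\<theta>. q (e \<theta> * y) \<partial>U) \<le> 0" for y
  proof (cases "0 < cmod y \<and> cmod y < \<delta>")
    case True
    have sub: "sphere x (cmod y) \<subseteq> ball x \<delta>" using True by auto
    have cs: "continuous_on (sphere x (cmod y)) f" by (rule continuous_on_subset[OF cont sub])
    have qe: "q (e \<theta> * y) = f (x + exp (2 * of_real pi * \<i> * of_real \<theta>) * y) - f x" for \<theta>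
      using True by (simp add: q_def norm_mult e1 e_def)
    have ci: "continuous_on {0..1} (\<lambda>\<theta>. f (x + exp (2 * of_real pi * \<i> * of_real \<theta>) * y))"
      by (intro continuous_on_compose2[OF cs] continuous_intros) (auto simp: dist_norm norm_mult)
    have "(\<integral>\<theta>. q (e \<theta> * y) \<partial>U) = integral {0..1} (\<lambda>\<theta>. q (e \<theta> * y))"
    proof (rule U_eq)
      show "continuous_on {0..1} (\<lambda>\<theta>. q (e \<theta> * y))" unfolding qe by (intro continuous_intros ci)
    qed measurable
    also have "\<dots> = integral {0..1} (\<lambda>\<theta>. f (x + exp (2 * of_real pi * \<i> * of_real \<theta>) * y)) - f x"
      unfolding qe by (subst integral_diff) (auto intro: integrable_continuous_real ci)
    also have "\<dots> \<le> 0" using mean[of "cmod y"] True by (simp add: circle_mean_rotate[OF cs])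
    finally show ?thesis .
  next
    case False
    hence "q (e \<theta> * y) = 0" for \<theta> by (auto simp: q_def norm_mult e1)
    thus ?thesis by simp
  qed
  have "(\<integral>y. q y \<partial>complex_gauss \<sigma>) = (\<integral>\<theta>. (\<integral>y. q (e \<theta> * y) \<partial>complex_gauss \<sigma>) \<partial>U)"
    by (simp add: rot U.prob_space)
  also have "\<dots> = (\<integral>y. (\<integral>\<theta>. q (e \<theta> * y) \<partial>U) \<partial>complex_gauss \<sigma>)"
    by (rule GU.Fubini_integral) (rule int)
  also have "\<dots> \<le> 0"
  proof -
    have "0 \<le> (\<integral>y. - (\<integral>\<theta>. q (e \<theta> * y) \<partial>U) \<partial>complex_gauss \<sigma>)"
      by (rule integral_nonneg_AE) (use inner in auto)
    thus ?thesis by simp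
  qed
  finally have q0: "(\<integral>y. q y \<partial>complex_gauss \<sigma>) \<le> 0" .
  have "(\<integral>y. f (x + y) - f x \<partial>complex_gauss \<sigma>) \<le> (\<integral>y. q y + 2 * C * indicator (- ball 0 \<delta>) y \<partial>complex_gauss \<sigma>)"
  proof (rule integral_mono)
    show "integrable (complex_gauss \<sigma>) (\<lambda>y. f (x + y) - f x)"
      by (rule G.integrable_const_bound[where B = "2 * C"])
         (use C[of x] C in \<open>auto intro!: AE_I2 abs_leI simp: abs_le_iff add_mono\<close>,
          (smt (verit))+)
    have "\<bar>q y + 2 * C * indicator (- ball 0 \<delta>) y\<bar> \<le> 4 * C" for y
      using qb[of y] C0 by (auto simp: indicator_def)
    thus "integrable (complex_gauss \<sigma>) (\<lambda>y. q y + 2 * C * indicator (- ball 0 \<delta>) y)"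
      by (intro G.integrable_const_bound[where B = "4 * C"]) auto
    show "f (x + y) - f x \<le> q y + 2 * C * indicator (- ball 0 \<delta>) y" for y
      using C[of "x + y"] C[of x] by (auto simp: q_def indicator_def)
  qed
  also have "\<dots> = (\<integral>y. q y \<partial>complex_gauss \<sigma>) + 2 * C * measure (complex_gauss \<sigma>) (- ball 0 \<delta>)"
  proof (subst Bochner_Integration.integral_add)
    show "integrable (complex_gauss \<sigma>) q"
      by (rule G.integrable_const_bound[where B = "2 * C"]) (use qb in auto)
    show "integrable (complex_gauss \<sigma>) (\<lambda>y. 2 * C * indicator (- ball 0 \<delta>) y)"
      by (rule G.integrable_const_bound[where B = "2 * C"]) (auto simp: indicator_def C0)
  qed simp
  also have "\<dots> \<le> 0 + 2 * C * (64 * \<sigma> ^ 4 / \<delta> ^ 4)"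
    using C0 complex_gauss_tail[OF \<sigma> \<delta>] by (intro add_mono q0 mult_left_mono) auto
  finally show ?thesis by simp
qed

section \<open>Brownian motion\<close>

lemma planar_brownian_motionD:
  assumes "planar_brownian_motion z M B"
  shows "prob_space M" "\<And>t. 0 \<le> t \<Longrightarrow> B t \<in> borel_measurable M"
    "\<And>\<omega>. \<omega> \<in> space M \<Longrightarrow> B 0 \<omega> = z"
    "\<And>\<omega>. \<omega> \<in> space M \<Longrightarrow> continuous_on {0..} (\<lambda>t. B t \<omega>)"
  using assms unfolding planar_brownian_motion_def by blast+

lemma distr_brownian_increment:
  assumes "planar_brownian_motion z M B" "0 \<le> s" "s < t"
  shows "distr M borel (\<lambda>\<omega>. B t \<omega> - B s \<omega>) = complex_gauss (sqrt (t - s))"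
proof -
  have "distributed M lborel (\<lambda>\<omega>. B t \<omega> - B s \<omega>)
          (\<lambda>w. ennreal (normal_density 0 (sqrt (t - s)) (Re w) *
                        normal_density 0 (sqrt (t - s)) (Im w)))"
    using assms unfolding planar_brownian_motion_def by blast
  from distributed_distr_eq_density[OF this]
  have "distr M lborel (\<lambda>\<omega>. B t \<omega> - B s \<omega>) = complex_gauss (sqrt (t - s))"
    by (simp add: complex_gauss_def complex_gauss_density_def)
  moreover have "distr M lborel (\<lambda>\<omega>. B t \<omega> - B s \<omega>) = distr M borel (\<lambda>\<omega>. B t \<omega> - B s \<omega>)"
    by (rule distr_cong) simp_all
  ultimately show ?thesis by simp
qed

text \<open>The indicator depends on the first n increments alone, and the next increment is
  independent of them. By Fubini the past can be frozen, and then \<open>step\<close> applies at the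
  current position, a point of \<open>F\<close>.\<close>

lemma brownian_grid_step:
  fixes f :: "complex \<Rightarrow> real"
  assumes bm: "planar_brownian_motion z M B"
    and h: "h > 0" and s: "s > 0" and F [measurable]: "F \<in> sets borel"
    and f [measurable]: "f \<in> borel_measurable borel" and C: "\<And>w. \<bar>f w\<bar> \<le> C"
    and step: "\<And>x. x \<in> F \<Longrightarrow> (\<integral>y. f (x + y) - f x \<partial>complex_gauss (sqrt s)) \<le> K" and K: "0 \<le> K"
  shows "(\<integral>\<omega>. indicator {\<omega>. \<forall>j\<le>n. B (real j * h) \<omega> \<in> F} \<omega>
            * (f (B (real n * h + s) \<omega>) - f (B (real n * h) \<omega>)) \<partial>M) \<le> K"
proof -
  note bmD = planar_brownian_motionD[OF bm]
  interpret prob_space M by (rule bmD(1))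
  \<comment> \<open>Independence is given along increasing sequences of times indexed by all
    naturals. Here n steps of length h reach the present, and the increment with index n is the one
    of length s.\<close>
  define t where "t i = (if i \<le> n then real i * h else real n * h + real (i - n) * s)" for i
  have t: "strict_mono t" "0 \<le> t 0"
  proof (rule strict_monoI_Suc)
    show "t i < t (Suc i)" for i
    proof -
      consider "Suc i \<le> n" | "i = n" | "n < i" by linarith
      thus ?thesis using h s
        by cases (auto simp: t_def algebra_simps Suc_diff_le)
    qed
  qed (use h in \<open>simp add: t_def\<close>)
  define X where "X i \<omega> = B (t (Suc i)) \<omega> - B (t i) \<omega>" for i \<omega>
  have ind: "indep_vars (\<lambda>_. borel) X {..<Suc n}"
    using bm t unfolding planar_brownian_motion_def X_def by blast
  define PM where "PM = PiM {..<n} (\<lambda>_. borel :: complex measure)"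
  define Y where "Y \<omega> = restrict (\<lambda>i. X i \<omega>) {..<n}" for \<omega>
  define PN where "PN = PiM {n} (\<lambda>_. borel :: complex measure)"
  define Z where "Z \<omega> = restrict (\<lambda>i. X i \<omega>) {n}" for \<omega>
  have "indep_var PM Y PN Z"
    unfolding Y_def PM_def Z_def PN_def by (rule indep_var_restrict[OF ind]) auto
  hence Ym [measurable]: "Y \<in> M \<rightarrow>\<^sub>M PM" and Zm [measurable]: "Z \<in> M \<rightarrow>\<^sub>M PN"
    and joint: "distr M PM Y \<Otimes>\<^sub>M distr M PN Z = distr M (PM \<Otimes>\<^sub>M PN) (\<lambda>\<omega>. (Y \<omega>, Z \<omega>))"
    unfolding indep_var_distribution_eq by auto
  have coord [measurable]: "(\<lambda>u. u n) \<in> borel_measurable PN"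
    unfolding PN_def by (rule measurable_component_singleton) simp
  have Zn: "Z \<omega> n = X n \<omega>" for \<omega> by (simp add: Z_def)
  have Xm [measurable]: "X n \<in> borel_measurable M"
    using measurable_compose[OF Zm coord] by (simp add: Zn)
  have "X n = (\<lambda>\<omega>. B (real n * h + s) \<omega> - B (real n * h) \<omega>)"
    by (simp add: X_def t_def fun_eq_iff)
  hence Xn: "distr M borel (X n) = complex_gauss (sqrt s)"
    using distr_brownian_increment[OF bm, of "real n * h" "real n * h + s"] h s by simp
  define pos where "pos u j = z + (\<Sum>i<j. u i)" for u :: "nat \<Rightarrow> complex" and j
  have pos_m: "(\<lambda>u. pos u j) \<in> borel_measurable PM" if "j \<le> n" for j
    unfolding pos_def PM_def using that
    by (intro borel_measurable_add borel_measurable_const borel_measurable_sum measurable_component_singleton) auto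
  have posB: "pos (Y \<omega>) j = B (real j * h) \<omega>" if "\<omega> \<in> space M" "j \<le> n" for \<omega> j
  proof -
    have "(\<Sum>i<j. Y \<omega> i) = (\<Sum>i<j. B (t (Suc i)) \<omega> - B (t i) \<omega>)"
      using that by (intro sum.cong) (auto simp: Y_def X_def)
    also have "\<dots> = B (t j) \<omega> - B (t 0) \<omega>" by (rule sum_lessThan_telescope)
    finally show ?thesis using that bmD(3)[OF that(1)] by (simp add: pos_def t_def)
  qed
  define g where "g p = (if \<forall>j\<in>{..n}. pos (fst p) j \<in> F then f (pos (fst p) n + snd p) - f (pos (fst p) n) else 0)" for p
  have gm [measurable]: "g \<in> borel_measurable (PM \<Otimes>\<^sub>M borel)"
  proof -
    have [measurable]: "(\<lambda>p. pos (fst p) j) \<in> borel_measurable (PM \<Otimes>\<^sub>M borel)" if "j \<in> {..n}" for j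
      using measurable_compose[OF measurable_fst pos_m] that by simp
    have [measurable]: "(\<lambda>p. pos (fst p) n) \<in> borel_measurable (PM \<Otimes>\<^sub>M borel)"
      using measurable_compose[OF measurable_fst pos_m] by simp
    have [measurable]: "Measurable.pred (PM \<Otimes>\<^sub>M borel) (\<lambda>p. \<forall>j\<in>{..n}. pos (fst p) j \<in> F)"
      by measurable
    show ?thesis unfolding g_def[abs_def] by measurable
  qed
  have gb: "\<bar>g p\<bar> \<le> 2 * C" for p
  proof -
    have "0 \<le> C" using C[of 0] by linarith
    thus ?thesis using C[of "pos (fst p) n + snd p"] C[of "pos (fst p) n"] by (auto simp: g_def)
  qed
  define G where "G p = g (fst p, snd p n)" for p
  have Gm [measurable]: "G \<in> borel_measurable (PM \<Otimes>\<^sub>M PN)" unfolding G_def[abs_def] by measurable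
  interpret D1: prob_space "distr M PM Y" by (rule prob_space_distr[OF Ym])
  interpret D2: prob_space "distr M PN Z" by (rule prob_space_distr[OF Zm])
  interpret D: pair_prob_space "distr M PM Y" "distr M PN Z" ..
  have int: "integrable (distr M PM Y \<Otimes>\<^sub>M distr M PN Z) G"
    by (rule D.integrable_const_bound[where B = "2 * C"]) (use gb in \<open>auto simp: G_def\<close>)
  have "(\<integral>\<omega>. indicator {\<omega>. \<forall>j\<le>n. B (real j * h) \<omega> \<in> F} \<omega>
            * (f (B (real n * h + s) \<omega>) - f (B (real n * h) \<omega>)) \<partial>M) = (\<integral>\<omega>. G (Y \<omega>, Z \<omega>) \<partial>M)"
  proof (rule Bochner_Integration.integral_cong[OF refl])
    fix \<omega> assume \<omega>: "\<omega> \<in> space M"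
    have "pos (Y \<omega>) n + X n \<omega> = B (real n * h + s) \<omega>"
      using posB[OF \<omega>, of n] by (simp add: X_def t_def)
    thus "indicator {\<omega>. \<forall>j\<le>n. B (real j * h) \<omega> \<in> F} \<omega>
            * (f (B (real n * h + s) \<omega>) - f (B (real n * h) \<omega>)) = G (Y \<omega>, Z \<omega>)"
      using posB[OF \<omega>] by (auto simp: G_def Zn g_def indicator_def)
  qed
  also have "\<dots> = (\<integral>p. G p \<partial>(distr M PM Y \<Otimes>\<^sub>M distr M PN Z))"
    unfolding joint by (subst integral_distr) auto
  also have "\<dots> = (\<integral>u. (\<integral>x. G (u, x) \<partial>distr M PN Z) \<partial>distr M PM Y)"
    by (rule D.integral_fst'[OF int, symmetric])
  also have "\<dots> \<le> K"
  proof (rule D1.integral_le_const)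
    show "integrable (distr M PM Y) (\<lambda>u. \<integral>x. G (u, x) \<partial>distr M PN Z)"
      by (rule D.integrable_fst'[OF int])
    have "(\<integral>x. G (u, x) \<partial>distr M PN Z) \<le> K" if u: "u \<in> space PM" for u
    proof (cases "\<forall>j\<in>{..n}. pos u j \<in> F")
      case True
      hence G: "G (u, x) = f (pos u n + x n) - f (pos u n)" for x by (simp add: G_def g_def)
      have "(\<integral>x. G (u, x) \<partial>distr M PN Z) = (\<integral>\<omega>. f (pos u n + X n \<omega>) - f (pos u n) \<partial>M)"
        unfolding G by (subst integral_distr) (simp_all add: Zn)
      also have "\<dots> = (\<integral>y. f (pos u n + y) - f (pos u n) \<partial>complex_gauss (sqrt s))"
        unfolding Xn[symmetric] by (subst integral_distr) simp_all
      finally show ?thesis using step[of "pos u n"] True by simp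
    next
      \<comment> \<open>A past that has left \<open>F\<close> contributes 0, and this has to be at
        most \<open>K\<close> as well.\<close>
      case False
      hence "G (u, x) = 0" for x unfolding G_def g_def fst_conv by (simp only: if_False)
      thus ?thesis using K by simp
    qed
    thus "AE u in distr M PM Y. (\<integral>x. G (u, x) \<partial>distr M PN Z) \<le> K" by (intro AE_I2) simp
  qed
  finally show ?thesis .
qed

text \<open>If the path is outside the closed set \<open>F\<close> at time r, it is so at all times
  close to r, and the grid point just before r is such a time once the mesh is small.\<close>

lemma grid_indicator_tendsto:
  assumes cont: "continuous_on {0..} b" and F: "closed F" and T: "0 < T"
  shows "(\<lambda>j. indicator {b. \<forall>i\<le>Suc j. b (real i * (T / real (Suc j))) \<in> F} b :: real)
            \<longlonglongrightarrow> indicator {b. \<forall>r\<in>{0..T}. b r \<in> F} (b :: real \<Rightarrow> complex)"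
proof (cases "\<forall>r\<in>{0..T}. b r \<in> F")
  case True
  have "b (real i * (T / real (Suc j))) \<in> F" if "i \<le> Suc j" for i j
  proof -
    have "real i * (T / real (Suc j)) = T * (real i / real (Suc j))" by simp
    also have "\<dots> \<le> T * 1" using that T by (intro mult_left_mono) auto
    finally show ?thesis using True T by auto
  qed
  thus ?thesis using True by (simp add: indicator_def)
next
  case False
  then obtain r where r: "0 \<le> r" "r \<le> T" "b r \<notin> F" by auto
  have "open (- F)" "b r \<in> - F" using F r by auto
  then obtain e where e: "e > 0" "ball (b r) e \<subseteq> - F" using open_contains_ball by blast
  obtain d where d: "d > 0" "\<And>x. 0 \<le> x \<Longrightarrow> dist x r < d \<Longrightarrow> dist (b x) (b r) < e"
    using cont r(1) e(1) unfolding continuous_on_iff by force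
  have "(\<lambda>j. T / real (Suc j)) \<longlonglongrightarrow> 0" by (rule lim_const_over_n[THEN LIMSEQ_Suc])
  hence ev: "\<forall>\<^sub>F j in sequentially. T / real (Suc j) < d" using d(1) by (intro order_tendstoD(2))
  have "\<forall>\<^sub>F j in sequentially. indicator {b. \<forall>i\<le>Suc j. b (real i * (T / real (Suc j))) \<in> F} b = (0::real)"
    using ev
  proof eventually_elim
    case (elim j)
    define h where "h = T / real (Suc j)"
    have h: "h > 0" "h < d" "real (Suc j) * h = T" using T elim by (simp_all add: h_def)
    define i where "i = nat \<lfloor>r / h\<rfloor>"
    have i: "real i \<le> r / h" "r / h < real i + 1" using r h by (auto simp: i_def)
    hence i': "real i * h \<le> r" "r < real i * h + h" using h(1) by (simp_all add: field_simps)
    have "real i * h \<le> real (Suc j) * h" using i' r h by linarith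
    hence "i \<le> Suc j" using h(1) by simp
    moreover have "dist (real i * h) r < d" using i' h by (simp add: dist_real_def)
    hence "dist (b (real i * h)) (b r) < e" using h(1) by (intro d(2)) auto
    hence "b (real i * h) \<in> ball (b r) e" by (simp add: dist_commute)
    hence "b (real i * h) \<notin> F" using e(2) by blast
    ultimately show ?case unfolding h_def[symmetric] by (auto simp: indicator_def)
  qed
  hence "(\<lambda>j. indicator {b. \<forall>i\<le>Suc j. b (real i * (T / real (Suc j))) \<in> F} b :: real) \<longlonglongrightarrow> 0"
    by (rule tendsto_eventually)
  moreover have "indicator {b. \<forall>r\<in>{0..T}. b r \<in> F} b = (0 :: real)"
    using False by (simp only: indicator_def mem_Collect_eq if_False of_bool_eq)
  ultimately show ?thesis by (simp only:)
qed

text \<open>Dominated convergence along refining grids. The same limit yields measurability of an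
  event that quantifies over uncountably many times.\<close>

lemma brownian_step:
  fixes f :: "complex \<Rightarrow> real"
  assumes bm: "planar_brownian_motion z M B"
    and T: "T \<ge> 0" and s: "s > 0" and F: "closed F"
    and f [measurable]: "f \<in> borel_measurable borel" and C: "\<And>w. \<bar>f w\<bar> \<le> C"
    and step: "\<And>x. x \<in> F \<Longrightarrow> (\<integral>y. f (x + y) - f x \<partial>complex_gauss (sqrt s)) \<le> K" and K: "0 \<le> K"
  shows "(indicator {\<omega>. \<forall>r\<in>{0..T}. B r \<omega> \<in> F} :: _ \<Rightarrow> real) \<in> borel_measurable M" (is "?I \<in> _")
    and "(\<integral>\<omega>. indicator {\<omega>. \<forall>r\<in>{0..T}. B r \<omega> \<in> F} \<omega> * (f (B (T + s) \<omega>) - f (B T \<omega>)) \<partial>M) \<le> K"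
proof -
  note bmD = planar_brownian_motionD[OF bm]
  interpret prob_space M by (rule bmD(1))
  have Fb [measurable]: "F \<in> sets borel" using F by simp
  have "?I \<in> borel_measurable M \<and>
    (\<integral>\<omega>. indicator {\<omega>. \<forall>r\<in>{0..T}. B r \<omega> \<in> F} \<omega> * (f (B (T + s) \<omega>) - f (B T \<omega>)) \<partial>M) \<le> K"
  proof (cases "T = 0")
    \<comment> \<open>At T = 0 there is no grid to refine; this is the grid lemma with n = 0, where
      the mesh 1 is arbitrary.\<close>
    case True
    have [measurable]: "B 0 \<in> borel_measurable M" by (rule bmD(2)) simp
    have eq: "{\<omega>. \<forall>r\<in>{0..T}. B r \<omega> \<in> F} = {\<omega>. B 0 \<omega> \<in> F}" using True by auto
    have "(\<lambda>\<omega>. indicator F (B 0 \<omega>) :: real) \<in> borel_measurable M" by measurable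
    hence "?I \<in> borel_measurable M" unfolding eq by (simp add: indicator_def)
    thus ?thesis
      using brownian_grid_step[OF bm zero_less_one s Fb f C step K, of 0] True by simp
  next
    case False
    hence T0: "0 < T" using T by simp
    define A where "A j = {\<omega>. \<forall>i\<le>Suc j. B (real i * (T / real (Suc j))) \<omega> \<in> F}" for j
    have lim: "(\<lambda>j. indicator (A j) \<omega> :: real) \<longlonglongrightarrow> indicator {\<omega>. \<forall>r\<in>{0..T}. B r \<omega> \<in> F} \<omega>"
      if "\<omega> \<in> space M" for \<omega>
      using grid_indicator_tendsto[OF bmD(4)[OF that] F T0] by (simp add: A_def indicator_def)
    have Am [measurable]: "(\<lambda>\<omega>. indicator (A j) \<omega> :: real) \<in> borel_measurable M" for j
    proof -
      have [measurable]: "B (real i * (T / real (Suc j))) \<in> borel_measurable M" for i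
        using T by (intro bmD(2)) auto
      have "Measurable.pred M (\<lambda>\<omega>. \<forall>i\<in>{..Suc j}. B (real i * (T / real (Suc j))) \<omega> \<in> F)" by measurable
      hence "(\<lambda>\<omega>. if \<forall>i\<in>{..Suc j}. B (real i * (T / real (Suc j))) \<omega> \<in> F then 1 else 0 :: real) \<in> borel_measurable M"
        by measurable
      thus ?thesis by (simp only: A_def indicator_def mem_Collect_eq of_bool_def atMost_iff Ball_def)
    qed
    have Im: "?I \<in> borel_measurable M"
      by (rule borel_measurable_LIMSEQ_real[OF lim Am])
    define D where "D \<omega> = f (B (T + s) \<omega>) - f (B T \<omega>)" for \<omega>
    have Dm [measurable]: "D \<in> borel_measurable M"
    proof -
      have [measurable]: "B (T + s) \<in> borel_measurable M" "B T \<in> borel_measurable M"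
        using T s by (auto intro: bmD(2))
      show ?thesis unfolding D_def[abs_def] by measurable
    qed
    have Db: "\<bar>D \<omega>\<bar> \<le> 2 * C" for \<omega>
      using C[of "B (T + s) \<omega>"] C[of "B T \<omega>"] by (simp add: D_def)
    have C0: "0 \<le> C" using C[of 0] by linarith
    have "(\<lambda>j. \<integral>\<omega>. indicator (A j) \<omega> * D \<omega> \<partial>M)
        \<longlonglongrightarrow> (\<integral>\<omega>. indicator {\<omega>. \<forall>r\<in>{0..T}. B r \<omega> \<in> F} \<omega> * D \<omega> \<partial>M)"
    proof (rule integral_dominated_convergence[where w = "\<lambda>_. 2 * C"])
      show "(\<lambda>\<omega>. indicator {\<omega>. \<forall>r\<in>{0..T}. B r \<omega> \<in> F} \<omega> * D \<omega>) \<in> borel_measurable M"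
        using Im by measurable
      show "AE \<omega> in M. (\<lambda>j. indicator (A j) \<omega> * D \<omega>) \<longlonglongrightarrow> indicator {\<omega>. \<forall>r\<in>{0..T}. B r \<omega> \<in> F} \<omega> * D \<omega>"
        by (rule AE_I2) (intro tendsto_intros lim)
      show "AE \<omega> in M. norm (indicator (A j) \<omega> * D \<omega>) \<le> 2 * C" for j
        using Db C0 by (auto simp: indicator_def)
    qed auto
    moreover have "(\<integral>\<omega>. indicator (A j) \<omega> * D \<omega> \<partial>M) \<le> K" for j
    proof -
      have h: "0 < T / real (Suc j)" and e: "real (Suc j) * (T / real (Suc j)) = T" using T0 by simp_all
      from brownian_grid_step[OF bm h s Fb f C step K, of "Suc j"]
      show ?thesis unfolding e A_def D_def by simp
    qed
    ultimately have "(\<integral>\<omega>. indicator {\<omega>. \<forall>r\<in>{0..T}. B r \<omega> \<in> F} \<omega> * D \<omega> \<partial>M) \<le> K"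
      by (intro LIMSEQ_le_const2) auto
    thus ?thesis using Im by (simp add: D_def)
  qed
  thus "?I \<in> borel_measurable M"
    "(\<integral>\<omega>. indicator {\<omega>. \<forall>r\<in>{0..T}. B r \<omega> \<in> F} \<omega> * (f (B (T + s) \<omega>) - f (B T \<omega>)) \<partial>M) \<le> K"
    by auto
qed

section \<open>Exit times and their discretisation\<close>

lemma downward_closed_eq_lessThan:
  assumes "finite S" "\<And>j k. k \<in> S \<Longrightarrow> j < k \<Longrightarrow> j \<in> S"
  shows "S = {..<card S :: nat}"
proof -
  obtain n where n: "n \<notin> S" using assms(1) infinite_UNIV_nat by (metis UNIV_eq_I)
  define m where "m = (LEAST n. n \<notin> S)"
  have m: "m \<notin> S" unfolding m_def by (rule LeastI[of _ n]) (rule n)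
  have "j \<in> S" if "j < m" for j using not_less_Least[of j "\<lambda>n. n \<notin> S"] that by (simp add: m_def)
  moreover have "j < m" if "j \<in> S" for j using m assms(2)[OF that] that by (metis linorder_neqE_nat)
  ultimately have "S = {..<m}" by auto
  thus ?thesis by simp
qed

text \<open>As \<open>A\<close> can only turn from true to false, the surviving increments form an
  initial segment and telescope.\<close>

lemma stopped_telescope:
  fixes \<phi> :: "nat \<Rightarrow> 'a :: ab_group_add"
  assumes A: "\<And>j k. A k \<Longrightarrow> j < k \<Longrightarrow> A j"
  shows "\<phi> 0 + (\<Sum>k<m. if A k then \<phi> (Suc k) - \<phi> k else 0) = \<phi> (card {k. k < m \<and> A k})"
proof (induction m)
  case (Suc m)
  show ?case
  proof (cases "A m")
    case True
    hence "{k. k < m \<and> A k} = {..<m}" "{k. k < Suc m \<and> A k} = {..<Suc m}"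
      using A[OF True] by (auto simp: less_Suc_eq)
    thus ?thesis using Suc True by (simp add: algebra_simps)
  next
    case False
    hence "{k. k < Suc m \<and> A k} = {k. k < m \<and> A k}" by (auto simp: less_Suc_eq)
    thus ?thesis using Suc False by simp
  qed
qed simp

text \<open>The minimum of \<open>T\<close> and the first exit time from \<open>G\<close>.\<close>

definition exit_time_before :: "complex set \<Rightarrow> real \<Rightarrow> (real \<Rightarrow> complex) \<Rightarrow> real" where
  "exit_time_before G T b = (if \<exists>t\<in>{0..T}. b t \<notin> G then Inf {t. 0 \<le> t \<and> b t \<notin> G} else T)"

text \<open>For a continuous path the times spent outside the open set form a closed set, so the
  infimum is attained.\<close>

lemma first_exit:
  fixes b :: "real \<Rightarrow> complex"
  assumes cont: "continuous_on {0..} b" and G: "open G" and ex: "0 \<le> t" "b t \<notin> G"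
  defines "\<tau> \<equiv> Inf {t. 0 \<le> t \<and> b t \<notin> G}"
  shows "0 \<le> \<tau>" "\<tau> \<le> t" "b \<tau> \<notin> G" "\<And>s. 0 \<le> s \<Longrightarrow> s < \<tau> \<Longrightarrow> b s \<in> G"
proof -
  let ?S = "{t. 0 \<le> t \<and> b t \<notin> G}"
  have bdd: "bdd_below ?S" by (rule bdd_belowI[of _ 0]) auto
  have "?S = {0..} \<inter> b -` (- G)" by auto
  moreover have "closed ({0..} \<inter> b -` (- G))"
    using G by (intro continuous_closed_preimage cont) auto
  ultimately have "closed ?S" by simp
  hence "\<tau> \<in> ?S" unfolding \<tau>_def using ex bdd by (intro closed_contains_Inf) auto
  thus "0 \<le> \<tau>" "b \<tau> \<notin> G" by auto
  show "\<tau> \<le> t" unfolding \<tau>_def using ex bdd by (intro cInf_lower) auto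
  show "b s \<in> G" if "0 \<le> s" "s < \<tau>" for s
  proof (rule ccontr)
    assume "b s \<notin> G"
    hence "\<tau> \<le> s" unfolding \<tau>_def using that bdd by (intro cInf_lower) auto
    thus False using that by simp
  qed
qed

lemma exit_time_before_bounds:
  fixes b :: "real \<Rightarrow> complex"
  assumes cont: "continuous_on {0..} b" and G: "open G" and T: "0 \<le> T"
  shows "0 \<le> exit_time_before G T b" "exit_time_before G T b \<le> T"
    "\<And>s. 0 \<le> s \<Longrightarrow> s < exit_time_before G T b \<Longrightarrow> b s \<in> G"
    "b (exit_time_before G T b) \<notin> G \<or> exit_time_before G T b = T"
proof -
  have "0 \<le> exit_time_before G T b \<and> exit_time_before G T b \<le> T \<and>
    (\<forall>s. 0 \<le> s \<longrightarrow> s < exit_time_before G T b \<longrightarrow> b s \<in> G) \<and>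
    (b (exit_time_before G T b) \<notin> G \<or> exit_time_before G T b = T)"
  proof (cases "\<exists>t\<in>{0..T}. b t \<notin> G")
    case True
    then obtain t where t: "0 \<le> t" "t \<le> T" "b t \<notin> G" by auto
    have e: "exit_time_before G T b = Inf {t. 0 \<le> t \<and> b t \<notin> G}" using True by (simp add: exit_time_before_def)
    show ?thesis unfolding e using first_exit[OF cont G t(1,3)] t(2) by auto
  next
    case False
    hence e: "exit_time_before G T b = T" by (simp only: exit_time_before_def if_False)
    show ?thesis unfolding e using False T by auto
  qed
  thus "0 \<le> exit_time_before G T b" "exit_time_before G T b \<le> T"
    "\<And>s. 0 \<le> s \<Longrightarrow> s < exit_time_before G T b \<Longrightarrow> b s \<in> G"
    "b (exit_time_before G T b) \<notin> G \<or> exit_time_before G T b = T" by auto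
qed

text \<open>Closed subsets of \<open>G\<close> whose points carry discs of one common radius in
  \<open>G\<close>: the Gaussian step estimate becomes uniform on them, and closedness is what
  \<open>brownian_step\<close> asks for.\<close>

definition deep_part :: "complex set \<Rightarrow> nat \<Rightarrow> complex set" where
  "deep_part G n = {x. 1 / real (Suc n) \<le> infdist x (- G)}"

lemma closed_deep_part: "closed (deep_part G n)"
  unfolding deep_part_def by (intro closed_Collect_le continuous_intros)

lemma deep_part_ball:
  assumes "x \<in> deep_part G n"
  shows "ball x (1 / real (Suc n)) \<subseteq> G"
proof
  fix y assume y: "y \<in> ball x (1 / real (Suc n))"
  show "y \<in> G"
  proof (rule ccontr)
    assume "y \<notin> G"
    hence "infdist x (- G) \<le> dist x y" by (intro infdist_le) simp
    thus False using assms y by (simp add: deep_part_def)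
  qed
qed

text \<open>A stopping index on the grid of mesh 1/N: whether step k is taken is decided by the path
  up to time k/N. Since the path is watched throughout that interval, the steps taken form an
  initial segment and their number is the stopping index.\<close>

definition discrete_exit :: "complex set \<Rightarrow> nat \<Rightarrow> nat \<Rightarrow> nat \<Rightarrow> (real \<Rightarrow> complex) \<Rightarrow> nat" where
  "discrete_exit G n N m b = card {k. k < m \<and> (\<forall>r\<in>{0..real k / real N}. b r \<in> deep_part G n)}"

text \<open>The last step taken starts before the capped exit time, because on exit the path is
  outside every deep part; the overshoot is thus at most one mesh. Conversely, the path up to an
  earlier time is a compact subset of \<open>G\<close> and lies in \<open>deep_part G n\<close> for
  large n.\<close>

lemma discrete_exit_tendsto:
  fixes b :: "real \<Rightarrow> complex"
  assumes cont: "continuous_on {0..} b" and G: "open G" "G \<noteq> UNIV"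
    and N: "\<And>n. n < N n"
  shows "(\<lambda>n. real (discrete_exit G n (N n) (N n * T) b) / real (N n)) \<longlonglongrightarrow> exit_time_before G (real T) b"
    (is "(\<lambda>n. real (?\<kappa> n) / real (N n)) \<longlonglongrightarrow> ?e")
proof -
  note e = exit_time_before_bounds[OF cont G(1) of_nat_0_le_iff[of T]]
  have N0: "0 < N n" for n using N[of n] by simp
  define S where "S n = {k. k < N n * T \<and> (\<forall>r\<in>{0..real k / real (N n)}. b r \<in> deep_part G n)}" for n
  have S: "S n = {..<?\<kappa> n}" for n
    unfolding discrete_exit_def S_def[symmetric]
  proof (rule downward_closed_eq_lessThan)
    fix j k assume k: "k \<in> S n" "j < k"
    have "real j / real (N n) \<le> real k / real (N n)" using k(2) by (intro divide_right_mono) auto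
    thus "j \<in> S n" using k by (auto simp: S_def)
  qed (simp add: S_def)
  have upper: "real (?\<kappa> n) / real (N n) \<le> ?e + 1 / real (N n)" for n
  proof (cases "?\<kappa> n")
    case 0
    thus ?thesis using e(1) by simp
  next
    case (Suc k)
    hence k: "k \<in> S n" using S by auto
    have "real k / real (N n) < ?e"
    proof (rule ccontr)
      assume "\<not> real k / real (N n) < ?e"
      hence le: "?e \<le> real k / real (N n)" by simp
      from e(4) show False
      proof
        assume "b ?e \<notin> G"
        moreover have "b ?e \<in> deep_part G n" using k le e(1) by (auto simp: S_def)
        hence "b ?e \<in> G" using deep_part_ball[of "b ?e" G n] by auto
        ultimately show False by simp
      next
        assume "?e = real T"
        hence "real T * real (N n) \<le> real k" using le N0[of n] by (simp add: pos_le_divide_eq)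
        hence "real (T * N n) \<le> real k" by simp
        hence "T * N n \<le> k" by (simp only: of_nat_le_iff)
        moreover have "k < N n * T" using k by (simp add: S_def)
        ultimately show False by (simp add: mult.commute)
      qed
    qed
    thus ?thesis using Suc by (simp add: add_divide_distrib)
  qed
  have lower: "\<forall>\<^sub>F n in sequentially. a < real (?\<kappa> n) / real (N n)" if a: "0 \<le> a" "a < ?e" for a
  proof -
    have "compact (b ` {0..a})" by (intro compact_continuous_image continuous_on_subset[OF cont]) auto
    moreover have "b ` {0..a} \<noteq> {}" using a by auto
    ultimately obtain y where y: "y \<in> b ` {0..a}" "\<And>w. w \<in> b ` {0..a} \<Longrightarrow> infdist y (- G) \<le> infdist w (- G)"
      using continuous_attains_inf[of "b ` {0..a}" "\<lambda>w. infdist w (- G)"]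
        continuous_on_infdist[OF continuous_on_id] by blast
    have "y \<in> G" using y(1) a e(3) by auto
    hence "y \<notin> closure (- G)" using G(1) by (simp add: closure_closed closed_Compl)
    hence "infdist y (- G) > 0"
      using G(2) in_closure_iff_infdist_zero[of "- G" y] infdist_nonneg[of y "- G"] by force
    then obtain n0 where n0: "1 / real (Suc n0) < infdist y (- G)" using nat_approx_posE by blast
    show ?thesis
      unfolding eventually_sequentially
    proof (intro exI[of _ n0] allI impI)
      fix n assume n: "n0 \<le> n"
      have "1 / real (Suc n) \<le> 1 / real (Suc n0)" using n by (intro divide_left_mono) auto
      hence deep: "b r \<in> deep_part G n" if "r \<in> {0..a}" for r
        using y(2)[of "b r"] that n0 by (auto simp: deep_part_def)
      show "a < real (?\<kappa> n) / real (N n)"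
      proof (rule ccontr)
        assume "\<not> a < real (?\<kappa> n) / real (N n)"
        hence le: "real (?\<kappa> n) / real (N n) \<le> a" by simp
        also have "a < real T" using a e(2) by simp
        finally have "real (?\<kappa> n) < real T * real (N n)" using N0[of n] by (simp add: pos_divide_less_eq)
        hence "real (?\<kappa> n) < real (T * N n)" by simp
        hence "?\<kappa> n < N n * T" by (simp only: of_nat_less_iff mult.commute)
        moreover have "\<forall>r\<in>{0..real (?\<kappa> n) / real (N n)}. b r \<in> deep_part G n" using le by (auto intro!: deep)
        ultimately have "?\<kappa> n \<in> S n" by (simp add: S_def)
        thus False by (subst (asm) S) simp
      qed
    qed
  qed
  show ?thesis
  proof (rule order_tendstoI)
    fix a assume "a < ?e"
    show "\<forall>\<^sub>F n in sequentially. a < real (?\<kappa> n) / real (N n)"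
    proof (cases "0 \<le> a")
      case False
      have "a < real (?\<kappa> n) / real (N n)" for n
      proof -
        have "0 \<le> real (?\<kappa> n) / real (N n)" by simp
        thus ?thesis using False by linarith
      qed
      thus ?thesis by simp
    qed (use lower \<open>a < ?e\<close> in blast)
  next
    fix a assume a: "?e < a"
    obtain n0 where n0: "1 / real (Suc n0) < a - ?e" using nat_approx_posE[of "a - ?e"] a by auto
    show "\<forall>\<^sub>F n in sequentially. real (?\<kappa> n) / real (N n) < a"
      unfolding eventually_sequentially
    proof (intro exI[of _ n0] allI impI)
      fix n assume "n0 \<le> n"
      hence "real (Suc n0) \<le> real (N n)" using N[of n] by (subst of_nat_le_iff) linarith
      hence "1 / real (N n) \<le> 1 / real (Suc n0)" by (intro divide_left_mono) (use N0[of n] in auto)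
      thus "real (?\<kappa> n) / real (N n) < a" using upper[of n] n0 by linarith
    qed
  qed
qed

text \<open>Optional stopping at the exit time capped at T. \<open>f\<close> may jump at the
  boundary of \<open>G\<close>, so the estimate is made for \<open>f\<close>, but the limit along
  the discretised exits is taken for a continuous minorant \<open>g\<close>.\<close>

lemma brownian_stopped_le:
  fixes f g :: "complex \<Rightarrow> real"
  assumes bm: "planar_brownian_motion z M B"
    and G: "open G" "G \<noteq> UNIV"
    and f [measurable]: "f \<in> borel_measurable borel" and Cf: "\<And>w. \<bar>f w\<bar> \<le> C"
    and sm: "supermean_on f G"
    and g: "continuous_on UNIV g" and Cg: "\<And>w. \<bar>g w\<bar> \<le> C" and gf: "\<And>w. g w \<le> f w"
  defines "X \<equiv> (\<lambda>T \<omega>. B (exit_time_before G (real T) (\<lambda>t. B t \<omega>)) \<omega>)"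
  shows "X T \<in> borel_measurable M" "(\<integral>\<omega>. g (X T \<omega>) \<partial>M) \<le> f z"
proof -
  note bmD = planar_brownian_motionD[OF bm]
  interpret prob_space M by (rule bmD(1))
  have gm [measurable]: "g \<in> borel_measurable borel" by (rule borel_measurable_continuous_onI[OF g])
  have C0: "0 \<le> C" using Cf[of 0] by linarith
  \<comment> \<open>each of the \<open>N * T\<close> steps contributes an error of order \<open>N^(-2) * (n + 1)^4\<close>; the exponent 5 makes the
    total tend to 0\<close>
  define N where "N n = Suc n ^ 5" for n
  have N: "n < N n" for n using power_increasing[of 1 5 "Suc n"] by (simp add: N_def)
  have N0: "0 < N n" for n using N[of n] by simp
  define s where "s n = 1 / real (N n)" for n
  have s0: "0 < s n" for n using N0[of n] by (simp add: s_def)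
  define A where "A n k \<omega> \<longleftrightarrow> (\<forall>r\<in>{0..real k / real (N n)}. B r \<omega> \<in> deep_part G n)" for n k \<omega>
  define \<kappa> where "\<kappa> n \<omega> = discrete_exit G n (N n) (N n * T) (\<lambda>t. B t \<omega>)" for n \<omega>
  define Y where "Y n \<omega> = B (real (\<kappa> n \<omega>) / real (N n)) \<omega>" for n \<omega>
  have \<kappa>: "\<kappa> n \<omega> = card {k. k < N n * T \<and> A n k \<omega>}" for n \<omega>
    by (simp add: \<kappa>_def discrete_exit_def A_def)
  have Adown: "A n j \<omega>" if "A n k \<omega>" "j < k" for n j k \<omega>
  proof -
    have "real j / real (N n) \<le> real k / real (N n)" using that(2) by (intro divide_right_mono) auto
    thus ?thesis using that(1) by (auto simp: A_def)
  qed
  define K where "K n = 2 * C * (64 * sqrt (s n) ^ 4 / (1 / real (Suc n)) ^ 4)" for n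
  have K0: "0 \<le> K n" for n using C0 s0[of n] by (simp add: K_def)
  have step: "(\<integral>y. f (x + y) - f x \<partial>complex_gauss (sqrt (s n))) \<le> K n" if x: "x \<in> deep_part G n" for x n
    unfolding K_def
  proof (rule complex_gauss_step[OF _ _ f Cf])
    show "continuous_on (ball x (1 / real (Suc n))) f"
      using supermean_on_imp_continuous[OF sm] deep_part_ball[OF x] continuous_on_subset by blast
    fix r assume r: "0 < r" "r < 1 / real (Suc n)"
    hence "cball x r \<subseteq> ball x (1 / real (Suc n))" by auto
    hence "cball x r \<subseteq> G" using deep_part_ball[OF x] by blast
    thus "circle_mean f x r \<le> f x" by (rule supermean_on_circle_mean_le[OF sm _ r(1)])
  qed (use s0[of n] in auto)
  have kN: "0 \<le> real k / real (N n)" for k n by simp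
  have kNs: "real k / real (N n) + s n = real (Suc k) / real (N n)" for k n
    by (simp add: s_def add_divide_distrib)
  have Bm [measurable]: "B (real k / real (N n)) \<in> borel_measurable M" for k n by (rule bmD(2)) simp
  have Am [measurable]: "(\<lambda>\<omega>. indicator {\<omega>. A n k \<omega>} \<omega> :: real) \<in> borel_measurable M" for n k
    unfolding A_def by (rule brownian_step(1)[OF bm kN s0 closed_deep_part f Cf step K0])
  have Ystep: "(\<integral>\<omega>. indicator {\<omega>. A n k \<omega>} \<omega> * (f (B (real (Suc k) / real (N n)) \<omega>) - f (B (real k / real (N n)) \<omega>)) \<partial>M) \<le> K n" for n k
    unfolding A_def kNs[symmetric] by (rule brownian_step(2)[OF bm kN s0 closed_deep_part f Cf step K0])
  \<comment> \<open>Stated for general real vector spaces because the position itself, for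
    measurability of \<open>Y n\<close>, and its image under \<open>f\<close> are both
    telescoped.\<close>
  have tele: "\<phi> (Y n \<omega>) = \<phi> (B 0 \<omega>) + (\<Sum>k<N n * T. indicator {\<omega>. A n k \<omega>} \<omega> *\<^sub>R
      (\<phi> (B (real (Suc k) / real (N n)) \<omega>) - \<phi> (B (real k / real (N n)) \<omega>)))"
    for \<phi> :: "complex \<Rightarrow> 'b :: real_vector" and n \<omega>
  proof -
    have "\<phi> (Y n \<omega>) = \<phi> (B (real 0 / real (N n)) \<omega>) + (\<Sum>k<N n * T. if A n k \<omega> then
      \<phi> (B (real (Suc k) / real (N n)) \<omega>) - \<phi> (B (real k / real (N n)) \<omega>) else 0)"
      unfolding Y_def \<kappa>
      by (rule stopped_telescope[of "\<lambda>k. A n k \<omega>" "\<lambda>k. \<phi> (B (real k / real (N n)) \<omega>)", symmetric]) (rule Adown)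
    also have "(\<Sum>k<N n * T. if A n k \<omega> then
      \<phi> (B (real (Suc k) / real (N n)) \<omega>) - \<phi> (B (real k / real (N n)) \<omega>) else 0) =
      (\<Sum>k<N n * T. indicator {\<omega>. A n k \<omega>} \<omega> *\<^sub>R
      (\<phi> (B (real (Suc k) / real (N n)) \<omega>) - \<phi> (B (real k / real (N n)) \<omega>)))"
      by (intro sum.cong refl) (simp add: indicator_def)
    finally show ?thesis by simp
  qed
  have B0m [measurable]: "B 0 \<in> borel_measurable M" by (rule bmD(2)) simp
  have Ym [measurable]: "Y n \<in> borel_measurable M" for n
  proof -
    have "(\<lambda>\<omega>. B 0 \<omega> + (\<Sum>k<N n * T. indicator {\<omega>. A n k \<omega>} \<omega> *\<^sub>R
      (B (real (Suc k) / real (N n)) \<omega> - B (real k / real (N n)) \<omega>))) \<in> borel_measurable M"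
      by (intro borel_measurable_add borel_measurable_sum borel_measurable_scaleR borel_measurable_diff B0m Am Bm)
    thus ?thesis using tele[of "\<lambda>x. x" n] by (simp only: fun_eq_iff[symmetric] cong: measurable_cong)
  qed
  have Yf: "(\<integral>\<omega>. f (Y n \<omega>) \<partial>M) \<le> f z + 128 * C * real T / real (Suc n)" for n
  proof -
    let ?D = "\<lambda>k \<omega>. indicator {\<omega>. A n k \<omega>} \<omega> * (f (B (real (Suc k) / real (N n)) \<omega>) - f (B (real k / real (N n)) \<omega>))"
    have int: "integrable M (?D k)" for k
    proof (rule integrable_const_bound[where B = "2 * C"])
      have "\<bar>?D k \<omega>\<bar> \<le> 2 * C" for \<omega>
        using Cf[of "B (real (Suc k) / real (N n)) \<omega>"] Cf[of "B (real k / real (N n)) \<omega>"] C0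
        by (auto simp: indicator_def)
      thus "AE \<omega> in M. norm (?D k \<omega>) \<le> 2 * C" by simp
    qed measurable
    have "(\<integral>\<omega>. f (Y n \<omega>) \<partial>M) = (\<integral>\<omega>. f z + (\<Sum>k<N n * T. ?D k \<omega>) \<partial>M)"
      by (intro Bochner_Integration.integral_cong refl) (simp add: tele[of f] bmD(3))
    also have "\<dots> = f z + (\<Sum>k<N n * T. \<integral>\<omega>. ?D k \<omega> \<partial>M)"
    proof -
      have "(\<integral>\<omega>. f z + (\<Sum>k<N n * T. ?D k \<omega>) \<partial>M) = (\<integral>\<omega>. f z \<partial>M) + (\<integral>\<omega>. (\<Sum>k<N n * T. ?D k \<omega>) \<partial>M)"
        by (intro Bochner_Integration.integral_add Bochner_Integration.integrable_sum int integrable_const)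
      also have "(\<integral>\<omega>. (\<Sum>k<N n * T. ?D k \<omega>) \<partial>M) = (\<Sum>k<N n * T. \<integral>\<omega>. ?D k \<omega> \<partial>M)"
        by (intro Bochner_Integration.integral_sum int)
      finally show ?thesis by (simp only: Bochner_Integration.lebesgue_integral_const prob_space scaleR_one)
    qed
    also have "(\<Sum>k<N n * T. \<integral>\<omega>. ?D k \<omega> \<partial>M) \<le> (\<Sum>k<N n * T. K n)"
      by (intro sum_mono Ystep)
    also have "(\<Sum>k<N n * T. K n) = real (N n) * real T * K n" by simp
    also have "\<dots> = 128 * C * real T / real (Suc n)"
    proof -
      have "sqrt (s n) ^ 4 = (sqrt (s n) ^ 2) ^ 2" by simp
      also have "\<dots> = (s n)\<^sup>2" using s0[of n] by simp
      finally have s4: "sqrt (s n) ^ 4 = (1 / real (N n))\<^sup>2" by (simp add: s_def)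
      define x where "x = real (Suc n)"
      have x: "x \<noteq> 0" "real (N n) = x ^ 5" by (simp_all add: x_def N_def)
      show ?thesis unfolding K_def s4 x_def[symmetric] x(2) using x(1)
        by (simp add: field_simps eval_nat_numeral)
    qed
    finally show ?thesis by simp
  qed
  have lim: "(\<lambda>n. Y n \<omega>) \<longlonglongrightarrow> X T \<omega>" if \<omega>: "\<omega> \<in> space M" for \<omega>
    unfolding Y_def X_def \<kappa>_def
  proof (rule continuous_on_tendsto_compose[OF bmD(4)[OF \<omega>] discrete_exit_tendsto])
    show "exit_time_before G (real T) (\<lambda>t. B t \<omega>) \<in> {0..}"
      using exit_time_before_bounds(1)[OF bmD(4)[OF \<omega>] G(1) of_nat_0_le_iff[of T]] by simp
  qed (use bmD(4)[OF \<omega>] G N in auto)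
  show Xm [measurable]: "X T \<in> borel_measurable M"
    by (rule borel_measurable_LIMSEQ_metric[OF Ym lim])
  have "(\<lambda>n. \<integral>\<omega>. g (Y n \<omega>) \<partial>M) \<longlonglongrightarrow> (\<integral>\<omega>. g (X T \<omega>) \<partial>M)"
  proof (rule integral_dominated_convergence[where w = "\<lambda>_. C"])
    show "AE \<omega> in M. (\<lambda>n. g (Y n \<omega>)) \<longlonglongrightarrow> g (X T \<omega>)"
      by (rule AE_I2) (intro continuous_on_tendsto_compose[OF g lim], auto)
  qed (use Cg in auto)
  moreover have "(\<lambda>n. f z + 128 * C * real T / real (Suc n)) \<longlonglongrightarrow> f z + 0"
    by (intro tendsto_intros lim_const_over_n[THEN LIMSEQ_Suc])
  moreover have "(\<integral>\<omega>. g (Y n \<omega>) \<partial>M) \<le> f z + 128 * C * real T / real (Suc n)" for n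
  proof -
    have "(\<integral>\<omega>. g (Y n \<omega>) \<partial>M) \<le> (\<integral>\<omega>. f (Y n \<omega>) \<partial>M)"
      by (intro integral_mono integrable_const_bound[where B = C]) (use Cf Cg gf in auto)
    thus ?thesis using Yf[of n] by linarith
  qed
  ultimately show "(\<integral>\<omega>. g (X T \<omega>) \<partial>M) \<le> f z"
    using LIMSEQ_le by fastforce
qed

section \<open>Letting the time tend to infinity\<close>

lemma complex_gauss_le_lborel:
  assumes \<sigma>: "\<sigma> > 0" and A [measurable]: "A \<in> sets borel" and fin: "emeasure lborel A < \<infinity>"
  shows "measure (complex_gauss \<sigma>) A \<le> measure lborel A / (2 * pi * \<sigma>\<^sup>2)"
proof -
  interpret prob_space "complex_gauss \<sigma>" by (rule prob_space_complex_gauss[OF \<sigma>])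
  have "complex_gauss_density \<sigma> w \<le> 1 / (2 * pi * \<sigma>\<^sup>2)" for w
    unfolding complex_gauss_density_eq using \<sigma> by (intro mult_left_le) auto
  hence "(\<integral>\<^sup>+w. ennreal (complex_gauss_density \<sigma> w) * indicator A w \<partial>lborel)
     \<le> (\<integral>\<^sup>+w. ennreal (1 / (2 * pi * \<sigma>\<^sup>2)) * indicator A w \<partial>lborel)"
    by (intro nn_integral_mono mult_right_mono ennreal_leI) auto
  also have "\<dots> = ennreal (1 / (2 * pi * \<sigma>\<^sup>2)) * emeasure lborel A" by (simp add: nn_integral_cmult_indicator)
  also have "\<dots> = ennreal (1 / (2 * pi * \<sigma>\<^sup>2)) * ennreal (measure lborel A)"
    using fin by (subst emeasure_eq_ennreal_measure) auto
  also have "\<dots> = ennreal (measure lborel A / (2 * pi * \<sigma>\<^sup>2))"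
    by (subst ennreal_mult[symmetric]) auto
  finally have "emeasure (complex_gauss \<sigma>) A \<le> ennreal (measure lborel A / (2 * pi * \<sigma>\<^sup>2))"
    unfolding complex_gauss_def by (subst emeasure_density) auto
  thus ?thesis by (simp add: emeasure_eq_measure)
qed

text \<open>At time T the density of the increment is at most 1 / (2 pi T), so a fixed disc carries
  mass of order 1/T; outside a large disc \<open>g\<close> is small.\<close>

lemma brownian_vanishing_expectation:
  fixes g :: "complex \<Rightarrow> real"
  assumes bm: "planar_brownian_motion z M B"
    and g [measurable]: "g \<in> borel_measurable borel" and C: "\<And>w. \<bar>g w\<bar> \<le> C"
    and lim: "(g \<longlongrightarrow> 0) at_infinity"
  shows "(\<lambda>T. \<integral>\<omega>. \<bar>g (B (real T) \<omega>)\<bar> \<partial>M) \<longlonglongrightarrow> 0"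
proof -
  note bmD = planar_brownian_motionD[OF bm]
  interpret prob_space M by (rule bmD(1))
  have C0: "0 \<le> C" using C[of 0] by linarith
  have [measurable]: "B (real T) \<in> borel_measurable M" for T by (rule bmD(2)) simp
  have [measurable]: "B 0 \<in> borel_measurable M" by (rule bmD(2)) simp
  have "\<forall>\<^sub>F T in sequentially. (\<integral>\<omega>. \<bar>g (B (real T) \<omega>)\<bar> \<partial>M) < e" if "e > 0" for e
  proof -
    have "\<forall>\<^sub>F w in at_infinity. dist (g w) 0 < e / 2" using lim \<open>e > 0\<close> by (intro tendstoD) auto
    then obtain R where R: "\<And>w. R \<le> cmod w \<Longrightarrow> \<bar>g w\<bar> < e / 2"
      unfolding eventually_at_infinity by (auto simp: dist_real_def)
    \<comment> \<open>The position at time T is in the disc of radius R about 0 iff the increment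
      from \<open>z\<close> is in the disc about -z.\<close>
    define V where "V = measure lborel (ball (- z) R)"
    have bound: "(\<integral>\<omega>. \<bar>g (B (real T) \<omega>)\<bar> \<partial>M) \<le> e / 2 + C * (V / (2 * pi)) / real T" if T: "T > 0" for T
    proof -
      have "(\<integral>\<omega>. \<bar>g (B (real T) \<omega>)\<bar> \<partial>M) \<le> (\<integral>\<omega>. e / 2 + C * indicator (ball (- z) R) (B (real T) \<omega> - B 0 \<omega>) \<partial>M)"
      proof (rule integral_mono)
        show "integrable M (\<lambda>\<omega>. \<bar>g (B (real T) \<omega>)\<bar>)"
          by (rule integrable_const_bound[where B = C]) (use C in auto)
        show "integrable M (\<lambda>\<omega>. e / 2 + C * indicator (ball (- z) R) (B (real T) \<omega> - B 0 \<omega>))"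
          by (rule integrable_const_bound[where B = "e / 2 + C"]) (use C0 \<open>e > 0\<close> in \<open>auto simp: indicator_def\<close>)
        fix \<omega> assume "\<omega> \<in> space M"
        hence "B 0 \<omega> = z" by (rule bmD(3))
        thus "\<bar>g (B (real T) \<omega>)\<bar> \<le> e / 2 + C * indicator (ball (- z) R) (B (real T) \<omega> - B 0 \<omega>)"
          using R[of "B (real T) \<omega>"] C[of "B (real T) \<omega>"] \<open>e > 0\<close> C0
          by (auto simp: indicator_def dist_norm norm_minus_commute not_less algebra_simps)
      qed
      also have "\<dots> = e / 2 + C * (\<integral>\<omega>. indicator (ball (- z) R) (B (real T) \<omega> - B 0 \<omega>) \<partial>M)"
      proof -
        have "integrable M (\<lambda>\<omega>. indicator (ball (- z) R) (B (real T) \<omega> - B 0 \<omega>) :: real)"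
          by (rule integrable_const_bound[where B = 1]) (auto simp: indicator_def)
        thus ?thesis by (simp add: prob_space)
      qed
      also have "(\<integral>\<omega>. indicator (ball (- z) R) (B (real T) \<omega> - B 0 \<omega>) \<partial>M) =
          (\<integral>y. (indicator (ball (- z) R) y :: real) \<partial>distr M borel (\<lambda>\<omega>. B (real T) \<omega> - B 0 \<omega>))"
        by (rule integral_distr[symmetric]) (intro borel_measurable_diff borel_measurable_indicator; simp)+
      also have "\<dots> = measure (complex_gauss (sqrt (real T))) (ball (- z) R)"
        using T by (subst distr_brownian_increment[OF bm]) auto
      also have "\<dots> \<le> V / (2 * pi * (sqrt (real T))\<^sup>2)"
        unfolding V_def using T emeasure_lborel_ball_finite[of "- z" R]
        by (intro complex_gauss_le_lborel) auto
      also have "\<dots> = V / (2 * pi) / real T" using T by simp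
      finally show ?thesis using C0 by (simp add: mult_left_mono)
    qed
    have "(\<lambda>T. e / 2 + C * (V / (2 * pi)) / real T) \<longlonglongrightarrow> e / 2 + 0"
      by (intro tendsto_intros lim_const_over_n)
    hence "\<forall>\<^sub>F T in sequentially. e / 2 + C * (V / (2 * pi)) / real T < e"
      by (rule order_tendstoD(2)) (use \<open>e > 0\<close> in simp)
    thus ?thesis using eventually_gt_at_top[of 0]
      by eventually_elim (use bound in \<open>meson le_less_trans\<close>)
  qed
  moreover have "a < (\<integral>\<omega>. \<bar>g (B (real T) \<omega>)\<bar> \<partial>M)" if "a < 0" for a T
  proof -
    have "0 \<le> (\<integral>\<omega>. \<bar>g (B (real T) \<omega>)\<bar> \<partial>M)" by (rule integral_nonneg_AE) simp
    thus ?thesis using that by linarith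
  qed
  hence "\<forall>\<^sub>F T in sequentially. a < (\<integral>\<omega>. \<bar>g (B (real T) \<omega>)\<bar> \<partial>M)" if "a < 0" for a
    using that by (intro always_eventually allI)
  ultimately show ?thesis by (intro order_tendstoI)
qed

text \<open>Paths still in \<open>G\<close> at time T are at their position at time T, and the mean
  of |g| there tends to 0. The condition \<open>g 0 = 0\<close> fits the value 0 that
  \<open>exit_position\<close> assigns to paths that never leave.\<close>

theorem brownian_exit_le:
  fixes f g :: "complex \<Rightarrow> real"
  assumes bm: "planar_brownian_motion z M B"
    and G: "open G" "G \<noteq> UNIV"
    and f [measurable]: "f \<in> borel_measurable borel" and Cf: "\<And>w. \<bar>f w\<bar> \<le> C"
    and sm: "supermean_on f G"
    and g: "continuous_on UNIV g" and Cg: "\<And>w. \<bar>g w\<bar> \<le> C" and gf: "\<And>w. g w \<le> f w"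
    and g0: "g 0 = 0" and ginf: "(g \<longlongrightarrow> 0) at_infinity"
  shows "(\<integral>\<omega>. g (exit_position G B \<omega>) \<partial>M) \<le> f z"
proof -
  note bmD = planar_brownian_motionD[OF bm]
  interpret prob_space M by (rule bmD(1))
  have gm [measurable]: "g \<in> borel_measurable borel" by (rule borel_measurable_continuous_onI[OF g])
  have C0: "0 \<le> C" using Cg[of 0] by linarith
  define X where "X T \<omega> = B (exit_time_before G (real T) (\<lambda>t. B t \<omega>)) \<omega>" for T :: nat and \<omega>
  have Xm [measurable]: "X T \<in> borel_measurable M" and XE: "(\<integral>\<omega>. g (X T \<omega>) \<partial>M) \<le> f z" for T
    using brownian_stopped_le[OF bm G f Cf sm g Cg gf, of T] by (simp_all add: X_def[abs_def])
  have Gb [measurable]: "G \<in> sets borel" using G by simp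
  have [measurable]: "B (real T) \<in> borel_measurable M" for T by (rule bmD(2)) simp
  \<comment> \<open>Counts only the paths that have left by time T. It converges on every path,
    whereas \<open>g (X T \<omega>)\<close> need not converge on a path that stays in
    \<open>G\<close> forever.\<close>
  define h where "h T \<omega> = (if X T \<omega> \<in> G then 0 else g (X T \<omega>))" for T \<omega>
  have hm [measurable]: "h T \<in> borel_measurable M" for T unfolding h_def[abs_def] by measurable
  have hb: "\<bar>h T \<omega>\<bar> \<le> C" for T \<omega> using Cg C0 by (simp add: h_def)
  have hlim: "(\<lambda>T. h T \<omega>) \<longlonglongrightarrow> g (exit_position G B \<omega>)" if \<omega>: "\<omega> \<in> space M" for \<omega>
  proof (cases "\<exists>t\<ge>0. B t \<omega> \<notin> G")
    case True
    then obtain t where t: "0 \<le> t" "B t \<omega> \<notin> G" by blast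
    define \<tau> where "\<tau> = Inf {t. 0 \<le> t \<and> B t \<omega> \<notin> G}"
    note fe = first_exit[OF bmD(4)[OF \<omega>] G(1) t, folded \<tau>_def]
    have ep: "exit_position G B \<omega> = B \<tau> \<omega>" using True by (simp add: exit_position_def \<tau>_def)
    have "h T \<omega> = g (B \<tau> \<omega>)" if "\<tau> \<le> real T" for T
    proof -
      have "\<exists>t\<in>{0..real T}. B t \<omega> \<notin> G" using fe that by auto
      hence "X T \<omega> = B \<tau> \<omega>" by (simp add: X_def exit_time_before_def \<tau>_def)
      thus ?thesis using fe(3) by (simp add: h_def)
    qed
    moreover have "\<forall>\<^sub>F T in sequentially. \<tau> \<le> real T"
      using filterlim_real_sequentially by (simp add: filterlim_at_top)
    ultimately have "\<forall>\<^sub>F T in sequentially. h T \<omega> = g (B \<tau> \<omega>)" by (auto elim: eventually_mono)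
    thus ?thesis unfolding ep by (rule tendsto_eventually)
  next
    case False
    hence ep: "exit_position G B \<omega> = 0" by (simp only: exit_position_def if_False)
    have "X T \<omega> \<in> G" for T
      using False exit_time_before_bounds(1)[OF bmD(4)[OF \<omega>] G(1) of_nat_0_le_iff[of T]] by (auto simp: X_def)
    thus ?thesis by (simp add: ep g0 h_def)
  qed
  have diff: "\<bar>g (X T \<omega>) - h T \<omega>\<bar> \<le> \<bar>g (B (real T) \<omega>)\<bar>" if \<omega>: "\<omega> \<in> space M" for T \<omega>
  proof (cases "X T \<omega> \<in> G")
    case True
    hence "X T \<omega> = B (real T) \<omega>"
      using exit_time_before_bounds(4)[OF bmD(4)[OF \<omega>] G(1) of_nat_0_le_iff[of T]] by (auto simp: X_def)
    thus ?thesis using True by (simp add: h_def)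
  qed (simp add: h_def)
  have intg: "integrable M (\<lambda>\<omega>. g (X T \<omega>))" "integrable M (h T)" "integrable M (\<lambda>\<omega>. \<bar>g (B (real T) \<omega>)\<bar>)" for T
    by (rule integrable_const_bound[where B = C], use Cg hb in auto)+
  have hE: "(\<integral>\<omega>. h T \<omega> \<partial>M) \<le> f z + (\<integral>\<omega>. \<bar>g (B (real T) \<omega>)\<bar> \<partial>M)" for T
  proof -
    have "(\<integral>\<omega>. h T \<omega> \<partial>M) \<le> (\<integral>\<omega>. g (X T \<omega>) + \<bar>g (B (real T) \<omega>)\<bar> \<partial>M)"
    proof (rule integral_mono)
      fix \<omega> assume "\<omega> \<in> space M"
      from diff[OF this, of T] show "h T \<omega> \<le> g (X T \<omega>) + \<bar>g (B (real T) \<omega>)\<bar>" by linarith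
    qed (intro intg Bochner_Integration.integrable_add)+
    also have "\<dots> = (\<integral>\<omega>. g (X T \<omega>) \<partial>M) + (\<integral>\<omega>. \<bar>g (B (real T) \<omega>)\<bar> \<partial>M)"
      by (intro Bochner_Integration.integral_add intg)
    finally show ?thesis using XE[of T] by linarith
  qed
  have mE: "(\<lambda>\<omega>. g (exit_position G B \<omega>)) \<in> borel_measurable M"
    by (rule borel_measurable_LIMSEQ_metric[OF hm hlim])
  have "(\<lambda>T. \<integral>\<omega>. h T \<omega> \<partial>M) \<longlonglongrightarrow> (\<integral>\<omega>. g (exit_position G B \<omega>) \<partial>M)"
  proof (rule integral_dominated_convergence[where w = "\<lambda>_. C"])
    show "AE \<omega> in M. (\<lambda>T. h T \<omega>) \<longlonglongrightarrow> g (exit_position G B \<omega>)" by (rule AE_I2) (rule hlim)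
  qed (use hb mE in auto)
  moreover have "(\<lambda>T. f z + (\<integral>\<omega>. \<bar>g (B (real T) \<omega>)\<bar> \<partial>M)) \<longlonglongrightarrow> f z + 0"
    by (intro tendsto_intros brownian_vanishing_expectation[OF bm gm Cg ginf])
  ultimately show ?thesis using hE LIMSEQ_le by fastforce
qed

section \<open>The Green function\<close>

text \<open>The logarithm of |w - cnj z| / |w - z|: the pole is balanced by its mirror image in the
  real axis.\<close>

definition green_half_plane :: "complex \<Rightarrow> complex \<Rightarrow> real" where
  "green_half_plane w z = ln (cmod (w - cnj z)) - ln (cmod (w - z))"

lemma open_upper_half_plane: "open upper_half_plane"
  unfolding upper_half_plane_def by (intro open_Collect_less continuous_intros)

lemma cmod_minus_cnj_power2: "(cmod (w - cnj z))\<^sup>2 = (cmod (w - z))\<^sup>2 + 4 * Im w * Im z"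
  unfolding cmod_power2 by (simp add: power2_eq_square algebra_simps)

text \<open>The inequality ln x \<le> x - 1, used for the squared quotient and for its reciprocal;
  the two squared distances differ by 4 Im w Im z.\<close>

lemma green_half_plane_bounds:
  assumes "w \<in> upper_half_plane" "z \<in> upper_half_plane" "w \<noteq> z"
  shows "2 * Im w * Im z / (cmod (w - cnj z))\<^sup>2 \<le> green_half_plane w z"
    and "green_half_plane w z \<le> 2 * Im w * Im z / (cmod (w - z))\<^sup>2"
    and "0 \<le> green_half_plane w z"
proof -
  define a b where "a = cmod (w - cnj z)" and "b = cmod (w - z)"
  have im: "0 < Im w" "0 < Im z" using assms by (auto simp: upper_half_plane_def)
  have ab: "a\<^sup>2 = b\<^sup>2 + 4 * Im w * Im z" unfolding a_def b_def by (rule cmod_minus_cnj_power2)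
  have b: "0 < b" using assms by (simp add: b_def)
  have "w \<noteq> cnj z" using im by auto
  hence a: "0 < a" by (simp add: a_def)
  have g: "2 * green_half_plane w z = ln (a\<^sup>2 / b\<^sup>2)"
    using a b by (simp add: green_half_plane_def a_def[symmetric] b_def[symmetric] ln_div ln_realpow)
  have "ln (a\<^sup>2 / b\<^sup>2) \<le> a\<^sup>2 / b\<^sup>2 - 1" using a b by (intro ln_le_minus_one) simp
  also have "\<dots> = 4 * Im w * Im z / b\<^sup>2" using b by (simp add: ab field_simps)
  finally show "green_half_plane w z \<le> 2 * Im w * Im z / (cmod (w - z))\<^sup>2"
    using g by (simp add: b_def)
  have "- ln (a\<^sup>2 / b\<^sup>2) = ln (b\<^sup>2 / a\<^sup>2)" using a b by (simp add: ln_div)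
  also have "\<dots> \<le> b\<^sup>2 / a\<^sup>2 - 1" using a b by (intro ln_le_minus_one) simp
  also have "\<dots> = (b\<^sup>2 - a\<^sup>2) / a\<^sup>2" using a by (simp add: diff_divide_distrib)
  also have "b\<^sup>2 - a\<^sup>2 = - (4 * Im w * Im z)" using ab by simp
  finally show "2 * Im w * Im z / (cmod (w - cnj z))\<^sup>2 \<le> green_half_plane w z"
    using g by (simp add: a_def)
  moreover have "0 \<le> 2 * Im w * Im z / (cmod (w - cnj z))\<^sup>2" using im by simp
  ultimately show "0 \<le> green_half_plane w z" by linarith
qed

lemma green_half_plane_real_eq_0: "Im w = 0 \<Longrightarrow> green_half_plane w z = 0"
  using cmod_minus_cnj_power2[of w z] by (simp add: green_half_plane_def)

lemma isCont_green_half_plane: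
  assumes "w \<noteq> z" "w \<noteq> cnj z"
  shows "isCont (\<lambda>w. green_half_plane w z) w"
  unfolding green_half_plane_def using assms by (intro continuous_intros) auto

lemma locally_Re_holomorphic_ln_cnj:
  assumes z: "z \<in> upper_half_plane"
  shows "locally_Re_holomorphic (\<lambda>w. ln (cmod (w - cnj z))) upper_half_plane"
proof (rule locally_Re_holomorphicI[OF open_upper_half_plane])
  have "w - cnj z \<notin> \<real>\<^sub>\<le>\<^sub>0" if "w \<in> upper_half_plane" for w
    using that z by (auto simp: complex_nonpos_Reals_iff upper_half_plane_def)
  thus "(\<lambda>w. Ln (w - cnj z)) holomorphic_on upper_half_plane"
    by (intro holomorphic_intros) auto
  fix w assume "w \<in> upper_half_plane"
  hence "w - cnj z \<noteq> 0" using z by (auto simp: complex_eq_iff upper_half_plane_def)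
  thus "ln (cmod (w - cnj z)) = Re (Ln (w - cnj z))" by simp
qed

text \<open>A branch of the logarithm exists on the largest disc about \<open>a\<close> that avoids
  \<open>z\<close>: there (w - z) / (a - z) is within distance 1 of 1, hence in the right
  half-plane.\<close>

lemma locally_Re_holomorphic_ln:
  "locally_Re_holomorphic (\<lambda>w. ln (cmod (w - z))) (- {z})"
proof (rule locally_Re_holomorphicI_local)
  fix a assume a: "a \<in> - {z}"
  let ?T = "ball a (cmod (a - z))"
  have "locally_Re_holomorphic (\<lambda>w. ln (cmod (w - z))) ?T"
  proof (rule locally_Re_holomorphicI)
    have "(w - z) / (a - z) \<notin> \<real>\<^sub>\<le>\<^sub>0" if "w \<in> ?T" for w
    proof -
      have "cmod (1 - (w - z) / (a - z)) = cmod (a - w) / cmod (a - z)"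
        using a by (simp add: norm_divide[symmetric] field_simps)
      also have "\<dots> < 1" using that a by (simp add: dist_norm)
      finally have "Re (1 - (w - z) / (a - z)) < 1" using complex_Re_le_cmod le_less_trans by blast
      hence "0 < Re ((w - z) / (a - z))" by simp
      thus ?thesis by (auto simp: complex_nonpos_Reals_iff)
    qed
    thus "(\<lambda>w. Ln ((w - z) / (a - z)) + of_real (ln (cmod (a - z)))) holomorphic_on ?T"
      using a by (intro holomorphic_intros) auto
    fix w assume w: "w \<in> ?T"
    hence "w \<noteq> z" by (auto simp: dist_norm)
    thus "ln (cmod (w - z)) = Re (Ln ((w - z) / (a - z)) + of_real (ln (cmod (a - z))))"
      using a by (simp add: norm_divide ln_div)
  qed simp
  moreover have "a \<in> ?T" "?T \<subseteq> - {z}" using a by (auto simp: dist_norm)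
  ultimately show "\<exists>T. a \<in> T \<and> T \<subseteq> - {z} \<and> locally_Re_holomorphic (\<lambda>w. ln (cmod (w - z))) T" by blast
qed

lemma locally_Re_holomorphic_green_half_plane:
  assumes "z \<in> upper_half_plane"
  shows "locally_Re_holomorphic (\<lambda>w. green_half_plane w z) (upper_half_plane - {z})"
  unfolding green_half_plane_def
  by (intro locally_Re_holomorphic_diff locally_Re_holomorphic_subset[OF locally_Re_holomorphic_ln_cnj[OF assms]]
      locally_Re_holomorphic_subset[OF locally_Re_holomorphic_ln])
     (auto intro: open_upper_half_plane)

lemma green_half_plane_eventually_small:
  assumes z: "z \<in> upper_half_plane" and \<eta>: "\<eta> > 0"
  shows "\<forall>\<^sub>F w in at_infinity. w \<in> upper_half_plane \<longrightarrow> green_half_plane w z < \<eta>"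
  unfolding eventually_at_infinity
proof (intro exI allI impI)
  \<comment> \<open>|w| > 2 |z| gives |w - z| \<ge> |w| / 2 and so the bound 8 |z| / |w|; the second
    summand makes this less than \<eta>.\<close>
  fix w assume w: "2 * cmod z + 8 * cmod z / \<eta> + 1 \<le> cmod w" "w \<in> upper_half_plane"
  have "0 \<le> 8 * cmod z / \<eta>" using \<eta> by simp
  hence big: "2 * cmod z < cmod w" "8 * cmod z / \<eta> < cmod w" "0 < cmod w" using w(1) by (smt (verit) norm_ge_zero)+
  have ne: "w \<noteq> z" using big by (smt (verit) norm_ge_zero)
  have "cmod w / 2 \<le> cmod (w - z)" using big norm_triangle_ineq2[of w z] by linarith
  hence sq: "(cmod w / 2)\<^sup>2 \<le> (cmod (w - z))\<^sup>2" by (intro power_mono) auto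
  have "green_half_plane w z \<le> 2 * Im w * Im z / (cmod (w - z))\<^sup>2"
    by (rule green_half_plane_bounds(2)[OF w(2) z ne])
  also have "\<dots> \<le> 2 * cmod w * cmod z / (cmod w / 2)\<^sup>2"
    using sq big z w(2) by (intro frac_le mult_mono mult_left_mono) (auto simp: upper_half_plane_def intro: abs_Im_le_cmod[THEN order_trans[OF abs_ge_self]])
  also have "\<dots> = 8 * cmod z / cmod w" using big(3) by (simp add: field_simps power2_eq_square)
  also have "\<dots> < \<eta>" using big \<eta> by (simp add: field_simps)
  finally show "green_half_plane w z < \<eta>" .
qed

lemma ln_norm_minus_at_bot: "filterlim (\<lambda>w. ln (cmod (w - z))) at_bot (at z)"
proof (rule filterlim_compose[OF ln_at_0])
  have "((\<lambda>w. cmod (w - z)) \<longlongrightarrow> 0) (at z)"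
    by (rule tendsto_eq_intros | simp)+
  thus "filterlim (\<lambda>w. cmod (w - z)) (at_right 0) (at z)"
    by (auto simp: filterlim_at eventually_at_filter)
qed

lemma green_half_plane_at_top:
  assumes z: "z \<in> upper_half_plane"
  shows "filterlim (\<lambda>w. green_half_plane w z) at_top (at z)"
proof -
  have "z - cnj z \<noteq> 0" using z by (auto simp: complex_eq_iff upper_half_plane_def)
  hence "((\<lambda>w. ln (cmod (w - cnj z))) \<longlongrightarrow> ln (cmod (z - cnj z))) (at z)"
    by (intro tendsto_intros) auto
  moreover have "filterlim (\<lambda>w. - ln (cmod (w - z))) at_top (at z)"
    using ln_norm_minus_at_bot by (simp add: filterlim_uminus_at_bot)
  ultimately have "filterlim (\<lambda>w. ln (cmod (w - cnj z)) + - ln (cmod (w - z))) at_top (at z)"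
    by (rule filterlim_tendsto_add_at_top)
  thus ?thesis by (simp add: green_half_plane_def)
qed

lemma cnj_notin_closed_upper: "z \<in> upper_half_plane \<Longrightarrow> 0 \<le> Im x \<Longrightarrow> x \<noteq> cnj z"
  by (auto simp: upper_half_plane_def)

lemma Im_nonneg_closure:
  assumes "D \<subseteq> upper_half_plane" "x \<in> closure D"
  shows "0 \<le> Im x"
proof -
  have "closed {z. 0 \<le> Im z}" by (intro closed_Collect_le continuous_intros)
  moreover have "D \<subseteq> {z. 0 \<le> Im z}" using assms(1) by (auto simp: upper_half_plane_def)
  ultimately show ?thesis using closure_minimal assms(2) by blast
qed

text \<open>By Harnack's inequality the infimum over the majorants, with the pole removed, is continuous at
  \<open>z\<close>; hence the limit in the definition of the inner radius exists.\<close>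

theorem inner_radius_bounds:
  assumes G: "open G" "G \<subseteq> upper_half_plane" and z: "z \<in> G"
    and V: "locally_Re_holomorphic V G"
    and cv: "\<And>n. continuous_on UNIV (v n)" and smv: "\<And>n::nat. supermean_on (v n) G"
    and v0: "\<And>n w. 0 \<le> v n w" and lim: "\<And>w. w \<in> G \<Longrightarrow> (\<lambda>n. v n w) \<longlonglongrightarrow> V w"
    and \<beta>: "0 \<le> \<beta>"
    and up: "\<And>w. w \<in> G \<Longrightarrow> w \<noteq> z \<Longrightarrow> \<alpha> * V w \<le> green_half_plane w z"
    and dn: "\<And>n w. w \<in> upper_half_plane \<Longrightarrow> w \<notin> G \<Longrightarrow> green_half_plane w z \<le> \<beta> * v n w"
  shows "2 * Im z * exp (- \<beta> * V z) \<le> inner_radius G z"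
    and "inner_radius G z \<le> 2 * Im z * exp (- \<alpha> * V z)"
proof -
  define D where "D = connected_component_set G z"
  have D: "open D" "z \<in> D" "D \<subseteq> G"
    using G(1) z by (auto simp: D_def open_connected_component connected_component_subset)
  have zH: "z \<in> upper_half_plane" and Imz: "0 < Im z" using z G(2) by (auto simp: upper_half_plane_def)
  have DH: "D \<subseteq> upper_half_plane" using D G by blast
  have frD: "0 \<le> Im x" "x \<notin> G" if "x \<in> frontier D" for x
  proof -
    show "0 \<le> Im x" using that DH Im_nonneg_closure by (auto simp: frontier_def)
    have "x \<in> frontier G" using that frontier_of_connected_component_subset D_def by blast
    thus "x \<notin> G" using G(1) by (simp add: frontier_def interior_open)
  qed
  define L where "L w = ln (cmod (w - cnj z))" for w
  have L: "locally_Re_holomorphic L D"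
    unfolding L_def[abs_def] by (rule locally_Re_holomorphic_subset[OF locally_Re_holomorphic_ln_cnj[OF zH] D(1) DH])
  have Lz: "L z = ln (2 * Im z)"
  proof -
    have "z - cnj z = of_real (2 * Im z) * \<i>" by (simp add: complex_eq_iff)
    thus ?thesis using Imz by (simp add: L_def norm_mult)
  qed
  \<comment> \<open>Majorants are written through their harmonic parts \<open>h\<close>, which
    unlike the majorants have a meaningful value at \<open>z\<close>; the infimum at the pole is
    taken over these.\<close>
  define pole where "pole h w = h w - ln (cmod (w - z))" for h :: "complex \<Rightarrow> real" and w
  define Hs where "Hs = {h. locally_Re_holomorphic h D \<and> (\<forall>w\<in>D - {z}. 0 \<le> pole h w)}"
  have maj: "pole h \<in> log_pole_majorants D z" if "h \<in> Hs" for h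
    unfolding log_pole_majorants_def
  proof (intro CollectI conjI)
    have h: "locally_Re_holomorphic h D" using that by (simp add: Hs_def)
    show "harmonic_on (pole h) (D - {z})"
      unfolding harmonic_on_iff_locally_Re_holomorphic pole_def[abs_def]
      by (intro locally_Re_holomorphic_diff locally_Re_holomorphic_subset[OF h]
            locally_Re_holomorphic_subset[OF locally_Re_holomorphic_ln]) (use D(1) in auto)
    show "\<forall>w\<in>D - {z}. 0 \<le> pole h w" using that by (simp add: Hs_def)
    show "\<exists>ha. harmonic_on ha D \<and> (\<forall>w\<in>D - {z}. pole h w = ha w - ln (cmod (w - z)))"
      using h by (intro exI[of _ h]) (simp add: harmonic_on_iff_locally_Re_holomorphic pole_def)
  qed
  have maj_ex: "\<exists>h\<in>Hs. \<forall>w\<in>D - {z}. u w = pole h w" if "u \<in> log_pole_majorants D z" for u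
    using that unfolding log_pole_majorants_def Hs_def pole_def harmonic_on_iff_locally_Re_holomorphic
    by force
  \<comment> \<open>One explicit competitor, \<open>green_half_plane\<close> minus \<alpha> V, which
    is nonnegative by \<open>up\<close>; it gives the upper bound.\<close>
  have h0: "(\<lambda>w. L w - \<alpha> * V w) \<in> Hs"
    unfolding Hs_def
  proof (intro CollectI conjI ballI)
    show "locally_Re_holomorphic (\<lambda>w. L w - \<alpha> * V w) D"
      by (intro locally_Re_holomorphic_diff L locally_Re_holomorphic_cmult locally_Re_holomorphic_subset[OF V D(1,3)])
    fix w assume "w \<in> D - {z}"
    thus "0 \<le> pole (\<lambda>w. L w - \<alpha> * V w) w"
      using up[of w] D(3) by (auto simp: pole_def L_def green_half_plane_def)
  qed
  \<comment> \<open>Every competitor dominates \<open>green_half_plane\<close> minus \<beta> V. The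
    minimum principle is applied with the continuous \<open>v n\<close> in place of
    \<open>V\<close>: near the frontier h - L is at least minus \<open>green_half_plane\<close>, and
    by \<open>dn\<close> the term with \<open>v n\<close> makes up for it.\<close>
  have hlow: "L w - \<beta> * V w \<le> h w" if h: "h \<in> Hs" and w: "w \<in> D" for h w
  proof -
    have hh: "locally_Re_holomorphic h D" and hp: "\<And>w. w \<in> D \<Longrightarrow> w \<noteq> z \<Longrightarrow> 0 \<le> pole h w"
      using h by (auto simp: Hs_def)
    have nonneg: "0 \<le> (h w - L w) + \<beta> * v n w" for n
    proof (rule minimum_principle_boundary[OF _ _ _ w])
      show "supermean_on (\<lambda>w. (h w - L w) + \<beta> * v n w) D"
        by (intro supermean_on_add supermean_on_cmult supermean_on_subset[OF smv D(1,3)] \<beta>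
              locally_Re_holomorphic_imp_supermean locally_Re_holomorphic_diff hh L)
      have ge: "\<beta> * v n y - green_half_plane y z \<le> (h y - L y) + \<beta> * v n y" if "y \<in> D" "y \<noteq> z" for y
        using hp[OF that] by (simp add: pole_def green_half_plane_def L_def)
      fix \<eta> :: real assume \<eta>: "\<eta> > 0"
      show "\<forall>\<^sub>F w in at x within D. - \<eta> < (h w - L w) + \<beta> * v n w" if x: "x \<in> frontier D" for x
      proof -
        have xz: "x \<noteq> z" using frD(2)[OF x] z by auto
        have xc: "x \<noteq> cnj z" using frD(1)[OF x] zH cnj_notin_closed_upper by blast
        have "isCont (v n) x" using cv[of n] by (simp add: continuous_on_eq_continuous_at)
        hence "isCont (\<lambda>y. \<beta> * v n y - green_half_plane y z) x"
          using isCont_green_half_plane[OF xz xc] by (intro continuous_intros)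
        hence lim: "((\<lambda>y. \<beta> * v n y - green_half_plane y z) \<longlongrightarrow> \<beta> * v n x - green_half_plane x z) (at x within D)"
          unfolding isCont_def by (rule tendsto_within_subset) simp
        have "0 \<le> \<beta> * v n x - green_half_plane x z"
        proof (cases "Im x = 0")
          case True
          thus ?thesis using green_half_plane_real_eq_0[OF True] v0[of n x] \<beta> by simp
        next
          case False
          hence "x \<in> upper_half_plane" using frD(1)[OF x] by (simp add: upper_half_plane_def)
          thus ?thesis using dn[OF _ frD(2)[OF x], of n] by simp
        qed
        hence "\<forall>\<^sub>F y in at x within D. - \<eta> < \<beta> * v n y - green_half_plane y z"
          using \<eta> by (intro order_tendstoD(1)[OF lim]) linarith
        moreover have "\<forall>\<^sub>F y in at x within D. y \<in> D" by (auto simp: eventually_at_filter)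
        moreover have "\<forall>\<^sub>F y in at x within D. y \<noteq> z"
          using tendsto_imp_eventually_ne[OF tendsto_ident_at xz] .
        ultimately show ?thesis by eventually_elim (use ge in force)
      qed
      have "\<forall>\<^sub>F y :: complex in at_infinity. y \<noteq> z"
        unfolding eventually_at_infinity by (intro exI[of _ "cmod z + 1"]) auto
      thus "\<forall>\<^sub>F w in at_infinity. w \<in> D \<longrightarrow> - \<eta> < (h w - L w) + \<beta> * v n w"
        using green_half_plane_eventually_small[OF zH \<eta>]
      proof eventually_elim
        case (elim y)
        show ?case
        proof
          assume y: "y \<in> D"
          have "0 \<le> \<beta> * v n y" using \<beta> v0[of n y] by simp
          thus "- \<eta> < (h y - L y) + \<beta> * v n y" using ge[OF y elim(1)] elim(2) y DH by fastforce
        qed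
      qed
    qed
    have "(\<lambda>n. (h w - L w) + \<beta> * v n w) \<longlonglongrightarrow> (h w - L w) + \<beta> * V w"
      using D(3) w by (intro tendsto_intros lim) auto
    hence "0 \<le> (h w - L w) + \<beta> * V w" by (rule LIMSEQ_le_const) (use nonneg in auto)
    thus ?thesis by simp
  qed
  define m where "m = (INF h\<in>Hs. h z)"
  have bdd: "bdd_below ((\<lambda>h. h z) ` Hs)" using hlow[OF _ D(2)] by (intro bdd_belowI2) auto
  have m1: "m \<le> L z - \<alpha> * V z" unfolding m_def by (rule cINF_lower[OF bdd h0])
  have m2: "L z - \<beta> * V z \<le> m" unfolding m_def
    using h0 hlow[OF _ D(2)] by (intro cINF_greatest) auto
  have green: "((\<lambda>w. green_function D w z + ln (cmod (w - z))) \<longlongrightarrow> m) (at z)"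
  proof -
    obtain s where s: "s > 0" "cball z s \<subseteq> D" using D open_contains_cball by blast
    \<comment> \<open>On the circle of radius s nonnegativity of the competitor reads ln s \<le> h.
      Harnack's inequality for h - ln s then has the same constants for all \<open>h\<close>, and
      therefore survives the infimum over \<open>Hs\<close>.\<close>
    have Harn: "(s - dist z w) / (s + dist z w) * (h z - ln s) \<le> h w - ln s"
        "h w - ln s \<le> (s + dist z w) / (s - dist z w) * (h z - ln s)"
      if h: "h \<in> Hs" and w: "w \<in> ball z s" for h w
    proof -
      have hh: "locally_Re_holomorphic h D" and hp: "\<And>w. w \<in> D \<Longrightarrow> w \<noteq> z \<Longrightarrow> 0 \<le> pole h w"
        using h by (auto simp: Hs_def)
      have "locally_Re_holomorphic (\<lambda>w. ln s) D"
        by (rule locally_Re_holomorphicI[of _ "\<lambda>_. of_real (ln s)"]) (use D in auto)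
      hence hs: "locally_Re_holomorphic (\<lambda>w. h w - ln s) D"
        by (intro locally_Re_holomorphic_diff hh)
      have "0 \<le> h \<zeta> - ln s" if "\<zeta> \<in> sphere z s" for \<zeta>
      proof -
        have "\<zeta> \<in> D" "\<zeta> \<noteq> z" "cmod (\<zeta> - z) = s" using that s by (auto simp: dist_norm norm_minus_commute)
        thus ?thesis using hp[of \<zeta>] by (simp add: pole_def)
      qed
      from Harnack_ball[OF hs s(2) w this]
      show "(s - dist z w) / (s + dist z w) * (h z - ln s) \<le> h w - ln s"
        "h w - ln s \<le> (s + dist z w) / (s - dist z w) * (h z - ln s)" by auto
    qed
    have hz: "m \<le> h z" if "h \<in> Hs" for h unfolding m_def by (rule cINF_lower[OF bdd that])
    have lower: "ln s + (s - dist z w) / (s + dist z w) * (m - ln s) \<le> green_function D w z + ln (cmod (w - z))"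
      if w: "w \<in> ball z s" "w \<noteq> z" for w
    proof -
      have wD: "w \<in> D" using w s by auto
      have "ln s + (s - dist z w) / (s + dist z w) * (m - ln s) - ln (cmod (w - z)) \<le> green_function D w z"
        unfolding green_function_def
      proof (rule cINF_greatest)
        show "log_pole_majorants D z \<noteq> {}" using maj[OF h0] by blast
        fix u assume "u \<in> log_pole_majorants D z"
        then obtain h where h: "h \<in> Hs" "u w = pole h w" using maj_ex wD w(2) by blast
        have "(s - dist z w) / (s + dist z w) * (m - ln s) \<le> (s - dist z w) / (s + dist z w) * (h z - ln s)"
          using hz[OF h(1)] w s by (intro mult_left_mono) auto
        also have "\<dots> \<le> h w - ln s" by (rule Harn(1)[OF h(1) w(1)])
        finally show "ln s + (s - dist z w) / (s + dist z w) * (m - ln s) - ln (cmod (w - z)) \<le> u w"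
          by (simp add: h(2) pole_def)
      qed
      thus ?thesis by simp
    qed
    have upper: "green_function D w z + ln (cmod (w - z)) \<le> ln s + (s + dist z w) / (s - dist z w) * (m - ln s)"
      if w: "w \<in> ball z s" "w \<noteq> z" for w
    proof -
      have wD: "w \<in> D" using w s by auto
      define c where "c = (s + dist z w) / (s - dist z w)"
      have c: "c > 0" unfolding c_def using w s by (intro divide_pos_pos add_pos_nonneg) auto
      define g where "g = green_function D w z + ln (cmod (w - z))"
      \<comment> \<open>Solved for the bound on \<open>h z\<close>, so that the infimum over
        \<open>h\<close> can be taken; this uses that c is positive.\<close>
      have "(g - ln s) / c + ln s \<le> m"
        unfolding m_def
      proof (rule cINF_greatest)
        show "Hs \<noteq> {}" using h0 by blast
        fix h assume h: "h \<in> Hs"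
        have "green_function D w z \<le> pole h w"
          unfolding green_function_def
        proof (rule cINF_lower[OF _ maj[OF h]])
          show "bdd_below ((\<lambda>u. u w) ` log_pole_majorants D z)"
            using wD w(2) by (intro bdd_belowI2[of _ 0]) (auto simp: log_pole_majorants_def)
        qed
        hence "g - ln s \<le> c * (h z - ln s)" using Harn(2)[OF h w(1)] by (simp add: g_def pole_def c_def)
        hence "(g - ln s) / c \<le> h z - ln s" using c by (simp add: pos_divide_le_eq mult.commute)
        thus "(g - ln s) / c + ln s \<le> h z" by simp
      qed
      hence "(g - ln s) / c \<le> m - ln s" by simp
      hence "g - ln s \<le> c * (m - ln s)" using c by (simp add: pos_divide_le_eq mult.commute)
      thus ?thesis by (simp add: g_def c_def)
    qed
    have "s \<noteq> 0" using s by simp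
    have near: "\<forall>\<^sub>F w in at z. w \<in> ball z s \<and> w \<noteq> z"
      using eventually_at_ball[OF s(1), of z UNIV] by (simp add: eventually_at_filter)
    have "((\<lambda>w. ln s + (s - dist z w) / (s + dist z w) * (m - ln s)) \<longlongrightarrow>
        ln s + (s - dist z z) / (s + dist z z) * (m - ln s)) (at z)"
      using s by (intro tendsto_intros) auto
    hence t1: "((\<lambda>w. ln s + (s - dist z w) / (s + dist z w) * (m - ln s)) \<longlongrightarrow> m) (at z)"
      using s by simp
    have "((\<lambda>w. ln s + (s + dist z w) / (s - dist z w) * (m - ln s)) \<longlongrightarrow>
        ln s + (s + dist z z) / (s - dist z z) * (m - ln s)) (at z)"
      using s by (intro tendsto_intros) auto
    hence t2: "((\<lambda>w. ln s + (s + dist z w) / (s - dist z w) * (m - ln s)) \<longlongrightarrow> m) (at z)"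
      using s by simp
    show ?thesis
      by (rule tendsto_sandwich[OF _ _ t1 t2]; rule eventually_mono[OF near]) (use lower upper in auto)
  qed
  hence ir: "inner_radius G z = exp m"
    unfolding inner_radius_def D_def by (subst tendsto_Lim) auto
  have "exp (L z - c) = 2 * Im z * exp (- c)" for c
    using Imz by (simp add: Lz exp_diff exp_minus divide_inverse)
  thus "2 * Im z * exp (- \<beta> * V z) \<le> inner_radius G z"
    "inner_radius G z \<le> 2 * Im z * exp (- \<alpha> * V z)"
    using m1 m2 unfolding ir by (metis exp_le_cancel_iff mult_minus_left)+
qed

text \<open>The case of empty \<open>E\<close>: with V = 0 and \<alpha> = \<beta> = 0 the two bounds
  coincide.\<close>

lemma inner_radius_upper_half_plane:
  assumes z: "z \<in> upper_half_plane"
  shows "inner_radius upper_half_plane z = 2 * Im z"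
proof -
  have zero: "locally_Re_holomorphic (\<lambda>_. 0) upper_half_plane"
    by (rule locally_Re_holomorphicI[of _ "\<lambda>_. 0"]) (auto intro: open_upper_half_plane)
  note b = inner_radius_bounds[OF open_upper_half_plane subset_refl z zero, of "\<lambda>_ _. 0" 0 0]
  have "2 * Im z * exp (- 0 * 0) \<le> inner_radius upper_half_plane z"
    by (rule b(1)) (use green_half_plane_bounds(3)[OF _ z] locally_Re_holomorphic_imp_supermean[OF zero] in auto)
  moreover have "inner_radius upper_half_plane z \<le> 2 * Im z * exp (- 0 * 0)"
    by (rule b(2)) (use green_half_plane_bounds(3)[OF _ z] locally_Re_holomorphic_imp_supermean[OF zero] in auto)
  ultimately show ?thesis by simp
qed

section \<open>The expected exit height\<close>

text \<open>On the upper half-plane this is the height inside the disc of radius \<open>R\<close>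
  and its Kelvin transform Im w R^2 / |w|^2 outside. It is bounded and decays at infinity, yet
  agrees with the height on any part of the half-plane inside the disc.\<close>

definition cutoff_height :: "real \<Rightarrow> complex \<Rightarrow> real" where
  "cutoff_height R w = max 0 (Im w) * (R / max R (cmod w))\<^sup>2"

lemma cutoff_height_nonneg: "0 \<le> cutoff_height R w"
  by (simp add: cutoff_height_def)

lemma cutoff_height_inside: "0 < R \<Longrightarrow> cmod w \<le> R \<Longrightarrow> cutoff_height R w = max 0 (Im w)"
  by (simp add: cutoff_height_def max_absorb1)

lemma cutoff_height_outside: "R \<le> cmod w \<Longrightarrow> cutoff_height R w = max 0 (Im w) * R\<^sup>2 / (cmod w)\<^sup>2"
  by (simp add: cutoff_height_def max_absorb2 power_divide)

lemma cutoff_height_eq_0: "Im w \<le> 0 \<Longrightarrow> cutoff_height R w = 0"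
  by (simp add: cutoff_height_def)

lemma continuous_on_cutoff_height:
  assumes "0 < R"
  shows "continuous_on UNIV (cutoff_height R)"
  unfolding cutoff_height_def[abs_def]
  using assms by (intro continuous_intros ballI) (auto simp: max_def)

lemma cutoff_height_outside_le:
  assumes "0 < R" "R \<le> cmod w"
  shows "cutoff_height R w \<le> R\<^sup>2 / cmod w"
proof -
  have "max 0 (Im w) \<le> cmod w" using abs_Im_le_cmod[of w] by simp
  hence "max 0 (Im w) * R\<^sup>2 / (cmod w)\<^sup>2 \<le> cmod w * R\<^sup>2 / (cmod w)\<^sup>2"
    by (intro divide_right_mono mult_right_mono) auto
  moreover have "w \<noteq> 0" using assms by auto
  ultimately show ?thesis using assms by (simp add: cutoff_height_outside power2_eq_square)
qed

lemma cutoff_height_le: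
  assumes "0 < R"
  shows "cutoff_height R w \<le> R"
proof (cases "cmod w \<le> R")
  case True
  thus ?thesis using abs_Im_le_cmod[of w] assms by (simp add: cutoff_height_inside)
next
  case False
  have "cutoff_height R w \<le> R\<^sup>2 / cmod w" using False assms by (intro cutoff_height_outside_le) auto
  also have "\<dots> \<le> R\<^sup>2 / R" using False assms by (intro divide_left_mono mult_pos_pos) auto
  finally show ?thesis using assms by (simp add: power2_eq_square)
qed

lemma cutoff_height_tendsto_0:
  assumes "0 < R"
  shows "(cutoff_height R \<longlongrightarrow> 0) at_infinity"
proof (rule tendsto_sandwich[of "\<lambda>_. 0" _ _ "\<lambda>w. R\<^sup>2 / cmod w"])
  show "\<forall>\<^sub>F w in at_infinity. cutoff_height R w \<le> R\<^sup>2 / cmod w"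
    unfolding eventually_at_infinity using cutoff_height_outside_le[OF assms] by blast
  show "((\<lambda>w. R\<^sup>2 / cmod w) \<longlongrightarrow> 0) at_infinity"
    by (intro tendsto_divide_0[OF tendsto_const] filterlim_at_top_imp_at_infinity filterlim_norm_at_top)
qed (simp_all add: cutoff_height_nonneg)

text \<open>On the upper half-plane it is the smaller of two harmonic functions, the height and its
  inversion in the circle of radius \<open>R\<close>.\<close>

lemma supermean_on_cutoff_height:
  assumes R: "0 < R"
  shows "supermean_on (cutoff_height R) upper_half_plane"
proof -
  have 1: "supermean_on Im upper_half_plane"
    by (intro locally_Re_holomorphic_imp_supermean
        locally_Re_holomorphicI[OF open_upper_half_plane, of "\<lambda>w. - \<i> * w"] holomorphic_intros) simp
  have Im_div: "Re (of_real (R\<^sup>2) * \<i> / w) = Im w * R\<^sup>2 / (cmod w)\<^sup>2" for w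
    by (simp add: complex_div_cnj[of _ w] del: of_real_power)
  have 2: "supermean_on (\<lambda>w. Im w * R\<^sup>2 / (cmod w)\<^sup>2) upper_half_plane"
    by (intro locally_Re_holomorphic_imp_supermean
        locally_Re_holomorphicI[OF open_upper_half_plane, of "\<lambda>w. of_real (R\<^sup>2) * \<i> / w"] holomorphic_intros)
       (auto simp: upper_half_plane_def Im_div simp del: of_real_power)
  have eq: "cutoff_height R w = min (Im w) (Im w * R\<^sup>2 / (cmod w)\<^sup>2)" if "w \<in> upper_half_plane" for w
  proof -
    have im: "0 < Im w" using that by (simp add: upper_half_plane_def)
    hence w0: "0 < cmod w" by (metis norm_ge_zero order_less_le norm_eq_zero zero_complex.sel(2) less_irrefl)
    show ?thesis
    proof (cases "cmod w \<le> R")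
      case True
      hence "(cmod w)\<^sup>2 \<le> R\<^sup>2" by (intro power_mono) auto
      hence "Im w * (cmod w)\<^sup>2 \<le> Im w * R\<^sup>2" using im by (intro mult_left_mono) auto
      hence "Im w \<le> Im w * R\<^sup>2 / (cmod w)\<^sup>2" using w0 by (simp add: pos_le_divide_eq)
      thus ?thesis using True R im by (simp add: cutoff_height_inside)
    next
      case False
      hence "R\<^sup>2 \<le> (cmod w)\<^sup>2" using R by (intro power_mono) auto
      hence "Im w * R\<^sup>2 \<le> Im w * (cmod w)\<^sup>2" using im by (intro mult_left_mono) auto
      hence "Im w * R\<^sup>2 / (cmod w)\<^sup>2 \<le> Im w" using w0 by (simp add: pos_divide_le_eq)
      thus ?thesis using False R im by (simp add: cutoff_height_outside)
    qed
  qed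
  have m: "supermean_on (\<lambda>w. min (Im w) (Im w * R\<^sup>2 / (cmod w)\<^sup>2)) upper_half_plane"
    by (rule supermean_on_min[OF 1 2])
  show ?thesis
    unfolding supermean_on_def
  proof (intro conjI ballI)
    show "continuous_on upper_half_plane (cutoff_height R)"
      using continuous_on_cutoff_height[OF R] continuous_on_subset by blast
    fix a assume a: "a \<in> upper_half_plane"
    obtain \<rho> where \<rho>: "\<rho> > 0" "ball a \<rho> \<subseteq> upper_half_plane"
      "\<And>r. 0 < r \<Longrightarrow> r < \<rho> \<Longrightarrow> circle_mean (\<lambda>w. min (Im w) (Im w * R\<^sup>2 / (cmod w)\<^sup>2)) a r \<le> min (Im a) (Im a * R\<^sup>2 / (cmod a)\<^sup>2)"
      using supermean_onE[OF m a] by blast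
    have "circle_mean (cutoff_height R) a r \<le> cutoff_height R a" if r: "0 < r" "r < \<rho>" for r
    proof -
      have "circle_mean (cutoff_height R) a r = circle_mean (\<lambda>w. min (Im w) (Im w * R\<^sup>2 / (cmod w)\<^sup>2)) a r"
      proof (rule circle_mean_cong)
        fix w assume "w \<in> sphere a r"
        hence "w \<in> upper_half_plane" using \<rho>(2) r sphere_subset_ball[of r \<rho> a] by blast
        thus "cutoff_height R w = min (Im w) (Im w * R\<^sup>2 / (cmod w)\<^sup>2)" by (rule eq)
      qed (use r in simp)
      thus ?thesis using \<rho>(3)[OF r] eq[OF a] by simp
    qed
    thus "\<exists>\<rho>>0. ball a \<rho> \<subseteq> upper_half_plane \<and> (\<forall>r. 0 < r \<and> r < \<rho> \<longrightarrow> circle_mean (cutoff_height R) a r \<le> cutoff_height R a)"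
      using \<rho> by blast
  qed
qed

section \<open>Exit from a subset of the half-plane\<close>

lemma open_half_plane_minus:
  assumes "closedin (top_of_set upper_half_plane) E"
  shows "open (upper_half_plane - E)"
proof -
  obtain C where "closed C" "E = upper_half_plane \<inter> C" using assms by (auto simp: closedin_closed)
  hence "upper_half_plane - E = upper_half_plane \<inter> (- C)" "open (- C)" by auto
  thus ?thesis using open_upper_half_plane by auto
qed

text \<open>Up to the exit the path is in the half-plane, so by continuity its height at the exit is
  at least 0. The default value 0 of \<open>exit_position\<close> has both properties as
  well.\<close>

lemma exit_position_half_plane:
  assumes bm: "planar_brownian_motion z M B" and G: "open G" "G \<subseteq> upper_half_plane" and z: "z \<in> G"
    and \<omega>: "\<omega> \<in> space M"
  shows "exit_position G B \<omega> \<notin> G" "0 \<le> Im (exit_position G B \<omega>)"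
proof -
  note bmD = planar_brownian_motionD[OF bm]
  have "exit_position G B \<omega> \<notin> G \<and> 0 \<le> Im (exit_position G B \<omega>)"
  proof (cases "\<exists>t\<ge>0. B t \<omega> \<notin> G")
    case True
    then obtain t where t: "0 \<le> t" "B t \<omega> \<notin> G" by blast
    define \<tau> where "\<tau> = Inf {t. 0 \<le> t \<and> B t \<omega> \<notin> G}"
    note fe = first_exit[OF bmD(4)[OF \<omega>] G(1) t, folded \<tau>_def]
    have ep: "exit_position G B \<omega> = B \<tau> \<omega>" using True by (simp add: exit_position_def \<tau>_def)
    have "\<tau> \<noteq> 0" using fe(3) bmD(3)[OF \<omega>] z by auto
    hence \<tau>: "0 < \<tau>" using fe(1) by simp
    have "0 \<le> Im (B \<tau> \<omega>)"
    proof (rule ccontr)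
      assume neg: "\<not> 0 \<le> Im (B \<tau> \<omega>)"
      obtain d where d: "d > 0" "\<And>x. 0 \<le> x \<Longrightarrow> dist x \<tau> < d \<Longrightarrow> dist (B x \<omega>) (B \<tau> \<omega>) < - Im (B \<tau> \<omega>)"
        using bmD(4)[OF \<omega>] fe(1) neg unfolding continuous_on_iff
        by (metis atLeast_iff neg_0_less_iff_less not_le)
      define x where "x = max 0 (\<tau> - d / 2)"
      have x: "0 \<le> x" "x < \<tau>" "dist x \<tau> < d" using \<tau> d(1) by (auto simp: x_def dist_real_def)
      have "B x \<omega> \<in> upper_half_plane" using fe(4)[OF x(1,2)] G(2) by blast
      hence "0 < Im (B x \<omega>)" by (simp add: upper_half_plane_def)
      moreover have "\<bar>Im (B x \<omega> - B \<tau> \<omega>)\<bar> < - Im (B \<tau> \<omega>)"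
        using d(2)[OF x(1,3)] abs_Im_le_cmod[of "B x \<omega> - B \<tau> \<omega>"] by (simp add: dist_norm)
      ultimately show False by simp
    qed
    thus ?thesis using fe(3) by (simp add: ep)
  next
    case False
    hence "exit_position G B \<omega> = 0" by (simp only: exit_position_def if_False)
    thus ?thesis using G(2) by (auto simp: upper_half_plane_def)
  qed
  thus "exit_position G B \<omega> \<notin> G" "0 \<le> Im (exit_position G B \<omega>)" by auto
qed

text \<open>The cutoff changes the height neither on \<open>E\<close> nor on the real axis, hence at no possible exit
  point.\<close>

theorem expected_exit_height:
  assumes bm: "planar_brownian_motion z M B" and R: "0 < R"
    and G: "open G" "G \<subseteq> upper_half_plane" and z: "z \<in> G"
    and E: "\<And>w. w \<in> upper_half_plane \<Longrightarrow> w \<notin> G \<Longrightarrow> cmod w \<le> R"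
    and cv: "\<And>n::nat. continuous_on UNIV (v n)" and smv: "\<And>n. supermean_on (v n) G"
    and v0: "\<And>n w. 0 \<le> v n w" and vle: "\<And>n w. v n w \<le> cutoff_height R w"
    and voff: "\<And>n w. w \<notin> G \<Longrightarrow> v n w = cutoff_height R w"
    and lim: "\<And>w. (\<lambda>n. v n w) \<longlonglongrightarrow> V w"
    and V: "locally_Re_holomorphic V G"
  shows "(\<integral>\<omega>. Im (exit_position G B \<omega>) \<partial>M) = V z"
proof -
  have "0 \<notin> G" using G(2) by (auto simp: upper_half_plane_def)
  hence GU: "G \<noteq> UNIV" by blast
  have exit: "cutoff_height R (exit_position G B \<omega>) = Im (exit_position G B \<omega>)"
    "v n (exit_position G B \<omega>) = Im (exit_position G B \<omega>)" if "\<omega> \<in> space M" for \<omega> n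
  proof -
    define p where "p = exit_position G B \<omega>"
    have p: "p \<notin> G" "0 \<le> Im p" using exit_position_half_plane[OF bm G z that] by (auto simp: p_def)
    have "cutoff_height R p = Im p"
    proof (cases "Im p = 0")
      case True
      thus ?thesis by (simp add: cutoff_height_eq_0)
    next
      case False
      hence "cmod p \<le> R" using p by (intro E) (auto simp: upper_half_plane_def)
      thus ?thesis using R p by (simp add: cutoff_height_inside)
    qed
    thus "cutoff_height R (exit_position G B \<omega>) = Im (exit_position G B \<omega>)"
      "v n (exit_position G B \<omega>) = Im (exit_position G B \<omega>)"
      using voff[OF p(1)] by (simp_all add: p_def)
  qed
  have vb: "\<bar>v n w\<bar> \<le> R" for n w using v0[of n w] vle[of n w] cutoff_height_le[OF R, of w] by simp
  have Vle: "V w \<le> cutoff_height R w" for w using lim[of w] vle by (intro LIMSEQ_le_const2) auto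
  have V0: "0 \<le> V w" for w using lim[of w] v0 by (intro LIMSEQ_le_const) auto
  have vm: "v n \<in> borel_measurable borel" for n by (rule borel_measurable_continuous_onI[OF cv])
  have Vm: "V \<in> borel_measurable borel" by (rule borel_measurable_LIMSEQ_real[OF lim vm])
  \<comment> \<open>From above: \<open>v n\<close> is continuous on the whole plane and serves both
    as \<open>f\<close> and as \<open>g\<close>.\<close>
  have upper: "(\<integral>\<omega>. Im (exit_position G B \<omega>) \<partial>M) \<le> v n z" for n
  proof -
    have "v n 0 = 0" using v0[of n 0] vle[of n 0] cutoff_height_eq_0[of 0 R] by simp
    moreover have "(v n \<longlongrightarrow> 0) at_infinity"
      by (rule tendsto_sandwich[OF _ _ tendsto_const cutoff_height_tendsto_0[OF R]]) (auto simp: v0 vle)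
    ultimately have "(\<integral>\<omega>. v n (exit_position G B \<omega>) \<partial>M) \<le> v n z"
      by (intro brownian_exit_le[OF bm G(1) GU vm vb smv cv vb]) auto
    moreover have "(\<integral>\<omega>. v n (exit_position G B \<omega>) \<partial>M) = (\<integral>\<omega>. Im (exit_position G B \<omega>) \<partial>M)"
      by (intro Bochner_Integration.integral_cong refl exit)
    ultimately show ?thesis by simp
  qed
  \<comment> \<open>From below: -V is harmonic on \<open>G\<close> but perhaps discontinuous at its
    boundary, so the continuous minorant is minus the truncated height, which equals minus the
    height at every exit point.\<close>
  have "(\<integral>\<omega>. - cutoff_height R (exit_position G B \<omega>) \<partial>M) \<le> - V z"
  proof (rule brownian_exit_le[OF bm G(1) GU, where C = R])
    show "(\<lambda>w. - V w) \<in> borel_measurable borel" using Vm by simp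
    show "supermean_on (\<lambda>w. - V w) G"
      by (intro locally_Re_holomorphic_imp_supermean locally_Re_holomorphic_uminus V)
    show "continuous_on UNIV (\<lambda>w. - cutoff_height R w)"
      by (intro continuous_intros continuous_on_cutoff_height R)
    show "((\<lambda>w. - cutoff_height R w) \<longlongrightarrow> 0) at_infinity"
      using tendsto_minus[OF cutoff_height_tendsto_0[OF R]] by simp
    show "\<bar>- V w\<bar> \<le> R" for w using V0[of w] Vle[of w] cutoff_height_le[OF R, of w] by simp
    show "\<bar>- cutoff_height R w\<bar> \<le> R" for w
      using cutoff_height_nonneg[of R w] cutoff_height_le[OF R, of w] by simp
  qed (simp_all add: Vle cutoff_height_eq_0)
  moreover have "(\<integral>\<omega>. - cutoff_height R (exit_position G B \<omega>) \<partial>M) = (\<integral>\<omega>. - Im (exit_position G B \<omega>) \<partial>M)"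
    by (intro Bochner_Integration.integral_cong refl) (simp add: exit)
  ultimately have lower: "V z \<le> (\<integral>\<omega>. Im (exit_position G B \<omega>) \<partial>M)" by simp
  have "(\<integral>\<omega>. Im (exit_position G B \<omega>) \<partial>M) \<le> V z"
    by (rule LIMSEQ_le_const[OF lim]) (use upper in auto)
  with lower show ?thesis by simp
qed

text \<open>The minimum principle for the difference. Near the frontier of \<open>G\<close> and at
  infinity \<open>V\<close> is replaced by its continuous majorant, the truncated height; at
  \<open>z\<close> the pole outweighs the bounded function.\<close>

lemma multiple_le_green_half_plane:
  assumes G: "open G" "G \<subseteq> upper_half_plane" and z: "z \<in> G" and R: "0 < R"
    and V: "locally_Re_holomorphic V G" and Vle: "\<And>w. V w \<le> cutoff_height R w"
    and E: "\<And>w. w \<in> upper_half_plane \<Longrightarrow> w \<notin> G \<Longrightarrow> cmod w \<le> R \<and> \<alpha> * Im w \<le> green_half_plane w z"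
    and \<alpha>: "0 \<le> \<alpha>" and w: "w \<in> G" "w \<noteq> z"
  shows "\<alpha> * V w \<le> green_half_plane w z"
proof -
  have zH: "z \<in> upper_half_plane" using z G by blast
  define q where "q w = green_half_plane w z + - (\<alpha> * V w)" for w
  define Q where "Q w = green_half_plane w z - \<alpha> * cutoff_height R w" for w
  have qQ: "Q w \<le> q w" for w using mult_left_mono[OF Vle[of w] \<alpha>] by (simp add: q_def Q_def)
  have D: "open (G - {z})" using G(1) by auto
  have "supermean_on q (G - {z})"
    unfolding q_def
    by (intro locally_Re_holomorphic_imp_supermean locally_Re_holomorphic_add locally_Re_holomorphic_uminus
          locally_Re_holomorphic_cmult locally_Re_holomorphic_subset[OF V D]
          locally_Re_holomorphic_subset[OF locally_Re_holomorphic_green_half_plane[OF zH] D])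
       (use G(2) in auto)
  hence "0 \<le> q w"
  proof (rule minimum_principle_boundary)
    fix \<eta> :: real assume \<eta>: "\<eta> > 0"
    show "\<forall>\<^sub>F w in at x within G - {z}. - \<eta> < q w" if x: "x \<in> frontier (G - {z})" for x
    proof (cases "x = z")
      case True
      have "\<forall>\<^sub>F w in at z. \<alpha> * R \<le> green_half_plane w z"
        using green_half_plane_at_top[OF zH] by (simp add: filterlim_at_top)
      hence "\<forall>\<^sub>F w in at z. - \<eta> < q w"
      proof eventually_elim
        case (elim w)
        have "\<alpha> * cutoff_height R w \<le> \<alpha> * R" by (intro mult_left_mono cutoff_height_le R \<alpha>)
        thus ?case using elim qQ[of w] \<eta> by (simp add: Q_def)
      qed
      thus ?thesis using True by (auto simp: eventually_at_filter elim: eventually_mono)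
    next
      case False
      have "x \<in> closure (G - {z})" using x by (simp add: frontier_def)
      hence im: "0 \<le> Im x" by (rule Im_nonneg_closure[rotated]) (use G in auto)
      have "x \<notin> G" using x D False by (auto simp: frontier_def interior_open)
      have xc: "x \<noteq> cnj z" using im zH cnj_notin_closed_upper by blast
      have "isCont (cutoff_height R) x"
        using continuous_on_cutoff_height[OF R] by (simp add: continuous_on_eq_continuous_at)
      hence "isCont Q x" unfolding Q_def[abs_def]
        using isCont_green_half_plane[OF False xc] by (intro continuous_intros)
      hence lim: "(Q \<longlongrightarrow> Q x) (at x within G - {z})"
        unfolding isCont_def by (rule tendsto_within_subset) simp
      have "0 \<le> Q x"
      proof (cases "Im x = 0")
        case True
        thus ?thesis using green_half_plane_real_eq_0[OF True] by (simp add: Q_def cutoff_height_eq_0)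
      next
        case False
        hence "x \<in> upper_half_plane" using im by (simp add: upper_half_plane_def)
        from E[OF this \<open>x \<notin> G\<close>] show ?thesis using R im by (simp add: Q_def cutoff_height_inside)
      qed
      hence "\<forall>\<^sub>F y in at x within G - {z}. - \<eta> < Q y"
        using \<eta> by (intro order_tendstoD(1)[OF lim]) linarith
      thus ?thesis by eventually_elim (use qQ le_less_trans less_le_trans in blast)
    qed
    have "((\<lambda>w. \<alpha> * cutoff_height R w) \<longlongrightarrow> \<alpha> * 0) at_infinity"
      by (intro tendsto_intros cutoff_height_tendsto_0 R)
    hence "\<forall>\<^sub>F w in at_infinity. \<alpha> * cutoff_height R w < \<eta>"
      by (rule order_tendstoD(2)) (use \<eta> in simp)
    thus "\<forall>\<^sub>F w in at_infinity. w \<in> G - {z} \<longrightarrow> - \<eta> < q w"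
    proof eventually_elim
      case (elim w)
      show ?case
      proof
        assume "w \<in> G - {z}"
        hence "0 \<le> green_half_plane w z" using G(2) by (intro green_half_plane_bounds(3) zH) auto
        thus "- \<eta> < q w" using elim qQ[of w] by (simp add: Q_def)
      qed
    qed
  qed (use w in simp)
  thus ?thesis by (simp add: q_def)
qed

section \<open>Expansion at infinity\<close>

lemma locally_Re_holomorphic_compose:
  assumes u: "locally_Re_holomorphic u S" and T: "open T" and \<phi>: "\<phi> holomorphic_on T" "\<phi> ` T \<subseteq> S"
  shows "locally_Re_holomorphic (\<lambda>w. u (\<phi> w)) T"
proof (rule locally_Re_holomorphicI_local)
  fix a assume a: "a \<in> T"
  hence "\<phi> a \<in> S" using \<phi>(2) by blast
  then obtain \<rho> F where F: "\<rho> > 0" "ball (\<phi> a) \<rho> \<subseteq> S" "F holomorphic_on ball (\<phi> a) \<rho>"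
    "\<And>w. w \<in> ball (\<phi> a) \<rho> \<Longrightarrow> u w = Re (F w)"
    using locally_Re_holomorphicE[OF u] by blast
  define W where "W = T \<inter> \<phi> -` ball (\<phi> a) \<rho>"
  have W: "open W" unfolding W_def
    by (rule continuous_open_preimage[OF holomorphic_on_imp_continuous_on[OF \<phi>(1)] T open_ball])
  have "locally_Re_holomorphic (\<lambda>w. u (\<phi> w)) W"
  proof (rule locally_Re_holomorphicI[OF W])
    have "(F \<circ> \<phi>) holomorphic_on W"
      by (rule holomorphic_on_compose_gen[OF holomorphic_on_subset[OF \<phi>(1)] F(3)]) (auto simp: W_def)
    thus "(\<lambda>w. F (\<phi> w)) holomorphic_on W" by (simp add: o_def)
  qed (auto simp: W_def F(4))
  thus "\<exists>T'. a \<in> T' \<and> T' \<subseteq> T \<and> locally_Re_holomorphic (\<lambda>w. u (\<phi> w)) T'"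
    using a F(1) by (intro exI[of _ W]) (auto simp: W_def)
qed

text \<open>The function cnj (F (cnj w)) is holomorphic and has the same real part as F (cnj
  w).\<close>

lemma locally_Re_holomorphic_cnj:
  assumes u: "locally_Re_holomorphic u S"
  shows "locally_Re_holomorphic (\<lambda>w. u (cnj w)) (cnj ` S)"
proof (rule locally_Re_holomorphicI_local)
  fix a assume "a \<in> cnj ` S"
  hence "cnj a \<in> S" by auto
  then obtain \<rho> F where F: "\<rho> > 0" "ball (cnj a) \<rho> \<subseteq> S" "F holomorphic_on ball (cnj a) \<rho>"
    "\<And>w. w \<in> ball (cnj a) \<rho> \<Longrightarrow> u w = Re (F w)"
    using locally_Re_holomorphicE[OF u] by blast
  have img: "cnj ` ball a \<rho> = ball (cnj a) \<rho>"
  proof (intro equalityI subsetI)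
    fix x assume "x \<in> ball (cnj a) \<rho>"
    hence "cnj x \<in> ball a \<rho>" by (metis complex_cnj_cnj complex_cnj_diff complex_mod_cnj dist_norm mem_ball)
    thus "x \<in> cnj ` ball a \<rho>" by (metis complex_cnj_cnj imageI)
  qed (auto simp: dist_norm simp flip: complex_cnj_diff)
  have "locally_Re_holomorphic (\<lambda>w. u (cnj w)) (ball a \<rho>)"
  proof (rule locally_Re_holomorphicI[of _ "cnj \<circ> F \<circ> cnj"])
    show "(cnj \<circ> F \<circ> cnj) holomorphic_on ball a \<rho>"
      using F(3) by (intro holomorphic_on_compose_cnj_cnj) (auto simp: img)
    fix w assume "w \<in> ball a \<rho>"
    hence "cnj w \<in> ball (cnj a) \<rho>" using img by blast
    thus "u (cnj w) = Re ((cnj \<circ> F \<circ> cnj) w)" using F(4) by simp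
  qed simp
  moreover have "ball a \<rho> \<subseteq> cnj ` S"
  proof
    fix x assume "x \<in> ball a \<rho>"
    hence "cnj x \<in> S" using img F(2) by blast
    thus "x \<in> cnj ` S" by (metis complex_cnj_cnj imageI)
  qed
  ultimately show "\<exists>T. a \<in> T \<and> T \<subseteq> cnj ` S \<and> locally_Re_holomorphic (\<lambda>w. u (cnj w)) T"
    using F(1) by (intro exI[of _ "ball a \<rho>"]) auto
qed

text \<open>A circle around a real point is symmetric in the real axis, and the parameters t and -t
  contribute with opposite signs.\<close>

lemma circle_mean_odd:
  assumes odd: "\<And>w. f (cnj w) = - f w" and x: "Im x = 0" and r: "0 \<le> r"
    and cont: "continuous_on (sphere x r) f"
  shows "circle_mean f x r = 0"
proof -
  define g where "g t = f (circlepath x r t)" for t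
  have cg: "continuous_on S g" for S unfolding g_def by (rule continuous_on_compose_circlepath[OF cont r])
  have "circlepath x r (- t) = cnj (circlepath x r t)" for t
    using x by (simp add: circlepath exp_cnj complex_eq_iff[of x "cnj x"])
  hence g: "g (- t) = - g t" for t using odd by (simp add: g_def)
  have per: "g (t + - 1) = g t" for t using circlepath_add1[of x r "t - 1"] by (simp add: g_def)
  have "integral {0..1} g = integral {-1..0} (\<lambda>t. g (- t))"
    using Henstock_Kurzweil_Integration.integral_reflect_real[of 1 0 g] by simp
  also have "\<dots> = - integral {-1..0} g" by (simp add: g)
  also have "integral {-1..0} g = integral {0..1} (g \<circ> (\<lambda>t. t + - 1))"
    using integral_shift[OF cg, of 0 1 "-1"] by simp
  also have "g \<circ> (\<lambda>t. t + - 1) = g" using per by (simp add: o_def)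
  finally show ?thesis by (simp add: circle_mean_def g_def)
qed

text \<open>Schwarz reflection: extended oddly to the disc, \<open>f\<close> has the mean value property also at the
  real points, where all circle means vanish.\<close>

lemma reflected_linear_part:
  assumes \<rho>: "0 < \<rho>" and f: "locally_Re_holomorphic f {z. 0 < Im z \<and> cmod z < \<rho>}"
    and bound: "\<And>z. 0 < Im z \<Longrightarrow> cmod z < \<rho> \<Longrightarrow> \<bar>f z\<bar> \<le> C * Im z"
  obtains c where "((\<lambda>z. (f z - c * Im z) / cmod z) \<longlongrightarrow> 0) (inf (at 0) (principal {z. 0 < Im z}))"
proof -
  define U where "U = {z. 0 < Im z \<and> cmod z < \<rho>}"
  define g where "g z = (if 0 < Im z then f z else if Im z < 0 then - f (cnj z) else 0)" for z
  have odd: "g (cnj z) = - g z" for z by (simp add: g_def)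
  have oU: "open U" unfolding U_def by (intro open_Collect_conj open_Collect_less continuous_intros)
  have gU: "locally_Re_holomorphic g U"
    by (rule locally_Re_holomorphic_cong[OF f[folded U_def]]) (simp add: g_def U_def)
  have gL: "locally_Re_holomorphic g (cnj ` U)"
    by (rule locally_Re_holomorphic_cong[OF locally_Re_holomorphic_uminus[OF locally_Re_holomorphic_cnj[OF f[folded U_def]]]])
       (auto simp: g_def U_def)
  have UL: "z \<in> U \<union> cnj ` U" if "z \<in> ball 0 \<rho>" "Im z \<noteq> 0" for z
  proof (cases "0 < Im z")
    case False
    hence "cnj z \<in> U" using that by (simp add: U_def)
    thus ?thesis by (metis UnCI complex_cnj_cnj imageI)
  qed (use that in \<open>simp add: U_def\<close>)
  \<comment> \<open>The bound by |Im z| makes the odd extension continuous across the real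
    axis.\<close>
  have gb: "\<bar>g z\<bar> \<le> C * \<bar>Im z\<bar>" if "z \<in> ball 0 \<rho>" for z
    using bound[of z] bound[of "cnj z"] that by (auto simp: g_def)
  have cont: "continuous_on (ball 0 \<rho>) g"
    unfolding continuous_on_eq_continuous_at[OF open_ball]
  proof
    fix z :: complex assume z: "z \<in> ball 0 \<rho>"
    show "isCont g z"
    proof (cases "Im z = 0")
      case True
      have "((\<lambda>w. C * \<bar>Im w\<bar>) \<longlongrightarrow> C * \<bar>Im z\<bar>) (at z)" by (intro tendsto_intros)
      hence "((\<lambda>w. C * \<bar>Im w\<bar>) \<longlongrightarrow> 0) (at z)" using True by simp
      moreover have "\<forall>\<^sub>F w in at z. w \<in> ball 0 \<rho>"
        using eventually_at_topological z open_ball by blast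
      hence "\<forall>\<^sub>F w in at z. norm (g w) \<le> C * \<bar>Im w\<bar>"
        by eventually_elim (use gb in auto)
      ultimately have "(g \<longlongrightarrow> 0) (at z)" by (rule Lim_null_comparison[rotated])
      thus ?thesis using True by (simp add: isCont_def g_def)
    next
      case False
      hence "z \<in> U \<or> z \<in> cnj ` U" using UL[OF z] by blast
      thus ?thesis
        using locally_Re_holomorphic_imp_continuous[OF gU] locally_Re_holomorphic_imp_continuous[OF gL]
          oU locally_Re_holomorphic_imp_open[OF gL] by (auto simp: continuous_on_eq_continuous_at)
    qed
  qed
  have mean: "\<exists>s>0. ball z s \<subseteq> ball 0 \<rho> \<and> (\<forall>r. 0 < r \<and> r < s \<longrightarrow> circle_mean g z r = g z)"
    if z: "z \<in> ball 0 \<rho>" for z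
  proof (cases "Im z = 0")
    case True
    have gz: "g z = 0" using True by (simp add: g_def)
    obtain s where s: "s > 0" "ball z s \<subseteq> ball 0 \<rho>" using z open_contains_ball[of "ball 0 \<rho>"] by blast
    have "circle_mean g z r = g z" if "0 < r" "r < s" for r
      unfolding gz using that s(2) sphere_subset_ball[of r s z]
      by (intro circle_mean_odd odd True continuous_on_subset[OF cont]) auto
    thus ?thesis using s by blast
  next
    case False
    have *: ?thesis if S: "locally_Re_holomorphic g S" "S \<subseteq> ball 0 \<rho>" "z \<in> S" for S
    proof -
      obtain s where s: "s > 0" "cball z s \<subseteq> S"
        using S(3) locally_Re_holomorphic_imp_open[OF S(1)] open_contains_cball by blast
      have "circle_mean g z r = g z" if "0 < r" "r < s" for r
        by (rule locally_Re_holomorphic_circle_mean[OF S(1)]) (use that s in auto)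
      moreover have "ball z s \<subseteq> ball 0 \<rho>" using s(2) S(2) ball_subset_cball by blast
      ultimately show ?thesis using s(1) by blast
    qed
    have "U \<subseteq> ball 0 \<rho>" "cnj ` U \<subseteq> ball 0 \<rho>" by (auto simp: U_def)
    thus ?thesis using UL[OF z False] *[OF gU] *[OF gL] by blast
  qed
  have "supermean_on g (ball 0 \<rho>)" "supermean_on (\<lambda>z. - g z) (ball 0 \<rho>)"
    unfolding supermean_on_def circle_mean_uminus
    using mean cont by (auto intro!: continuous_intros simp del: mem_ball) (metis order_refl)+
  hence gh: "locally_Re_holomorphic g (ball 0 \<rho>)" by (rule supermean_imp_locally_Re_holomorphic)
  have z0: "(0 :: complex) \<in> ball 0 \<rho>" using \<rho> by simp
  obtain s F where F: "s > 0" "F holomorphic_on ball 0 s" "\<And>w. w \<in> ball 0 s \<Longrightarrow> g w = Re (F w)"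
  proof (rule locally_Re_holomorphicE[OF gh z0])
    fix s F assume "s > 0" "F holomorphic_on ball 0 s" "\<And>w. w \<in> ball 0 s \<Longrightarrow> g w = Re (F w)"
    thus thesis by (rule that)
  qed
  define a c where "a = Re (deriv F 0)" and "c = Re (\<i> * deriv F 0)"
  have der: "(g has_derivative (\<lambda>h. a * Re h + c * Im h)) (at 0)"
    unfolding a_def c_def by (rule Re_holomorphic_has_derivative[OF F(2,3)]) (use F(1) in auto)
  \<comment> \<open>The derivative in the real direction is 0, since \<open>g\<close> vanishes on
    the real axis; only the term c Im h is left.\<close>
  have "DERIV (\<lambda>t. g (0 + complex_of_real t)) 0 :> a"
    by (rule DERIV_along_Re) (use der in simp)
  moreover have "DERIV (\<lambda>t. g (0 + complex_of_real t)) 0 :> 0" by (simp add: g_def)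
  ultimately have "a = 0" by (rule DERIV_unique)
  hence "((\<lambda>h. norm (g (0 + h) - g 0 - c * Im h) / norm h) \<longlongrightarrow> 0) (at 0)"
    using der unfolding has_derivative_at by simp
  hence "((\<lambda>h. \<bar>(g h - c * Im h) / cmod h\<bar>) \<longlongrightarrow> 0) (at 0)" by (simp add: g_def)
  hence "((\<lambda>h. (g h - c * Im h) / cmod h) \<longlongrightarrow> 0) (at 0)" by (rule tendsto_rabs_zero_cancel)
  hence "((\<lambda>h. (g h - c * Im h) / cmod h) \<longlongrightarrow> 0) (inf (at 0) (principal {z. 0 < Im z}))"
    by (rule tendsto_mono[rotated]) simp
  moreover have "\<forall>\<^sub>F z in inf (at 0) (principal {z. 0 < Im z}). (g z - c * Im z) / cmod z = (f z - c * Im z) / cmod z"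
    by (simp add: eventually_inf_principal g_def)
  ultimately have "((\<lambda>z. (f z - c * Im z) / cmod z) \<longlongrightarrow> 0) (inf (at 0) (principal {z. 0 < Im z}))"
    by (rule Lim_transform_eventually)
  thus thesis by (rule that)
qed

text \<open>The map \<zeta> = -1/z carries the half-plane near infinity to a half-disc at 0, with Im
  \<zeta> = Im z / |z|^2, so the linear term c Im \<zeta> at 0 is the leading term of
  \<open>u\<close> at infinity.\<close>

lemma expansion_at_infinity:
  assumes R: "0 < R" and u: "locally_Re_holomorphic u {z. 0 < Im z \<and> R < cmod z}"
    and bound: "\<And>z. 0 < Im z \<Longrightarrow> R < cmod z \<Longrightarrow> \<bar>u z\<bar> \<le> C * Im z / (cmod z)\<^sup>2"
  obtains c where "((\<lambda>z. (u z - c * Im z / (cmod z)\<^sup>2) * cmod z) \<longlongrightarrow> 0)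
    (inf at_infinity (principal upper_half_plane))"
proof -
  define f where "f \<zeta> = u (- 1 / \<zeta>)" for \<zeta>
  have im: "Im (- 1 / \<zeta>) = Im \<zeta> / (cmod \<zeta>)\<^sup>2" for \<zeta>
    by (simp add: Im_divide cmod_power2)
  have mod: "cmod (- 1 / \<zeta>) = 1 / cmod \<zeta>" for \<zeta> by (simp add: norm_divide)
  have pos: "0 < cmod \<zeta>" if "0 < Im \<zeta>" for \<zeta> using that by (metis less_irrefl zero_complex.sel(2) zero_less_norm_iff)
  have mapsto: "0 < Im (- 1 / \<zeta>)" "R < cmod (- 1 / \<zeta>)" if "0 < Im \<zeta>" "cmod \<zeta> < 1 / R" for \<zeta>
  proof -
    show "0 < Im (- 1 / \<zeta>)" unfolding im using that pos by simp
    have "R * cmod \<zeta> < 1" using that(2) R by (simp add: field_simps)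
    thus "R < cmod (- 1 / \<zeta>)" unfolding mod using pos[OF that(1)] by (simp add: field_simps)
  qed
  have f: "locally_Re_holomorphic f {z. 0 < Im z \<and> cmod z < 1 / R}"
    unfolding f_def
  proof (rule locally_Re_holomorphic_compose[OF u])
    show "open {z. 0 < Im z \<and> cmod z < 1 / R}"
      by (intro open_Collect_conj open_Collect_less continuous_intros)
    show "(\<lambda>\<zeta>. - 1 / \<zeta>) holomorphic_on {z. 0 < Im z \<and> cmod z < 1 / R}"
      by (intro holomorphic_intros) auto
  qed (use mapsto in auto)
  have fb: "\<bar>f \<zeta>\<bar> \<le> C * Im \<zeta>" if "0 < Im \<zeta>" "cmod \<zeta> < 1 / R" for \<zeta>
    using bound[OF mapsto[OF that]] pos[OF that(1)] unfolding f_def[symmetric] im mod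
    by (simp add: power_divide)
  obtain c where c: "((\<lambda>z. (f z - c * Im z) / cmod z) \<longlongrightarrow> 0) (inf (at 0) (principal {z. 0 < Im z}))"
    using reflected_linear_part[OF _ f fb] R by auto
  have "filterlim (\<lambda>z. - 1 / z :: complex) (inf (at 0) (principal {z. 0 < Im z})) (inf at_infinity (principal upper_half_plane))"
    unfolding filterlim_inf filterlim_principal
  proof
    have "((\<lambda>z. - 1 / z :: complex) \<longlongrightarrow> 0) at_infinity"
      by (intro tendsto_divide_0[OF tendsto_const] filterlim_ident)
    hence "((\<lambda>z. - 1 / z :: complex) \<longlongrightarrow> 0) (inf at_infinity (principal upper_half_plane))"
      by (rule tendsto_mono[rotated]) simp
    moreover have "\<forall>\<^sub>F z in inf at_infinity (principal upper_half_plane). - 1 / z \<noteq> 0"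
      by (auto simp: eventually_inf_principal upper_half_plane_def intro!: always_eventually)
    ultimately show "filterlim (\<lambda>z. - 1 / z :: complex) (at 0) (inf at_infinity (principal upper_half_plane))"
      by (simp add: filterlim_at)
    show "\<forall>\<^sub>F z in inf at_infinity (principal upper_half_plane). - 1 / z \<in> {z. 0 < Im z}"
      unfolding eventually_inf_principal
    proof (intro always_eventually allI impI)
      fix z assume "z \<in> upper_half_plane"
      hence "0 < Im z" by (simp add: upper_half_plane_def)
      hence "0 < Im (- 1 / z)" unfolding im using pos by simp
      thus "- 1 / z \<in> {z. 0 < Im z}" by blast
    qed
  qed
  from filterlim_compose[OF c this]
  have "((\<lambda>z. (f (- 1 / z) - c * Im (- 1 / z)) / cmod (- 1 / z)) \<longlongrightarrow> 0) (inf at_infinity (principal upper_half_plane))" .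
  moreover have "(f (- 1 / z) - c * Im (- 1 / z)) / cmod (- 1 / z) = (u z - c * Im z / (cmod z)\<^sup>2) * cmod z" for z
    unfolding im mod by (cases "z = 0") (simp_all add: f_def)
  ultimately have "((\<lambda>z. (u z - c * Im z / (cmod z)\<^sup>2) * cmod z) \<longlongrightarrow> 0) (inf at_infinity (principal upper_half_plane))"
    by simp
  thus thesis by (rule that)
qed

section \<open>Comparison of the two capacities\<close>

text \<open>From below 1 - y \<le> exp (-y); from above exp (-x) \<le> 1 / (1 + x) \<le> 1 - x + x^2
  for x \<ge> 0. The square is harmless because x is of order at most 1 / r^2.\<close>

lemma tendsto_exp_minus_1_rescaled:
  fixes q r x y :: "'a \<Rightarrow> real"
  assumes r: "filterlim r at_top F"
    and x: "((\<lambda>t. x t * (r t)\<^sup>2) \<longlongrightarrow> l) F" and y: "((\<lambda>t. y t * (r t)\<^sup>2) \<longlongrightarrow> l) F"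
    and x0: "\<forall>\<^sub>F t in F. 0 \<le> x t"
    and q: "\<forall>\<^sub>F t in F. exp (- y t) \<le> q t \<and> q t \<le> exp (- x t)"
  shows "((\<lambda>t. (q t - 1) * (r t)\<^sup>2) \<longlongrightarrow> - l) F"
proof (rule tendsto_sandwich)
  show "((\<lambda>t. - (y t * (r t)\<^sup>2)) \<longlongrightarrow> - l) F" by (intro tendsto_minus y)
  have "filterlim (\<lambda>t. (r t)\<^sup>2) at_top F" by (rule filterlim_pow_at_top[OF _ r]) simp
  hence "((\<lambda>t. (x t * (r t)\<^sup>2)\<^sup>2 / (r t)\<^sup>2) \<longlongrightarrow> 0) F"
    by (intro tendsto_divide_0[OF tendsto_power[OF x]] filterlim_at_top_imp_at_infinity)
  hence "((\<lambda>t. - (x t * (r t)\<^sup>2) + (x t * (r t)\<^sup>2)\<^sup>2 / (r t)\<^sup>2) \<longlongrightarrow> - l + 0) F"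
    by (intro tendsto_add tendsto_minus x)
  thus "((\<lambda>t. - (x t * (r t)\<^sup>2) + (x t * (r t)\<^sup>2)\<^sup>2 / (r t)\<^sup>2) \<longlongrightarrow> - l) F" by simp
  show "\<forall>\<^sub>F t in F. - (y t * (r t)\<^sup>2) \<le> (q t - 1) * (r t)\<^sup>2"
    using q
  proof eventually_elim
    case (elim t)
    have "- y t \<le> q t - 1" using elim exp_ge_add_one_self[of "- y t"] by linarith
    hence "- y t * (r t)\<^sup>2 \<le> (q t - 1) * (r t)\<^sup>2" by (rule mult_right_mono) simp
    thus ?case by simp
  qed
  show "\<forall>\<^sub>F t in F. (q t - 1) * (r t)\<^sup>2 \<le> - (x t * (r t)\<^sup>2) + (x t * (r t)\<^sup>2)\<^sup>2 / (r t)\<^sup>2"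
    using q x0 eventually_compose_filterlim[OF eventually_gt_at_top[of 0] r]
  proof eventually_elim
    case (elim t)
    have "exp (- x t) = 1 / exp (x t)" by (simp add: exp_minus divide_inverse)
    also have "\<dots> \<le> 1 / (1 + x t)" using elim exp_ge_add_one_self[of "x t"] by (intro divide_left_mono) auto
    also have "\<dots> \<le> 1 - x t + (x t)\<^sup>2"
    proof -
      have "(1 - x t + (x t)\<^sup>2) * (1 + x t) = 1 + (x t)^3"
        by (simp add: algebra_simps power2_eq_square power3_eq_cube)
      thus ?thesis using elim by (simp add: pos_divide_le_eq)
    qed
    finally have "q t - 1 \<le> - x t + (x t)\<^sup>2" using elim by linarith
    hence "(q t - 1) * (r t)\<^sup>2 \<le> (- x t + (x t)\<^sup>2) * (r t)\<^sup>2" by (rule mult_right_mono) simp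
    also have "\<dots> = - (x t * (r t)\<^sup>2) + (x t * (r t)\<^sup>2)\<^sup>2 / (r t)\<^sup>2"
      using elim by (simp add: algebra_simps power2_eq_square)
    finally show ?case .
  qed
qed

text \<open>The third conclusion restates perpendicularity: sgn (1 / w) is the conjugate of sgn w,
  so minus its imaginary part is Im w / |w|.\<close>

lemma perpendicular_arcD:
  assumes "perpendicular_arc_to_infinity \<gamma>"
  shows "\<forall>\<^sub>F t in at_left 1. \<gamma> t \<in> upper_half_plane"
    and "filterlim (\<lambda>t. cmod (\<gamma> t)) at_top (at_left 1)"
    and "((\<lambda>t. Im (\<gamma> t) / cmod (\<gamma> t)) \<longlongrightarrow> 1) (at_left 1)"
proof -
  have mem: "\<gamma> t \<in> upper_half_plane" if "0 \<le> t" "t < 1" for t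
    using assms that by (auto simp: perpendicular_arc_to_infinity_def)
  have near: "\<forall>\<^sub>F t in at_left 1. t \<in> {0<..<1::real}"
    by (rule eventually_at_leftI[of 0]) auto
  show ev: "\<forall>\<^sub>F t in at_left 1. \<gamma> t \<in> upper_half_plane"
    using near by eventually_elim (use mem in auto)
  let ?p = "\<lambda>t. if t = 1 then 0 else 1 / \<gamma> t"
  have "continuous_on {0..1} ?p"
    using assms by (auto simp: perpendicular_arc_to_infinity_def arc_def path_def)
  hence "(?p \<longlongrightarrow> ?p 1) (at 1 within {0..1})"
    unfolding continuous_on_def by (rule bspec) simp
  hence "(?p \<longlongrightarrow> 0) (at_left 1)"
    by (simp add: at_within_Icc_at_left)
  moreover have "\<forall>\<^sub>F t in at_left 1. ?p t = 1 / \<gamma> t" using near by eventually_elim auto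
  ultimately have lim0: "((\<lambda>t. 1 / \<gamma> t) \<longlongrightarrow> 0) (at_left 1)" by (rule Lim_transform_eventually)
  have ne: "\<forall>\<^sub>F t in at_left 1. \<gamma> t \<noteq> 0" using ev by eventually_elim (auto simp: upper_half_plane_def)
  have "((\<lambda>t. cmod (1 / \<gamma> t)) \<longlongrightarrow> 0) (at_left 1)" using lim0 by (rule tendsto_norm_zero)
  hence "((\<lambda>t. inverse (cmod (\<gamma> t))) \<longlongrightarrow> 0) (at_left 1)" by (simp add: norm_inverse divide_inverse)
  moreover have "\<forall>\<^sub>F t in at_left 1. 0 < inverse (cmod (\<gamma> t))" using ne by eventually_elim simp
  ultimately have "filterlim (\<lambda>t. inverse (inverse (cmod (\<gamma> t)))) at_top (at_left 1)"
    by (rule filterlim_inverse_at_top)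
  thus "filterlim (\<lambda>t. cmod (\<gamma> t)) at_top (at_left 1)" by simp
  have "((\<lambda>t. Im (sgn (1 / \<gamma> t))) \<longlongrightarrow> Im (- \<i>)) (at_left 1)"
    using assms unfolding perpendicular_arc_to_infinity_def by (intro tendsto_Im) auto
  hence "((\<lambda>t. - Im (sgn (1 / \<gamma> t))) \<longlongrightarrow> 1) (at_left 1)" using tendsto_minus by fastforce
  moreover have "- Im (sgn (1 / w)) = Im w / cmod w" for w
  proof (cases "w = 0")
    case False
    have "Im (1 / w) = - Im w / (cmod w)\<^sup>2" by (simp add: Im_divide cmod_power2)
    thus ?thesis using False unfolding Im_sgn by (simp add: norm_divide power2_eq_square del: Im_divide)
  qed simp
  ultimately show "((\<lambda>t. Im (\<gamma> t) / cmod (\<gamma> t)) \<longlongrightarrow> 1) (at_left 1)" by simp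
qed

text \<open>A vertical ray, whose image is the segment from -i to 0. Uniqueness of the relative
  capacity requires at least one admissible arc.\<close>

lemma perpendicular_arc_exists: "perpendicular_arc_to_infinity (\<lambda>t. \<i> / of_real (1 - t))"
  unfolding perpendicular_arc_to_infinity_def
proof (intro conjI)
  show "(\<lambda>t. \<i> / of_real (1 - t)) ` {0..<1} \<subseteq> upper_half_plane"
    by (auto simp: upper_half_plane_def Im_divide_of_real simp del: of_real_diff)
  have inv: "1 / (\<i> / of_real (1 - t)) = of_real (1 - t) * (- \<i>)" for t :: real
    by (simp add: divide_inverse mult.commute)
  have "(\<lambda>t. if t = 1 then 0 else 1 / (\<i> / of_real (1 - t))) = linepath (- \<i>) 0"
    unfolding inv by (auto simp: linepath_def fun_eq_iff scaleR_conv_of_real)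
  thus "arc (\<lambda>t. if t = 1 then 0 else 1 / (\<i> / of_real (1 - t)))" by (simp only: arc_linepath) simp
  have "sgn (1 / (\<i> / of_real (1 - t))) = - \<i>" if "t < 1" for t :: real
    unfolding inv using that by (simp add: sgn_mult sgn_of_real sgn_eq[of "\<i>"] del: of_real_diff)
  hence "\<forall>\<^sub>F t in at_left 1. sgn (1 / (\<i> / of_real (1 - t))) = - \<i>"
    by (auto simp: eventually_at_filter)
  thus "((\<lambda>t. sgn (1 / (\<i> / of_real (1 - t)))) \<longlongrightarrow> - \<i>) (at_left 1)" by (rule tendsto_eventually)
qed

text \<open>Along one admissible arc the two error terms, divided by |1/z|^2, differ by the constant
  2 (c - c'), and both quotients tend to 0.\<close>

lemma relcap_expansion_unique:
  assumes "relcap_expansion E c" "relcap_expansion E c'"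
  shows "c = c'"
proof -
  define \<gamma> where "\<gamma> t = \<i> / complex_of_real (1 - t)" for t
  have \<gamma>: "perpendicular_arc_to_infinity \<gamma>" unfolding \<gamma>_def[abs_def] by (rule perpendicular_arc_exists)
  define \<rho> where "\<rho> t = inner_radius (upper_half_plane - E) (\<gamma> t) / inner_radius upper_half_plane (\<gamma> t)" for t
  let ?g = "\<lambda>t. (cmod (1 / \<gamma> t))\<^sup>2"
  have o: "(\<lambda>t. \<rho> t - (1 - 2 * c * ?g t)) \<in> o[at_left 1](?g)" "(\<lambda>t. \<rho> t - (1 - 2 * c' * ?g t)) \<in> o[at_left 1](?g)"
    using assms \<gamma> unfolding relcap_expansion_def \<rho>_def by blast+
  have "((\<lambda>t. (\<rho> t - (1 - 2 * c * ?g t)) / ?g t - (\<rho> t - (1 - 2 * c' * ?g t)) / ?g t) \<longlongrightarrow> 0 - 0) (at_left 1)"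
    by (intro tendsto_diff smalloD_tendsto o)
  moreover have "\<forall>\<^sub>F t in at_left 1. (\<rho> t - (1 - 2 * c * ?g t)) / ?g t - (\<rho> t - (1 - 2 * c' * ?g t)) / ?g t = 2 * (c - c')"
    using perpendicular_arcD(1)[OF \<gamma>]
  proof eventually_elim
    case (elim t)
    hence "\<gamma> t \<noteq> 0" by (auto simp: upper_half_plane_def)
    hence g: "?g t \<noteq> 0" by simp
    have "(\<rho> t - (1 - 2 * c * G)) / G - (\<rho> t - (1 - 2 * c' * G)) / G = 2 * (c - c')" if "G \<noteq> 0" for G
      using that by (simp add: diff_divide_distrib[symmetric]) (simp add: field_simps)
    from this[OF g] show ?case .
  qed
  ultimately have "((\<lambda>_::real. 2 * (c - c')) \<longlongrightarrow> 0) (at_left 1)"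
    by (auto elim: Lim_transform_eventually)
  thus ?thesis by (simp add: tendsto_const_iff)
qed

lemma filterlim_imaginary_axis:
  assumes "bounded E"
  shows "filterlim (\<lambda>y. \<i> * complex_of_real y) (inf at_infinity (principal (upper_half_plane - E))) at_top"
  unfolding filterlim_inf filterlim_principal
proof
  show "filterlim (\<lambda>y. \<i> * complex_of_real y) at_infinity at_top"
    by (intro tendsto_mult_filterlim_at_infinity[OF tendsto_const] filterlim_of_real_at_infinity) auto
  obtain b where b: "\<And>w. w \<in> E \<Longrightarrow> cmod w \<le> b" using assms bounded_iff by blast
  show "\<forall>\<^sub>F y in at_top. \<i> * complex_of_real y \<in> upper_half_plane - E"
    using eventually_gt_at_top[of "max 0 b"]
  proof eventually_elim
    case (elim y)
    thus ?case using b[of "\<i> * complex_of_real y"] by (auto simp: upper_half_plane_def norm_mult)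
  qed
qed

text \<open>On the imaginary axis the two error terms differ by (c - c') / y, and multiplication by
  y leaves a constant that tends to 0. Boundedness of \<open>E\<close> puts the axis into the domain
  near infinity.\<close>

lemma hcap_expansion_unique:
  assumes "bounded E" "hcap_expansion M B E c" "hcap_expansion M B E c'"
  shows "c = c'"
proof -
  define F where "F = inf at_infinity (principal (upper_half_plane - E))"
  define f where "f c z = phi M B (upper_half_plane - E) z - Im (z + complex_of_real c / z)" for c z
  have "((\<lambda>z. f c z / (1 / cmod z) - f c' z / (1 / cmod z)) \<longlongrightarrow> 0 - 0) F"
    using assms(2,3) unfolding hcap_expansion_def F_def f_def by (intro tendsto_diff smalloD_tendsto)
  hence "((\<lambda>y. f c (\<i> * of_real y) / (1 / cmod (\<i> * of_real y)) - f c' (\<i> * of_real y) / (1 / cmod (\<i> * of_real y))) \<longlongrightarrow> 0 - 0) at_top"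
    unfolding F_def by (rule filterlim_compose[OF _ filterlim_imaginary_axis[OF assms(1)]])
  moreover have "\<forall>\<^sub>F y in at_top. f c (\<i> * of_real y) / (1 / cmod (\<i> * of_real y)) - f c' (\<i> * of_real y) / (1 / cmod (\<i> * of_real y)) = c - c'"
    using eventually_gt_at_top[of 0]
  proof eventually_elim
    case (elim y)
    have "f c (\<i> * of_real y) - f c' (\<i> * of_real y) = (c - c') / y"
      using elim by (simp add: f_def Im_divide power2_eq_square field_simps)
    thus ?case using elim by (simp add: norm_mult left_diff_distrib[symmetric])
  qed
  ultimately have "((\<lambda>_::real. c - c') \<longlongrightarrow> 0) at_top"
    by (auto elim: Lim_transform_eventually)
  thus ?thesis by (simp add: tendsto_const_iff)
qed

theorem common_expansion:
  fixes M :: "complex \<Rightarrow> 'w measure"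
  assumes bm: "\<And>z. planar_brownian_motion z (M z) (B z)"
    and bdd: "bounded E"
    and closed: "closedin (top_of_set upper_half_plane) E"
  obtains c where "relcap_expansion E c" "hcap_expansion M B E c"
proof -
  let ?H = upper_half_plane
  define G where "G = ?H - E"
  have G: "open G" "G \<subseteq> ?H" using open_half_plane_minus[OF closed] by (auto simp: G_def)
  obtain R where R: "0 < R" and ER: "\<And>w. w \<in> E \<Longrightarrow> cmod w \<le> R" using bdd by (auto simp: bounded_pos)
  have inE: "w \<in> E" if "w \<in> ?H" "w \<notin> G" for w using that by (simp add: G_def)
  have far: "w \<in> G" if "w \<in> ?H" "R < cmod w" for w using that ER[of w] by (auto simp: G_def)
  have sm: "supermean_on (cutoff_height R) G"
    by (rule supermean_on_subset[OF supermean_on_cutoff_height[OF R] G])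
  obtain v :: "nat \<Rightarrow> complex \<Rightarrow> real" and V where v:
    "\<And>n. continuous_on UNIV (v n)" "\<And>n. supermean_on (v n) G"
    "\<And>n w. 0 \<le> v n w" "\<And>n w. v n w \<le> cutoff_height R w"
    "\<And>n w. w \<notin> G \<Longrightarrow> v n w = cutoff_height R w"
    "\<And>w. (\<lambda>n. v n w) \<longlonglongrightarrow> V w"
    "locally_Re_holomorphic V G"
    using sweeping_out[OF G(1) continuous_on_cutoff_height[OF R] sm cutoff_height_nonneg] by metis
  have V0: "0 \<le> V w" for w using v(6)[of w] v(3) by (intro LIMSEQ_le_const) auto
  have Vle: "V w \<le> cutoff_height R w" for w using v(6)[of w] v(4) by (intro LIMSEQ_le_const2) auto
  have exit: "(\<integral>\<omega>. Im (exit_position G (B z) \<omega>) \<partial>M z) = V z" if "z \<in> G" for z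
    by (rule expected_exit_height[OF bm R G that _ v]) (use ER inE in auto)
  \<comment> \<open>The truncated height supplies the bound R^2 Im z / |z|^2 that the reflection at
    infinity demands; its cutoff radius is the bound \<open>R\<close> for \<open>E\<close>.\<close>
  obtain c where c: "((\<lambda>z. (V z - c * Im z / (cmod z)\<^sup>2) * cmod z) \<longlongrightarrow> 0) (inf at_infinity (principal ?H))"
  proof (rule expansion_at_infinity[OF R])
    show "locally_Re_holomorphic V {z. 0 < Im z \<and> R < cmod z}"
    proof (rule locally_Re_holomorphic_subset[OF v(7)])
      show "open {z. 0 < Im z \<and> R < cmod z}"
        by (intro open_Collect_conj open_Collect_less continuous_intros)
    qed (auto intro: far simp: upper_half_plane_def)
    show "\<bar>V z\<bar> \<le> R\<^sup>2 * Im z / (cmod z)\<^sup>2" if "0 < Im z" "R < cmod z" for z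
      using V0[of z] Vle[of z] that by (simp add: cutoff_height_outside mult.commute)
  qed
  have "hcap_expansion M B E c"
    unfolding hcap_expansion_def G_def[symmetric]
  proof (rule smalloI_tendsto)
    have "((\<lambda>z. (V z - c * Im z / (cmod z)\<^sup>2) * cmod z) \<longlongrightarrow> 0) (inf at_infinity (principal G))"
      using c by (rule tendsto_mono[rotated]) (intro inf_mono order_refl, simp add: G(2))
    hence "((\<lambda>z. - ((V z - c * Im z / (cmod z)\<^sup>2) * cmod z)) \<longlongrightarrow> - 0) (inf at_infinity (principal G))"
      by (rule tendsto_minus)
    moreover have "\<forall>\<^sub>F z in inf at_infinity (principal G).
      - ((V z - c * Im z / (cmod z)\<^sup>2) * cmod z) = (phi M B G z - Im (z + complex_of_real c / z)) / (1 / cmod z)"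
      unfolding eventually_inf_principal
    proof (intro always_eventually allI impI)
      fix z assume z: "z \<in> G"
      \<comment> \<open>This minus sign matches the one in phi = Im z - V, so the coefficient is c
        itself.\<close>
      have "Im (complex_of_real c / z) = - c * Im z / (cmod z)\<^sup>2" by (simp add: Im_divide cmod_power2)
      hence "phi M B G z - Im (z + complex_of_real c / z) = - (V z - c * Im z / (cmod z)\<^sup>2)"
        using exit[OF z] by (simp add: phi_def)
      thus "- ((V z - c * Im z / (cmod z)\<^sup>2) * cmod z) = (phi M B G z - Im (z + complex_of_real c / z)) / (1 / cmod z)"
        by (simp only: divide_divide_eq_right div_by_1 mult_minus_left)
    qed
    ultimately show "((\<lambda>z. (phi M B G z - Im (z + complex_of_real c / z)) / (1 / cmod z)) \<longlongrightarrow> 0) (inf at_infinity (principal G))"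
      by (auto elim: Lim_transform_eventually)
    show "\<forall>\<^sub>F z in inf at_infinity (principal G). 1 / cmod z \<noteq> 0"
      using G(2) by (auto simp: eventually_inf_principal upper_half_plane_def intro!: always_eventually)
  qed
  moreover have "relcap_expansion E c"
    unfolding relcap_expansion_def
  proof (intro allI impI)
    fix \<gamma> assume "perpendicular_arc_to_infinity \<gamma>"
    note \<gamma> = perpendicular_arcD[OF this]
    define r where "r t = cmod (\<gamma> t)" for t
    \<comment> \<open>On \<open>E\<close> there is |w| \<le> R, hence |w - cnj z| \<le> r + R and |w
      - z| \<ge> r - R; these turn the two bounds on \<open>green_half_plane\<close> into multiples
      of Im w.\<close>
    define \<alpha> \<beta> where "\<alpha> t = 2 * Im (\<gamma> t) / (r t + R)\<^sup>2" and "\<beta> t = 2 * Im (\<gamma> t) / (r t - R)\<^sup>2" for t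
    define \<rho> where "\<rho> t = inner_radius G (\<gamma> t) / inner_radius ?H (\<gamma> t)" for t
    have r: "filterlim r at_top (at_left 1)" using \<gamma>(2) unfolding r_def[abs_def] .
    have rR: "\<forall>\<^sub>F t in at_left 1. R < r t" using r by (simp add: filterlim_at_top_dense)
    have bounds: "\<forall>\<^sub>F t in at_left 1. exp (- (\<beta> t * V (\<gamma> t))) \<le> \<rho> t \<and> \<rho> t \<le> exp (- (\<alpha> t * V (\<gamma> t)))"
      using \<gamma>(1) rR
    proof eventually_elim
      case (elim t)
      define z where "z = \<gamma> t"
      have zH: "z \<in> ?H" and zR: "R < cmod z" using elim by (auto simp: z_def r_def)
      have zG: "z \<in> G" by (rule far[OF zH zR])
      have im: "0 < Im z" using zH by (simp add: upper_half_plane_def)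
      have E: "\<alpha> t * Im w \<le> green_half_plane w z \<and> green_half_plane w z \<le> \<beta> t * Im w" if w: "w \<in> ?H" "w \<notin> G" for w
      proof -
        have wR: "cmod w \<le> R" using ER[OF inE[OF w]] .
        have wz: "w \<noteq> z" using w zG by blast
        have imw: "0 < Im w" using w by (simp add: upper_half_plane_def)
        have "w \<noteq> cnj z" using im imw by auto
        hence pos: "0 < cmod (w - cnj z)" by simp
        have "cmod (w - cnj z) \<le> cmod z + R" using norm_triangle_ineq4[of w "cnj z"] wR by simp
        hence "(cmod (w - cnj z))\<^sup>2 \<le> (cmod z + R)\<^sup>2" by (intro power_mono) auto
        hence "2 * Im w * Im z / (cmod z + R)\<^sup>2 \<le> 2 * Im w * Im z / (cmod (w - cnj z))\<^sup>2"
          using pos im imw by (intro frac_le) auto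
        also have "\<dots> \<le> green_half_plane w z" by (rule green_half_plane_bounds(1)[OF w(1) zH wz])
        finally have 1: "\<alpha> t * Im w \<le> green_half_plane w z" by (simp add: \<alpha>_def r_def z_def mult_ac)
        have "cmod z - R \<le> cmod (w - z)" using norm_triangle_ineq2[of z w] wR by (simp add: norm_minus_commute)
        hence "(cmod z - R)\<^sup>2 \<le> (cmod (w - z))\<^sup>2" using zR by (intro power_mono) auto
        hence "2 * Im w * Im z / (cmod (w - z))\<^sup>2 \<le> 2 * Im w * Im z / (cmod z - R)\<^sup>2"
          using im imw zR by (intro frac_le) auto
        with green_half_plane_bounds(2)[OF w(1) zH wz]
        have "green_half_plane w z \<le> \<beta> t * Im w" by (simp add: \<beta>_def r_def z_def mult_ac)
        with 1 show ?thesis by blast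
      qed
      have \<alpha>0: "0 \<le> \<alpha> t" and \<beta>0: "0 \<le> \<beta> t" using im by (simp_all add: \<alpha>_def \<beta>_def z_def)
      have up: "\<alpha> t * V w \<le> green_half_plane w z" if "w \<in> G" "w \<noteq> z" for w
        by (rule multiple_le_green_half_plane[OF G zG R v(7) Vle _ \<alpha>0 that]) (use E ER inE in blast)
      have dn: "green_half_plane w z \<le> \<beta> t * v n w" if w: "w \<in> ?H" "w \<notin> G" for n w
      proof -
        have "v n w = Im w"
          using v(5)[OF w(2)] ER[OF inE[OF w]] R w(1) by (simp add: cutoff_height_inside upper_half_plane_def)
        thus ?thesis using E[OF w] by simp
      qed
      note ir = inner_radius_bounds[OF G zG v(7) v(1,2,3) v(6) \<beta>0 up dn]
      have e: "\<rho> t = inner_radius G z / (2 * Im z)"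
        using inner_radius_upper_half_plane[OF zH] by (simp add: \<rho>_def z_def)
      have "exp (- \<beta> t * V z) \<le> \<rho> t" "\<rho> t \<le> exp (- \<alpha> t * V z)"
        unfolding e using ir im by (simp_all add: pos_le_divide_eq pos_divide_le_eq mult.commute)
      thus ?case by (simp add: z_def)
    qed
    have F: "filterlim \<gamma> (inf at_infinity (principal ?H)) (at_left 1)"
      unfolding filterlim_inf filterlim_principal using \<gamma>(1)
      by (auto intro: filterlim_norm_at_top_imp_at_infinity \<gamma>(2))
    have "((\<lambda>t. (V (\<gamma> t) - c * Im (\<gamma> t) / (r t)\<^sup>2) * r t) \<longlongrightarrow> 0) (at_left 1)"
      using filterlim_compose[OF c F] by (simp add: r_def)
    \<comment> \<open>Perpendicularity enters here: Im / r tends to 1, so V r tends to c.\<close>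
    hence "((\<lambda>t. (V (\<gamma> t) - c * Im (\<gamma> t) / (r t)\<^sup>2) * r t + c * (Im (\<gamma> t) / r t)) \<longlongrightarrow> 0 + c * 1) (at_left 1)"
      using \<gamma>(3) by (intro tendsto_intros) (auto simp: r_def)
    moreover have "\<forall>\<^sub>F t in at_left 1. (V (\<gamma> t) - c * Im (\<gamma> t) / (r t)\<^sup>2) * r t + c * (Im (\<gamma> t) / r t) = V (\<gamma> t) * r t"
      using rR by eventually_elim (use R in \<open>simp add: field_simps power2_eq_square\<close>)
    ultimately have Vr: "((\<lambda>t. V (\<gamma> t) * r t) \<longlongrightarrow> c) (at_left 1)"
      by (auto elim: Lim_transform_eventually)
    have Rr: "((\<lambda>t. R / r t) \<longlongrightarrow> 0) (at_left 1)"
      by (intro tendsto_divide_0[OF tendsto_const] filterlim_at_top_imp_at_infinity r)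
    \<comment> \<open>s = 1 gives \<alpha> and s = -1 gives \<beta>; the shift by R disappears in
      the limit.\<close>
    have scaled: "((\<lambda>t. 2 * Im (\<gamma> t) / (r t + s * R)\<^sup>2 * V (\<gamma> t) * (r t)\<^sup>2) \<longlongrightarrow> 2 * c) (at_left 1)"
      if s: "s = 1 \<or> s = - 1" for s
    proof -
      have "((\<lambda>t. 2 * (Im (\<gamma> t) / r t) / (1 + s * (R / r t))\<^sup>2 * (V (\<gamma> t) * r t)) \<longlongrightarrow> 2 * 1 / (1 + s * 0)\<^sup>2 * c) (at_left 1)"
        using \<gamma>(3) by (intro tendsto_intros Vr Rr) (auto simp: r_def)
      moreover have "\<forall>\<^sub>F t in at_left 1. 2 * (Im (\<gamma> t) / r t) / (1 + s * (R / r t))\<^sup>2 * (V (\<gamma> t) * r t)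
          = 2 * Im (\<gamma> t) / (r t + s * R)\<^sup>2 * V (\<gamma> t) * (r t)\<^sup>2"
        using rR
      proof eventually_elim
        case (elim t)
        hence r0: "r t \<noteq> 0" using R by simp
        have sum: "1 + s * (R / r t) = (r t + s * R) / r t" using r0 by (simp add: field_simps)
        show ?case unfolding sum using r0 by (simp add: power_divide power2_eq_square)
      qed
      ultimately show ?thesis by (auto elim: Lim_transform_eventually)
    qed
    have lim: "((\<lambda>t. (\<rho> t - 1) * (r t)\<^sup>2) \<longlongrightarrow> - (2 * c)) (at_left 1)"
    proof (rule tendsto_exp_minus_1_rescaled[OF r])
      show "((\<lambda>t. \<alpha> t * V (\<gamma> t) * (r t)\<^sup>2) \<longlongrightarrow> 2 * c) (at_left 1)" using scaled[of 1] by (simp add: \<alpha>_def)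
      show "((\<lambda>t. \<beta> t * V (\<gamma> t) * (r t)\<^sup>2) \<longlongrightarrow> 2 * c) (at_left 1)" using scaled[of "-1"] by (simp add: \<beta>_def)
      show "\<forall>\<^sub>F t in at_left 1. 0 \<le> \<alpha> t * V (\<gamma> t)"
        using \<gamma>(1) by eventually_elim (simp add: \<alpha>_def upper_half_plane_def V0)
      show "\<forall>\<^sub>F t in at_left 1. exp (- (\<beta> t * V (\<gamma> t))) \<le> \<rho> t \<and> \<rho> t \<le> exp (- (\<alpha> t * V (\<gamma> t)))" by (rule bounds)
    qed
    show "(\<lambda>t. inner_radius (?H - E) (\<gamma> t) / inner_radius ?H (\<gamma> t) - (1 - 2 * c * (cmod (1 / \<gamma> t))\<^sup>2))
          \<in> o[at_left 1](\<lambda>t. (cmod (1 / \<gamma> t))\<^sup>2)"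
      unfolding G_def[symmetric] \<rho>_def[symmetric]
    proof (rule smalloI_tendsto)
      have "((\<lambda>t. (\<rho> t - 1) * (r t)\<^sup>2 + 2 * c) \<longlongrightarrow> - (2 * c) + 2 * c) (at_left 1)"
        by (intro tendsto_intros lim)
      moreover have "\<forall>\<^sub>F t in at_left 1. (\<rho> t - 1) * (r t)\<^sup>2 + 2 * c = (\<rho> t - (1 - 2 * c * (cmod (1 / \<gamma> t))\<^sup>2)) / (cmod (1 / \<gamma> t))\<^sup>2"
        using rR
      proof eventually_elim
        case (elim t)
        hence r0: "r t \<noteq> 0" using R by simp
        have inv: "cmod (1 / \<gamma> t) = 1 / r t" by (simp add: r_def norm_divide)
        show ?case unfolding inv using r0 by (simp add: field_simps power2_eq_square)
      qed
      ultimately show "((\<lambda>t. (\<rho> t - (1 - 2 * c * (cmod (1 / \<gamma> t))\<^sup>2)) / (cmod (1 / \<gamma> t))\<^sup>2) \<longlongrightarrow> 0) (at_left 1)"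
        by (auto elim: Lim_transform_eventually)
      show "\<forall>\<^sub>F t in at_left 1. (cmod (1 / \<gamma> t))\<^sup>2 \<noteq> 0"
        using \<gamma>(1) by eventually_elim (auto simp: upper_half_plane_def)
    qed
  qed
  ultimately show thesis by (intro that)
qed

text \<open>Both capacities are definite descriptions; unique existence is stated along with the
  equality so that it does not compare unspecified values.\<close>

theorem theorem2p6:
  fixes M :: "complex \<Rightarrow> 'w measure"
    and B :: "complex \<Rightarrow> real \<Rightarrow> 'w \<Rightarrow> complex"
    and E :: "complex set"
  assumes "\<And>z. planar_brownian_motion z (M z) (B z)"
    and "bounded E"
    and "closedin (top_of_set upper_half_plane) E"
  shows "(\<exists>!c. relcap_expansion E c) \<and> (\<exists>!c. hcap_expansion M B E c) \<and> relcap E = hcap M B E"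
proof -
  obtain c where c: "relcap_expansion E c" "hcap_expansion M B E c"
    using common_expansion[OF assms] by blast
  have "relcap E = c" unfolding relcap_def
    by (rule the_equality, rule c(1), rule relcap_expansion_unique[OF _ c(1)])
  moreover have "hcap M B E = c" unfolding hcap_def
    by (rule the_equality, rule c(2), rule hcap_expansion_unique[OF assms(2) _ c(2)])
  ultimately show ?thesis
    using c relcap_expansion_unique hcap_expansion_unique[OF assms(2)] by metis
qed

end
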